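(* Let $d\ge 2$, let $v_1,\ldots,v_n\in\mathbb{R}^d$, $x^0=(x^0_1,\ldots,x^0_n)\in\mathbb{R}^n$, and let $$P(x^0)=\{p\in\mathbb{R}^d \mid v_i^\top p\le x_i^0 \text{ for all } i=1,\ldots,n\}$$ be a $d$-dimensional convex polytope with outer facet normals $v_1,\ldots,v_n$ (one for each facet) and support parameters $x^0_1,\ldots,x^0_n$. Let $G$ be the dual 1-skeleton of $P(x^0)$. Then the $n\times n$ matrix $M$ defined by $$M_{ij}=-\left.\frac{\partial^2 \mathrm{vol}_d(P(x))}{\partial x_i\,\partial x_j}\right|_{x=x^0}$$ is a Colin de Verdière matrix for the graph $G$. The corank of $M$ is equal to $d$. In particular, $\mu(G)\ge d$ for every graph $G$ that can be realized as the 1-skeleton of a $d$-dimensional convex polytope.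
   Context: All polytopes are convex. A facet of a $d$-dimensional polytope is a $(d-1)$-dimensional face. For $x=(x_1,\ldots,x_n)\in\mathbb{R}^n$ put $P(x)=\{p\in\mathbb{R}^d\mid v_i^\top p\le x_i \text{ for all } i\}$. Saying that $P(x)$ has outer facet normals $v_1,\ldots,v_n$ means that $P(x)$ is a $d$-dimensional polytope, that for each $i$ the set $F_i(x)=\{p\in P(x)\mid v_i^\top p=x_i\}$ is a facet, and that these facets are distinct for distinct $i$ (so each facet has exactly one of the $v_i$ as its nonzero outer normal; the $v_i$ need not be unit vectors). The set of $x$ for which this holds is open in $\mathbb{R}^n$, and $x\mapsto \mathrm{vol}_d(P(x))$ is twice continuously differentiable on it. The $x_i$ are called support parameters. The dual 1-skeleton of $P(x^0)$ is the graph with vertex set $\{1,\ldots,n\}$ (indexing the facets) in which $i\neq j$ are joined by an edge iff the facets $F_i(x^0)$ and $F_j(x^0)$ are adjacent, i.e. intersect in a $(d-2)$-dimensional face. The 1-skeleton of a polytope is the graph formed by its vertices and edges. Let $G$ be a graph with $n$ vertices. A Colin de Verdière matrix for $G$ is a symmetric real $n\times n$ matrix $M=(M_{ij})$ such that: (M1) $M_{ij}<0$ if $ij$ is an edge of $G$, and $M_{ij}=0$ if $i\ne j$ and $ij$ is not an edge of $G$ (diagonal entries are arbitrary); (M2) $M$ has exactly one negative eigenvalue, and this eigenvalue is simple; (M3) if $X$ is a symmetric $n\times n$ matrix such that $MX=0$ and $X_{ij}=0$ whenever $i=j$ or $ij$ is an edge of $G$, then $X=0$. The Colin de Verdière number $\mu(G)$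 is the maximum of $\dim\ker M$ over all Colin de Verdière matrices $M$ for $G$. The corank of $M$ is $\dim\ker M$. *)

theory Defs
  imports "HOL-Analysis.Analysis" "HOL-Computational_Algebra.Polynomial"
begin

text \<open>
  The dimension \<open>d\<close> and the number \<open>n\<close> are \<open>CARD('d)\<close> and \<open>CARD('n)\<close>. Graphs on \<open>n\<close> vertices are
  given by their adjacency relation on the type \<open>'n\<close>.
\<close>

section \<open>Polytopes given by facet normals and support parameters\<close>

definition support_polytope :: "('n \<Rightarrow> real^'d) \<Rightarrow> real^'n \<Rightarrow> (real^'d) set" where
  "support_polytope v x = {p. \<forall>i. v i \<bullet> p \<le> x $ i}"

definition support_facet :: "('n \<Rightarrow> real^'d) \<Rightarrow> real^'n \<Rightarrow> 'n \<Rightarrow> (real^'d) set" where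
  "support_facet v x i = {p \<in> support_polytope v x. v i \<bullet> p = x $ i}"

definition has_outer_facet_normals :: "('n \<Rightarrow> real^'d) \<Rightarrow> real^'n \<Rightarrow> bool" where
  "has_outer_facet_normals v x \<longleftrightarrow>
     polytope (support_polytope v x) \<and>
     aff_dim (support_polytope v x) = int CARD('d) \<and>
     (\<forall>i. support_facet v x i facet_of support_polytope v x) \<and>
     inj (support_facet v x)"

definition support_volume :: "('n \<Rightarrow> real^'d) \<Rightarrow> real^'n \<Rightarrow> real" where
  "support_volume v x = measure lebesgue (support_polytope v x)"

definition partial_deriv :: "'n \<Rightarrow> (real^'n \<Rightarrow> real) \<Rightarrow> real^'n \<Rightarrow> real" where
  "partial_deriv i f x = deriv (\<lambda>t. f (x + t *\<^sub>R axis i 1)) 0"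

definition dual_skeleton :: "('n \<Rightarrow> real^'d) \<Rightarrow> real^'n \<Rightarrow> 'n \<Rightarrow> 'n \<Rightarrow> bool" where
  "dual_skeleton v x i j \<longleftrightarrow>
     i \<noteq> j \<and>
     (support_facet v x i \<inter> support_facet v x j) face_of support_polytope v x \<and>
     aff_dim (support_facet v x i \<inter> support_facet v x j) = int CARD('d) - 2"

text \<open>
  The graph \<open>G\<close> is realized as the 1-skeleton of \<open>Q\<close> if it is isomorphic to the graph of vertices
  and edges of \<open>Q\<close>; \<open>f\<close> is the isomorphism.
\<close>

definition realized_as_skeleton :: "('n \<Rightarrow> 'n \<Rightarrow> bool) \<Rightarrow> (real^'d) set \<Rightarrow> bool" where
  "realized_as_skeleton G Q \<longleftrightarrow>
     (\<exists>f. bij_betw f UNIV {p. p extreme_point_of Q} \<and>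
          (\<forall>i j. G i j \<longleftrightarrow> i \<noteq> j \<and> closed_segment (f i) (f j) edge_of Q))"

section \<open>Colin de Verdiere matrices\<close>

definition matrix_eigenvalue :: "real^'n^'n \<Rightarrow> real \<Rightarrow> bool" where
  "matrix_eigenvalue M c \<longleftrightarrow> (\<exists>x. x \<noteq> 0 \<and> M *v x = c *\<^sub>R x)"

text \<open>The polynomial \<open>det (X I - M)\<close>.\<close>

definition characteristic_poly :: "real^'n^'n \<Rightarrow> real poly" where
  "characteristic_poly M = det (\<chi> i j. (if i = j then [:0, 1:] else 0) - [:M $ i $ j:])"

definition simple_eigenvalue :: "real^'n^'n \<Rightarrow> real \<Rightarrow> bool" where
  "simple_eigenvalue M c \<longleftrightarrow> matrix_eigenvalue M c \<and> order c (characteristic_poly M) = 1"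

definition corank :: "real^'n^'n \<Rightarrow> nat" where
  "corank M = dim {x. M *v x = 0}"

definition colin_de_verdiere_matrix :: "('n \<Rightarrow> 'n \<Rightarrow> bool) \<Rightarrow> real^'n^'n \<Rightarrow> bool" where
  "colin_de_verdiere_matrix G M \<longleftrightarrow>
     transpose M = M \<and>
     (\<forall>i j. G i j \<longrightarrow> M $ i $ j < 0) \<and>
     (\<forall>i j. i \<noteq> j \<and> \<not> G i j \<longrightarrow> M $ i $ j = 0) \<and>
     (\<exists>c. {l. l < 0 \<and> matrix_eigenvalue M l} = {c} \<and> simple_eigenvalue M c) \<and>
     (\<forall>X :: real^'n^'n.
        transpose X = X \<and> M ** X = 0 \<and> (\<forall>i j. i = j \<or> G i j \<longrightarrow> X $ i $ j = 0) \<longrightarrow> X = 0)"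

text \<open>
  All coranks are at most \<open>n\<close>, so the maximum is over a finite set.
\<close>

definition colin_de_verdiere_number :: "('n::finite \<Rightarrow> 'n \<Rightarrow> bool) \<Rightarrow> nat" where
  "colin_de_verdiere_number G = Max {corank M |M. colin_de_verdiere_matrix G M}"

end

theory Submission
  imports Defs
begin

text \<open>Increasing the support parameter of a facet changes the volume at the rate of the volume of that
  facet divided by the norm of its normal. A facet volume can be written as the volume of a prism
  over the facet, which lives in the same space, so the second derivatives are obtained by
  differentiating twice in the same way: off the diagonal they are multiples of ridge volumes, hence
  positive exactly for adjacent facets.

  The Brunn-Minkowski inequality makes the Hessian of the volume nonpositive on the hyperplane where
  the gradient vanishes, and Euler's identity for homogeneous functions makes it positive at the
  support vector itself, so \<open>M\<close> has exactly one negative eigenvalue.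

  For the kernel, let \<open>y\<close> be a null vector of the Hessian and cut the polytope by a hyperplane
  \<open>e \<bullet> p = s\<close>. Both pieces satisfy the Brunn-Minkowski inequality and their volumes add up, so \<open>y\<close> extends to a
  null vector of each cut polytope. It follows that moving the support parameters along \<open>y\<close> changes the
  distribution of \<open>e \<bullet> p\<close>, to first order, as a translation by some \<open>\<tau> e\<close> does. The first moment
  shows that \<open>\<tau>\<close> is linear in \<open>e\<close>, say \<open>\<tau> e = e \<bullet> a\<close>, and cutting parallel to facet \<open>i\<close> yields
  \<open>y\<^sub>i = v\<^sub>i \<bullet> a\<close>. So the kernel consists of the translations.

  If \<open>M X = 0\<close>, the rows of \<open>X\<close> are therefore of the form \<open>v\<^sub>i \<bullet> a\<close>; transversality holds because the
  normals of a facet and of its neighbours span the space. Finally, a graph realized as the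
  skeleton of a polytope is the dual skeleton of the polar polytope.\<close>

section \<open>Volumes of support polytopes\<close>

text \<open>The kernel claim is the infinitesimal equality case of the Brunn-Minkowski inequality.
  The inequality itself is used only in the weak form that the volume at a midpoint is at least the
  smaller of the two volumes, and no description of its equality case is required: additivity of the
  volume turns a single degenerate direction of the whole polytope into equalities on all of its
  pieces, which carry more information. Differentiating twice means passing to prisms over prisms,
  and cutting adds constraints. Both operations leave the class of irredundant facet descriptions,
  since projected normals may vanish or become parallel and a cut may pass through a ridge. These
  heights are harmless, because the quantities concerned are continuous there or get
  integrated.\<close>

definition positively_spanning :: "('n \<Rightarrow> real^'d) \<Rightarrow> bool" where
  "positively_spanning v \<longleftrightarrow> (\<forall>u. (\<forall>i. v i \<bullet> u \<le> 0) \<longrightarrow> u = 0)"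

text \<open>\<open>positively_spanning\<close> says that the recession cone is trivial, whatever the
  offsets are. Compactness of the unit sphere makes this quantitative: the sum of the positive parts
  of \<open>v i \<bullet> u\<close> has a positive minimum there, and some summand is at least the
  average.\<close>

lemma positively_spanning_bound:
  fixes v :: "'n::finite \<Rightarrow> real^'d"
  assumes "positively_spanning v"
  obtains c where "c > 0" "\<And>u. \<exists>i. c * norm u \<le> v i \<bullet> u"
proof -
  define g where "g u = (\<Sum>i\<in>UNIV. max 0 (v i \<bullet> u))" for u
  have "continuous_on (sphere 0 1) g"
    unfolding g_def by (intro continuous_intros)
  moreover have "sphere (0::real^'d) 1 \<noteq> {}" by simp
  ultimately obtain u0 where u0: "u0 \<in> sphere 0 1" "\<And>u. u \<in> sphere 0 1 \<Longrightarrow> g u0 \<le> g u"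
    using continuous_attains_inf[of "sphere (0::real^'d) 1" g] compact_sphere by blast
  have "u0 \<noteq> 0" using u0 by auto
  then obtain i0 where "v i0 \<bullet> u0 > 0"
    using assms unfolding positively_spanning_def by (meson not_le)
  moreover have "v i0 \<bullet> u0 \<le> g u0"
    unfolding g_def
    using member_le_sum[of i0 UNIV "\<lambda>i. max 0 (v i \<bullet> u0)"] by simp
  ultimately have pos: "g u0 > 0" by simp
  define c where "c = g u0 / real CARD('n)"
  have "c > 0" using pos by (simp add: c_def)
  moreover have "\<exists>i. c * norm u \<le> v i \<bullet> u" for u
  proof (cases "u = 0")
    case False
    define w where "w = u /\<^sub>R norm u"
    have "w \<in> sphere 0 1" using False by (simp add: w_def)
    then have gw: "g u0 \<le> g w" by (rule u0)
    have "\<exists>i. c \<le> v i \<bullet> w"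
    proof (rule ccontr)
      assume "\<not> (\<exists>i. c \<le> v i \<bullet> w)"
      then have "max 0 (v i \<bullet> w) < c" for i using \<open>c > 0\<close> by (simp add: not_le)
      then have "g w < (\<Sum>i\<in>(UNIV::'n set). c)"
        unfolding g_def by (intro sum_strict_mono) auto
      then show False using gw by (simp add: c_def)
    qed
    then obtain i where "c \<le> v i \<bullet> w" ..
    then have "c * norm u \<le> (v i \<bullet> w) * norm u" by (simp add: mult_right_mono)
    then show ?thesis using False by (intro exI[of _ i]) (simp add: w_def field_simps)
  qed auto
  ultimately show thesis using that by blast
qed

section \<open>Compactness of support polytopes and continuity of their volume\<close>

lemma closed_support_polytope: "closed (support_polytope v x)"
  unfolding support_polytope_def by (intro closed_Collect_all closed_Collect_le continuous_intros)

lemma convex_support_polytope: "convex (support_polytope v x)"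
proof -
  have "support_polytope v x = (\<Inter>i. {p. v i \<bullet> p \<le> x $ i})"
    by (auto simp: support_polytope_def)
  then show ?thesis by (simp add: convex_INT convex_halfspace_le)
qed

text \<open>Normals must be allowed to move as well, because the slabs used below have normals that
  depend on their thickness. Moving each normal by at most \<open>c / 2\<close> costs half of the
  constant, so nearby polytopes stay in a common ball.\<close>

lemma positively_spanning_bound_perturbed:
  fixes v :: "'n::finite \<Rightarrow> real^'d"
  assumes c: "\<And>u. \<exists>i. c * norm u \<le> v i \<bullet> u" and w: "\<And>i. norm (w i - v i) \<le> c / 2"
    and "p \<in> support_polytope w y"
  shows "c * norm p \<le> 2 * norm y"
proof -
  obtain i where i: "c * norm p \<le> v i \<bullet> p" using c by blast
  have "\<bar>(w i - v i) \<bullet> p\<bar> \<le> norm (w i - v i) * norm p" by (rule Cauchy_Schwarz_ineq2)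
  also have "\<dots> \<le> c / 2 * norm p" using w by (intro mult_right_mono) auto
  finally have "v i \<bullet> p - c / 2 * norm p \<le> w i \<bullet> p" unfolding inner_diff_left by linarith
  also have "\<dots> \<le> y $ i" using assms(3) by (simp add: support_polytope_def)
  also have "\<dots> \<le> norm y" using component_le_norm_cart[of y i] by linarith
  finally show ?thesis using i by linarith
qed

lemma support_polytope_subset_cball:
  fixes v :: "'n::finite \<Rightarrow> real^'d"
  assumes "positively_spanning v"
  obtains C where "C > 0" "\<And>y. support_polytope v y \<subseteq> cball 0 (C * norm y)"
proof -
  obtain c where c: "c > 0" "\<And>u. \<exists>i. c * norm u \<le> v i \<bullet> u"
    using positively_spanning_bound[OF assms] by blast
  have "support_polytope v y \<subseteq> cball 0 (2 / c * norm y)" for y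
    using positively_spanning_bound_perturbed[OF c(2), of v _ y] c(1)
    by (auto simp: field_simps)
  then show thesis using that[of "2 / c"] c(1) by simp
qed

lemma compact_support_polytope:
  fixes v :: "'n::finite \<Rightarrow> real^'d"
  assumes "positively_spanning v"
  shows "compact (support_polytope v x)"
  using support_polytope_subset_cball[OF assms] closed_support_polytope bounded_subset bounded_cball
  by (metis compact_eq_bounded_closed)

lemma lmeasurable_support_polytope:
  fixes v :: "'n::finite \<Rightarrow> real^'d"
  assumes "positively_spanning v"
  shows "support_polytope v x \<in> lmeasurable"
  using compact_support_polytope[OF assms] by (rule lmeasurable_compact)

lemma AE_lebesgue_not_in: "negligible N \<Longrightarrow> AE p in lebesgue. p \<notin> N"
  by (simp add: AE_not_in negligible_iff_null_sets)

text \<open>Dominated convergence: off the boundary hyperplanes every constraint eventually takes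
  its limiting truth value. The hypothesis \<open>nz\<close> excludes the constraint
  \<open>0 \<le> 0\<close>, which an arbitrarily small change can make unsatisfiable; every other
  boundary is a null set.\<close>

lemma support_volume_tendsto:
  fixes w :: "nat \<Rightarrow> 'n::finite \<Rightarrow> real^'d" and y :: "nat \<Rightarrow> real^'n"
  assumes v: "positively_spanning v" and w: "\<And>k. (\<lambda>m. w m k) \<longlonglongrightarrow> v k" and y: "y \<longlonglongrightarrow> x"
    and nz: "\<And>k. v k \<noteq> 0 \<or> x $ k \<noteq> 0"
  shows "(\<lambda>m. support_volume (w m) (y m)) \<longlonglongrightarrow> support_volume v x"
proof -
  obtain c where c: "c > 0" "\<And>u. \<exists>i. c * norm u \<le> v i \<bullet> u"
    using positively_spanning_bound[OF v] by blast
  have "Bseq y" using y by (simp add: convergent_def Bseq_eq_bounded convergent_imp_bounded)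
  then obtain B where B: "\<And>m. norm (y m) \<le> B" by (auto simp: Bseq_def)
  have "\<forall>\<^sub>F m in sequentially. norm (w m k - v k) \<le> c / 2" for k
  proof -
    have "\<forall>\<^sub>F m in sequentially. dist (w m k) (v k) < c / 2"
      using w[of k] c(1) by (intro tendstoD) auto
    then show ?thesis by (rule eventually_mono) (simp add: dist_norm)
  qed
  then have "\<forall>\<^sub>F m in sequentially. \<forall>k. norm (w m k - v k) \<le> c / 2"
    by (rule eventually_all_finite)
  then obtain N where N: "\<And>m k. m \<ge> N \<Longrightarrow> norm (w m k - v k) \<le> c / 2"
    unfolding eventually_sequentially by blast
  define R where "R = 2 * B / c"
  have sub: "support_polytope (w m) (y m) \<subseteq> cball 0 R" if "m \<ge> N" for m
  proof
    fix p assume p: "p \<in> support_polytope (w m) (y m)"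
    have "c * norm p \<le> 2 * norm (y m)"
      by (rule positively_spanning_bound_perturbed[OF c(2) N p]) (use that in auto)
    also have "\<dots> \<le> 2 * B" using B by simp
    finally show "p \<in> cball 0 R" using c(1) by (simp add: R_def field_simps)
  qed
  define Z where "Z = (\<Union>k. {p. v k \<bullet> p = x $ k})"
  have Z: "negligible Z"
    unfolding Z_def using nz by (intro negligible_Union finite_imageI) (auto simp: negligible_hyperplane)
  have lim: "(\<lambda>m. indicator (support_polytope (w m) (y m)) p :: real) \<longlonglongrightarrow> indicator (support_polytope v x) p"
    if "p \<notin> Z" for p
  proof -
    have "\<forall>\<^sub>F m in sequentially. (w m k \<bullet> p \<le> y m $ k) = (v k \<bullet> p \<le> x $ k)" for k
    proof -
      have ne: "v k \<bullet> p \<noteq> x $ k" using that by (auto simp: Z_def)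
      have t: "(\<lambda>m. w m k \<bullet> p - y m $ k) \<longlonglongrightarrow> v k \<bullet> p - x $ k"
        by (intro tendsto_intros w y)
      show ?thesis
      proof (cases "v k \<bullet> p < x $ k")
        case True
        then have "\<forall>\<^sub>F m in sequentially. w m k \<bullet> p - y m $ k < 0"
          using t by (intro order_tendstoD(2)) auto
        then show ?thesis by (rule eventually_mono) (use True in auto)
      next
        case False
        then have "\<forall>\<^sub>F m in sequentially. w m k \<bullet> p - y m $ k > 0"
          using t ne by (intro order_tendstoD(1)) auto
        then show ?thesis by (rule eventually_mono) (use False ne in auto)
      qed
    qed
    then have "\<forall>\<^sub>F m in sequentially. \<forall>k. (w m k \<bullet> p \<le> y m $ k) = (v k \<bullet> p \<le> x $ k)"
      by (rule eventually_all_finite)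
    then show ?thesis
      by (intro tendsto_eventually) (auto elim!: eventually_mono simp: support_polytope_def indicator_def)
  qed
  have "(\<lambda>m. integral\<^sup>L lebesgue (indicator (support_polytope (w (m + N)) (y (m + N))) :: _ \<Rightarrow> real))
     \<longlonglongrightarrow> integral\<^sup>L lebesgue (indicator (support_polytope v x))"
  proof (rule integral_dominated_convergence[where w="indicator (cball 0 R)"])
    show "indicator (support_polytope v x) \<in> borel_measurable lebesgue"
      using lmeasurable_support_polytope[OF v] by (intro borel_measurable_indicator) (auto simp: fmeasurableD)
    show "indicator (support_polytope (w (m + N)) (y (m + N))) \<in> borel_measurable lebesgue" for m
      by (intro borel_measurable_indicator) (simp add: closed_support_polytope lebesgue_closedin borel_closed)
    show "integrable lebesgue (indicator (cball (0::real^'d) R) :: _ \<Rightarrow> real)"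
      by (simp add: lmeasurable_iff_integrable[symmetric])
    show "AE p in lebesgue. (\<lambda>m. indicator (support_polytope (w (m + N)) (y (m + N))) p :: real) \<longlonglongrightarrow> indicator (support_polytope v x) p"
      using AE_lebesgue_not_in[OF Z]
    proof (rule eventually_mono)
      fix p assume "p \<notin> Z"
      from LIMSEQ_ignore_initial_segment[OF lim[OF this], of N]
      show "(\<lambda>m. indicator (support_polytope (w (m + N)) (y (m + N))) p :: real) \<longlonglongrightarrow> indicator (support_polytope v x) p" .
    qed
    show "AE p in lebesgue. norm (indicator (support_polytope (w (m + N)) (y (m + N))) p :: real) \<le> indicator (cball 0 R) p" for m
      using sub[of "m + N"] by (intro AE_I2) (auto simp: indicator_def)
  qed
  then have "(\<lambda>m. support_volume (w (m + N)) (y (m + N))) \<longlonglongrightarrow> support_volume v x"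
    by (simp add: support_volume_def)
  then show ?thesis by (rule LIMSEQ_offset)
qed

text \<open>An orthogonal matrix taking a coordinate vector to \<open>e\<close> makes the map
  diagonal, with one entry \<open>1 + k\<close> and all others 1. The formula serves both the
  stretching of slabs and the characteristic polynomial of a rank-one shift.\<close>

lemma det_rank_one_update:
  fixes e :: "real^'d"
  assumes "norm e = 1"
  shows "det (matrix (\<lambda>q. q + (k * (e \<bullet> q)) *\<^sub>R e)) = 1 + k"
proof -
  obtain A :: "real^'d^'d" and i where A: "orthogonal_matrix A" and Ai: "A *v (axis i 1) = e"
    using orthogonal_matrix_exists_basis[OF assms] by metis
  define D :: "real^'d^'d" where "D = (\<chi> a b. if a = b then (if a = i then 1 + k else 1) else 0)"
  have D: "D *v q = q + (k * q $ i) *\<^sub>R axis i 1" for q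
  proof (subst vec_eq_iff, rule allI)
    fix a
    have "(D *v q) $ a = (\<Sum>b\<in>UNIV. D $ a $ b * q $ b)"
      by (simp add: matrix_vector_mult_def)
    also have "\<dots> = (\<Sum>b\<in>UNIV. if a = b then (if a = i then 1 + k else 1) * q $ b else 0)"
      unfolding D_def by (intro sum.cong) auto
    also have "\<dots> = (if a = i then 1 + k else 1) * q $ a" by simp
    finally show "(D *v q) $ a = (q + (k * q $ i) *\<^sub>R axis i 1) $ a"
      by (simp add: axis_def algebra_simps)
  qed
  have detD: "det D = 1 + k"
  proof -
    have "det D = (\<Prod>a\<in>UNIV. D $ a $ a)" by (rule det_diagonal) (simp add: D_def)
    also have "\<dots> = (\<Prod>a\<in>UNIV. if a = i then 1 + k else 1)" by (simp add: D_def)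
    also have "\<dots> = 1 + k" by simp
    finally show ?thesis .
  qed
  have AT: "A ** transpose A = mat 1" using A by (simp add: orthogonal_matrix_def)
  have "(\<lambda>q. q + (k * (e \<bullet> q)) *\<^sub>R e) = (\<lambda>q. (A ** D ** transpose A) *v q)"
  proof
    fix q
    have "(transpose A *v q) $ i = e \<bullet> q"
      by (simp only: Ai[symmetric] inner_commute[of _ q] dot_lmul_matrix[symmetric] transpose_matrix_vector cart_eq_inner_axis)
    then have "(A ** D ** transpose A) *v q = A *v (transpose A *v q + (k * (e \<bullet> q)) *\<^sub>R axis i 1)"
      by (simp add: matrix_vector_mul_assoc[symmetric] D)
    also have "\<dots> = (A ** transpose A) *v q + (k * (e \<bullet> q)) *\<^sub>R e"
      by (simp only: matrix_vector_right_distrib matrix_vector_mul_assoc matrix_vector_mult_scaleR Ai)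
    finally show "q + (k * (e \<bullet> q)) *\<^sub>R e = (A ** D ** transpose A) *v q" by (simp add: AT)
  qed
  then have "det (matrix (\<lambda>q. q + (k * (e \<bullet> q)) *\<^sub>R e)) = det (A ** D ** transpose A)"
    by simp
  also have "\<dots> = det D * (det A * det (transpose A))" by (simp add: det_mul)
  also have "det A * det (transpose A) = 1" unfolding det_mul[symmetric] AT by simp
  finally show ?thesis by (simp add: detD)
qed


text \<open>For \<open>r = 0\<close> these are the normals of the right prism \<open>0 \<le> v i \<bullet> p \<le> 1\<close> over facet \<open>i\<close>; for \<open>r > 0\<close>
  they describe the slab of thickness \<open>r\<close> between two parallel facets, stretched to
  \<open>0 \<le> v i \<bullet> p \<le> 1\<close>. The index \<open>None\<close> stands for the new half-space \<open>0 \<le> v i \<bullet> p\<close>.\<close>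

definition facet_normals :: "real \<Rightarrow> ('n \<Rightarrow> real^'d) \<Rightarrow> 'n \<Rightarrow> 'n option \<Rightarrow> real^'d" where
  "facet_normals r v i K = (case K of None \<Rightarrow> - v i
     | Some k \<Rightarrow> if k = i then v i else v k + ((r - 1) * ((v k \<bullet> v i) / (v i \<bullet> v i))) *\<^sub>R v i)"

definition facet_offsets :: "('n::finite \<Rightarrow> real^'d) \<Rightarrow> 'n \<Rightarrow> real^'n \<Rightarrow> real^('n option)" where
  "facet_offsets v i x = (\<chi> K. case K of None \<Rightarrow> 0
     | Some k \<Rightarrow> if k = i then 1 else x $ k - (v k \<bullet> v i) / (v i \<bullet> v i) * x $ i)"

text \<open>The \<open>(d - 1)\<close>-dimensional volume of facet \<open>i\<close> divided by the norm of \<open>v i\<close>, but expressed as a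
  \<open>d\<close>-dimensional volume, so that everything proved about \<open>support_volume\<close> applies to it again.\<close>

definition facet_volume :: "('n::finite \<Rightarrow> real^'d) \<Rightarrow> 'n \<Rightarrow> real^'n \<Rightarrow> real" where
  "facet_volume v i x =
     (if v i = 0 then 0 else support_volume (facet_normals 0 v i) (facet_offsets v i x))"

text \<open>Distinct half-spaces have distinct boundary hyperplanes. Zero normals have to be admitted,
  because projecting the normals onto a facet can produce them.\<close>

definition nondegenerate :: "('n \<Rightarrow> real^'d) \<Rightarrow> real^'n \<Rightarrow> bool" where
  "nondegenerate v x \<longleftrightarrow> (\<forall>k. v k \<noteq> 0 \<or> x $ k \<noteq> 0) \<and>
     (\<forall>i k c. i \<noteq> k \<longrightarrow> v i \<noteq> 0 \<longrightarrow> v k = c *\<^sub>R v i \<longrightarrow> x $ k \<noteq> c * x $ i)"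

lemma positively_spanning_facet_normals:
  assumes "positively_spanning v" "v i \<noteq> 0"
  shows "positively_spanning (facet_normals r v i)"
  unfolding positively_spanning_def
proof (intro allI impI)
  fix u assume u: "\<forall>K. facet_normals r v i K \<bullet> u \<le> 0"
  have i0: "v i \<bullet> u = 0"
    using u[rule_format, of None] u[rule_format, of "Some i"] by (simp add: facet_normals_def)
  have "v k \<bullet> u \<le> 0" for k
    using u[rule_format, of "Some k"] i0
    by (cases "k = i") (auto simp: facet_normals_def inner_add_left)
  then show "u = 0" using assms(1) by (simp add: positively_spanning_def)
qed

lemma facet_normals_nonzero:
  assumes "nondegenerate v x" "v i \<noteq> 0"
  shows "facet_normals 0 v i K \<noteq> 0 \<or> facet_offsets v i x $ K \<noteq> 0"
proof (cases K)
  case None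
  then show ?thesis using assms by (simp add: facet_normals_def)
next
  case (Some k)
  show ?thesis
  proof (cases "k = i")
    case True
    then show ?thesis using Some assms by (simp add: facet_normals_def)
  next
    case False
    then have "v k = ((v k \<bullet> v i) / (v i \<bullet> v i)) *\<^sub>R v i \<Longrightarrow> x $ k \<noteq> (v k \<bullet> v i) / (v i \<bullet> v i) * x $ i"
      using assms unfolding nondegenerate_def by metis
    then show ?thesis using False Some by (auto simp: facet_normals_def facet_offsets_def)
  qed
qed

text \<open>The library computes the measure of linear images only over a well-ordered index type.\<close>

typedef (overloaded) ('a::finite) ranked = "{..<CARD('a)}"
  by (auto intro: exI[of _ 0])

lemma finite_UNIV_ranked: "finite (UNIV :: ('a::finite) ranked set)"
proof (rule finite_subset)
  show "(UNIV :: 'a ranked set) \<subseteq> Abs_ranked ` {..<CARD('a)}"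
    using Rep_ranked Rep_ranked_inverse by (metis (no_types) image_eqI subsetI)
qed simp

instance ranked :: (finite) finite
  by standard (rule finite_UNIV_ranked)

instantiation ranked :: (finite) wellorder
begin

definition less_eq_ranked :: "'a ranked \<Rightarrow> 'a ranked \<Rightarrow> bool" where
  "x \<le> y \<longleftrightarrow> Rep_ranked x \<le> Rep_ranked y"

definition less_ranked :: "'a ranked \<Rightarrow> 'a ranked \<Rightarrow> bool" where
  "x < y \<longleftrightarrow> Rep_ranked x < Rep_ranked y"

instance
proof
  fix P and a :: "'a ranked"
  assume step: "\<And>x :: 'a ranked. (\<And>y. y < x \<Longrightarrow> P y) \<Longrightarrow> P x"
  show "P a"
  proof (induction "Rep_ranked a" arbitrary: a rule: less_induct)
    case less
    show ?case by (rule step) (auto simp: less_ranked_def intro: less)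
  qed
qed (auto simp: less_eq_ranked_def less_ranked_def Rep_ranked_inject)

end

text \<open>Relabelling the coordinates permutes the sides of a box, so it preserves the volumes of
  boxes, and these determine the measure.\<close>

lemma lborel_reindex:
  fixes g :: "'m::finite \<Rightarrow> 'd::finite"
  assumes "bij g"
  shows "lborel = distr lborel borel (\<lambda>x::real^'d. (\<chi> r. x $ g r) :: real^'m)"
proof (rule lborel_eqI)
  let ?f = "\<lambda>x::real^'d. (\<chi> r. x $ g r) :: real^'m"
  have f: "?f \<in> borel_measurable borel"
    by (intro borel_measurable_continuous_onI continuous_on_vec_lambda continuous_intros)
  fix l u :: "real^'m"
  assume lu: "\<And>b. b \<in> Basis \<Longrightarrow> l \<bullet> b \<le> u \<bullet> b"
  let ?l = "(\<chi> i. l $ inv g i) :: real^'d" and ?u = "(\<chi> i. u $ inv g i) :: real^'d"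
  have le: "l $ r \<le> u $ r" for r
    using lu[of "axis r 1"] by (simp add: inner_axis)
  have "?f -` box l u = box ?l ?u"
    unfolding set_eq_iff vimage_eq mem_box_cart
    by (simp) (metis assms bij_inv_eq_iff)
  then have "emeasure (distr lborel borel ?f) (box l u) = emeasure lborel (box ?l ?u)"
    using f by (simp add: emeasure_distr)
  also have "\<dots> = ennreal (\<Prod>b\<in>Basis. (?u - ?l) \<bullet> b)"
    using le by (intro emeasure_lborel_box) (auto simp: Basis_vec_def inner_axis)
  also have "(\<Prod>b\<in>Basis. (?u - ?l) \<bullet> b) = (\<Prod>i\<in>UNIV. (u - l) $ inv g i)"
    by (subst prod.reindex_bij_betw[where T=Basis and h="\<lambda>i. axis i 1" and S=UNIV, symmetric])
      (auto simp: bij_betw_def inj_on_def axis_eq_axis Basis_vec_def inner_axis)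
  also have "\<dots> = (\<Prod>r\<in>UNIV. (u - l) $ r)"
    using bij_imp_bij_inv[OF assms] by (rule prod.reindex_bij_betw)
  also have "\<dots> = (\<Prod>b\<in>Basis. (u - l) \<bullet> b)"
    by (subst prod.reindex_bij_betw[where T=Basis and h="\<lambda>i. axis i 1" and S=UNIV, symmetric])
      (auto simp: bij_betw_def inj_on_def axis_eq_axis Basis_vec_def inner_axis)
  finally show "emeasure (distr lborel borel ?f) (box l u) = ennreal (\<Prod>b\<in>Basis. (u - l) \<bullet> b)" .
qed simp

lemma measure_directional_scaling:
  fixes e b :: "real^'d"
  assumes e: "norm e = 1" and S: "compact S"
  shows "measure lebesgue ((\<lambda>q. q + (k * (e \<bullet> q)) *\<^sub>R e + b) ` S) = \<bar>1 + k\<bar> * measure lebesgue S"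
    and "compact ((\<lambda>q. q + (k * (e \<bullet> q)) *\<^sub>R e + b) ` S)"
proof -
  show c: "compact ((\<lambda>q. q + (k * (e \<bullet> q)) *\<^sub>R e + b) ` S)" for b
    by (intro compact_continuous_image S continuous_intros)
  obtain g :: "'d ranked \<Rightarrow> 'd" where g: "bij g"
  proof -
    have "card (UNIV :: 'd ranked set) = CARD('d)"
      using type_definition.card[OF type_definition_ranked] by simp
    then show thesis
      using finite_same_card_bij[of "UNIV :: 'd ranked set" "UNIV :: 'd set"] that by auto
  qed
  \<comment> \<open>\<open>h\<close> renames the coordinates by the well-ordered index type. It is a
    linear isometry preserving measure, so the determinant formula for \<open>?F\<close> on the
    image yields the one for \<open>?f\<close>.\<close>
  define h where "h x = ((\<chi> r. x $ g r) :: real^'d ranked)" for x :: "real^'d"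
  have lin: "linear h" unfolding h_def by (intro linearI) (auto simp: vec_eq_iff)
  have inj: "inj h"
    unfolding h_def inj_on_def vec_eq_iff by simp (metis g bij_pointE)
  have hm: "h \<in> borel_measurable borel"
    by (intro borel_measurable_continuous_onI linear_continuous_on linear_conv_bounded_linear[THEN iffD1] lin)
  have inner: "h x \<bullet> h y = x \<bullet> y" for x y
    unfolding h_def inner_vec_def using sum.reindex_bij_betw[OF g, of "\<lambda>i. x $ i * y $ i"] by simp
  have meas: "measure lebesgue (h ` T) = measure lebesgue T" if "compact T" for T
  proof -
    have cT: "compact (h ` T)"
      by (intro compact_continuous_image that linear_continuous_on linear_conv_bounded_linear[THEN iffD1] lin)
    then have "measure lebesgue (h ` T) = measure lborel (h ` T)"
      by (intro measure_completion) (simp add: borel_compact)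
    also have "\<dots> = measure (distr lborel borel h) (h ` T)"
      using lborel_reindex[OF g] by (simp add: h_def[abs_def])
    also have "\<dots> = measure lborel (h -` h ` T)"
      using hm cT by (subst measure_distr) (auto simp: borel_compact)
    also have "h -` h ` T = T" using inj by (simp add: inj_vimage_image_eq)
    also have "measure lborel T = measure lebesgue T"
      using that by (intro measure_completion[symmetric]) (simp add: borel_compact)
    finally show ?thesis .
  qed
  let ?f = "\<lambda>q. q + (k * (e \<bullet> q)) *\<^sub>R e" and ?F = "\<lambda>q. q + (k * (h e \<bullet> q)) *\<^sub>R h e"
  have linF: "linear ?F"
    by (intro linearI) (auto simp: inner_add_right algebra_simps)
  have "(\<lambda>q. ?f q + b) ` S = (+) b ` (?f ` S)" by (auto simp: image_iff algebra_simps)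
  then have "measure lebesgue ((\<lambda>q. ?f q + b) ` S) = measure lebesgue (?f ` S)"
    by (simp add: measure_translation)
  also have "\<dots> = measure lebesgue (h ` ?f ` S)"
    using meas[of "?f ` S"] c[of 0] by simp
  also have "h ` ?f ` S = ?F ` (h ` S)"
    unfolding image_image by (simp add: linear_add[OF lin] linear_scale[OF lin] inner)
  also have "measure lebesgue (?F ` (h ` S)) = \<bar>det (matrix ?F)\<bar> * measure lebesgue (h ` S)"
    by (intro measure_linear_image linF lmeasurable_compact compact_continuous_image S
      linear_continuous_on linear_conv_bounded_linear[THEN iffD1] lin)
  also have "det (matrix ?F) = 1 + k"
    using e by (intro det_rank_one_update) (simp add: norm_eq_sqrt_inner inner)
  finally show "measure lebesgue ((\<lambda>q. ?f q + b) ` S) = \<bar>1 + k\<bar> * measure lebesgue S"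
    using meas[OF S] by simp
qed

text \<open>Dividing by \<open>r\<close> in the definition of \<open>T\<close> treats both signs at
  once: the layer gained for \<open>r > 0\<close> and the layer lost for \<open>r < 0\<close>.
  Stretching along \<open>v i\<close> brings the slab to heights between 0 and 1; all that remains
  of \<open>r\<close> sits in the normals, which converge as \<open>r\<close> tends to 0.\<close>

lemma slab_volume:
  fixes v :: "'n::finite \<Rightarrow> real^'d" and x :: "real^'n"
  assumes "positively_spanning v" "v i \<noteq> 0" "r \<noteq> 0"
  defines "T \<equiv> {p. 0 \<le> (v i \<bullet> p - x $ i) / r \<and> (v i \<bullet> p - x $ i) / r \<le> 1 \<and> (\<forall>k. k \<noteq> i \<longrightarrow> v k \<bullet> p \<le> x $ k)}"
  shows "measure lebesgue T = \<bar>r\<bar> * support_volume (facet_normals r v i) (facet_offsets v i x)"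
    and "T \<in> lmeasurable"
proof -
  define S where "S = support_polytope (facet_normals r v i) (facet_offsets v i x)"
  define n2 where "n2 = v i \<bullet> v i"
  have n2: "n2 > 0" using assms by (simp add: n2_def)
  define e where "e = v i /\<^sub>R norm (v i)"
  have e: "norm e = 1" using assms by (simp add: e_def)
  define L where "L q = q + ((r - 1) * (e \<bullet> q)) *\<^sub>R e" for q
  define f where "f q = L q + (x $ i / n2) *\<^sub>R v i" for q
  have L: "L q = q + ((r - 1) * (v i \<bullet> q) / n2) *\<^sub>R v i" for q
    using assms by (simp add: L_def e_def n2_def dot_square_norm power2_eq_square field_simps)
  have vkf: "v k \<bullet> f q = v k \<bullet> q + (v k \<bullet> v i) / n2 * ((r - 1) * (v i \<bullet> q) + x $ i)" for k q
    by (simp add: f_def L inner_add_right algebra_simps add_divide_distrib diff_divide_distrib)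
  have vif: "v i \<bullet> f q = r * (v i \<bullet> q) + x $ i" for q
    unfolding vkf using n2 by (simp add: n2_def[symmetric] algebra_simps)
  have iff: "q \<in> S \<longleftrightarrow> f q \<in> T" for q
  proof -
    have "q \<in> S \<longleftrightarrow> 0 \<le> v i \<bullet> q \<and> v i \<bullet> q \<le> 1 \<and>
        (\<forall>k. k \<noteq> i \<longrightarrow> v k \<bullet> q + (r - 1) * ((v k \<bullet> v i) / n2) * (v i \<bullet> q) \<le> x $ k - (v k \<bullet> v i) / n2 * x $ i)"
      unfolding S_def support_polytope_def mem_Collect_eq split_option_all
      by (auto simp: facet_normals_def facet_offsets_def inner_add_left n2_def)
    also have "\<dots> \<longleftrightarrow> f q \<in> T"
      unfolding T_def mem_Collect_eq vif using assms(3) by (auto simp: vkf algebra_simps diff_divide_distrib)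
    finally show ?thesis .
  qed
  have surj: "\<exists>q. p = f q" for p
  proof
    define s where "s = p - (x $ i / n2) *\<^sub>R v i"
    \<comment> \<open>The inverse first undoes the translation and then stretches by
      \<open>1 / r\<close> instead of \<open>r\<close>.\<close>
    show "p = f (s + ((1 / r - 1) * (v i \<bullet> s) / n2) *\<^sub>R v i)"
    proof -
      have "v i \<bullet> (s + ((1 / r - 1) * (v i \<bullet> s) / n2) *\<^sub>R v i) = (v i \<bullet> s) / r"
        using n2 by (simp add: inner_add_right n2_def[symmetric] field_simps)
      then have "L (s + ((1 / r - 1) * (v i \<bullet> s) / n2) *\<^sub>R v i) = s + ((1 / r - 1) * (v i \<bullet> s) / n2 + (r - 1) * ((v i \<bullet> s) / r) / n2) *\<^sub>R v i"
        unfolding L by (simp add: algebra_simps)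
      also have "(1 / r - 1) * (v i \<bullet> s) / n2 + (r - 1) * ((v i \<bullet> s) / r) / n2 = 0"
        using n2 assms(3) by (simp add: field_simps)
      finally show ?thesis by (simp add: f_def s_def)
    qed
  qed
  have img: "T = (\<lambda>q. L q + (x $ i / n2) *\<^sub>R v i) ` S"
  proof -
    have "T = f ` S" using iff surj by (auto simp: image_iff) metis
    then show ?thesis by (simp add: f_def[abs_def])
  qed
  have S: "compact S"
    unfolding S_def using assms by (intro compact_support_polytope positively_spanning_facet_normals)
  show "measure lebesgue T = \<bar>r\<bar> * support_volume (facet_normals r v i) (facet_offsets v i x)"
    unfolding img L_def using measure_directional_scaling(1)[OF e S, of "r - 1"]
    by (simp add: support_volume_def S_def)
  show "T \<in> lmeasurable"
    unfolding img L_def using measure_directional_scaling(2)[OF e S, of "r - 1"] by (rule lmeasurable_compact)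
qed

lemma measure_Un_negligible_Int:
  assumes "S \<in> lmeasurable" "T \<in> lmeasurable" "negligible (S \<inter> T)"
  shows "measure lebesgue (S \<union> T) = measure lebesgue S + measure lebesgue T"
  using measure_Un3[OF assms(1,2)] negligible_imp_measure0[OF assms(3)] by simp

text \<open>The slab is glued to the polytope for \<open>r > 0\<close> and cut off from it for
  \<open>r < 0\<close>, with overlap in a hyperplane only. Since the identity is exact and not just
  asymptotic, differentiability of the volume becomes its continuity in the normals.\<close>

lemma difference_quotient_support_volume:
  fixes v :: "'n::finite \<Rightarrow> real^'d"
  assumes v: "positively_spanning v" "v i \<noteq> 0" "r \<noteq> 0"
  shows "(support_volume v (x + r *\<^sub>R axis i 1) - support_volume v x) / r
    = support_volume (facet_normals r v i) (facet_offsets v i x)"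
proof -
  define T where "T = {p. 0 \<le> (v i \<bullet> p - x $ i) / r \<and> (v i \<bullet> p - x $ i) / r \<le> 1 \<and> (\<forall>k. k \<noteq> i \<longrightarrow> v k \<bullet> p \<le> x $ k)}"
  note T = slab_volume[OF v, of x, folded T_def]
  have m: "(x + r *\<^sub>R axis i 1) $ k = x $ k + (if k = i then r else 0)" for k
    by (simp add: axis_def)
  have neg: "negligible {p. v i \<bullet> p = b}" for b
    using v by (simp add: negligible_hyperplane)
  note lm = lmeasurable_support_polytope[OF v(1)]
  show ?thesis
  proof (cases "r > 0")
    case True
    have "support_polytope v (x + r *\<^sub>R axis i 1) = support_polytope v x \<union> T" (is "?L = ?R")
    proof (intro equalityI subsetI)
      fix p assume "p \<in> ?L"
      then have *: "v i \<bullet> p \<le> x $ i + r" "\<And>k. k \<noteq> i \<Longrightarrow> v k \<bullet> p \<le> x $ k"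
        unfolding support_polytope_def m mem_Collect_eq by (metis, metis add_0_right)
      show "p \<in> ?R"
      proof (cases "v i \<bullet> p \<le> x $ i")
        case True
        then have "v k \<bullet> p \<le> x $ k" for k using * by (cases "k = i") auto
        then have "p \<in> support_polytope v x" unfolding support_polytope_def by blast
        then show ?thesis by simp
      next
        case False
        then have "p \<in> T" using * \<open>r > 0\<close> unfolding T_def by (simp add: field_simps)
        then show ?thesis by simp
      qed
    next
      fix p assume "p \<in> ?R"
      then have "v k \<bullet> p \<le> x $ k + (if k = i then r else 0)" for k
        using \<open>r > 0\<close> by (cases "k = i") (auto simp: support_polytope_def T_def field_simps intro: order_trans)
      then show "p \<in> ?L" unfolding support_polytope_def m by blast
    qed
    moreover have "support_polytope v x \<inter> T \<subseteq> {p. v i \<bullet> p = x $ i}"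
      using True by (auto simp: support_polytope_def T_def field_simps intro: antisym)
    ultimately have "support_volume v (x + r *\<^sub>R axis i 1) = support_volume v x + measure lebesgue T"
      unfolding support_volume_def
      by (simp add: measure_Un_negligible_Int lm T(2) negligible_subset[OF neg])
    then show ?thesis using True T(1) by simp
  next
    case False
    then have r: "r < 0" using v by simp
    have "support_polytope v x = support_polytope v (x + r *\<^sub>R axis i 1) \<union> T" (is "?L = ?R")
    proof (intro equalityI subsetI)
      fix p assume "p \<in> ?L"
      then have *: "\<And>k. v k \<bullet> p \<le> x $ k"
        unfolding support_polytope_def by blast
      show "p \<in> ?R"
      proof (cases "v i \<bullet> p \<le> x $ i + r")
        case True
        then have "p \<in> support_polytope v (x + r *\<^sub>R axis i 1)" using * unfolding support_polytope_def m by simp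
        then show ?thesis by simp
      next
        case False
        then have "p \<in> T" using * r unfolding T_def by (simp add: field_simps)
        then show ?thesis by simp
      qed
    next
      fix p assume "p \<in> ?R"
      then show "p \<in> ?L"
      proof
        assume "p \<in> support_polytope v (x + r *\<^sub>R axis i 1)"
        then have "v k \<bullet> p \<le> x $ k + (if k = i then r else 0)" for k
          unfolding support_polytope_def m by blast
        then have "v k \<bullet> p \<le> x $ k" for k using r by (smt (verit))
        then show "p \<in> ?L" by (simp add: support_polytope_def)
      next
        assume p: "p \<in> T"
        then have "v i \<bullet> p \<le> x $ i" using r by (auto simp: T_def field_simps)
        then have "v k \<bullet> p \<le> x $ k" for k using p by (cases "k = i") (auto simp: T_def)
        then show "p \<in> ?L" by (simp add: support_polytope_def)
      qed
    qed
    moreover have "support_polytope v (x + r *\<^sub>R axis i 1) \<inter> T \<subseteq> {p. v i \<bullet> p = x $ i + r}"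
    proof
      fix p assume p: "p \<in> support_polytope v (x + r *\<^sub>R axis i 1) \<inter> T"
      then have "v i \<bullet> p \<le> x $ i + r" unfolding support_polytope_def m by (auto dest: spec[of _ i])
      moreover have "v i \<bullet> p \<ge> x $ i + r" using p r by (auto simp: T_def field_simps)
      ultimately show "p \<in> {p. v i \<bullet> p = x $ i + r}" by simp
    qed
    ultimately have "support_volume v x = support_volume v (x + r *\<^sub>R axis i 1) + measure lebesgue T"
      unfolding support_volume_def
      by (simp add: measure_Un_negligible_Int lm T(2) negligible_subset[OF neg])
    then show ?thesis using r T(1) by (simp add: field_simps)
  qed
qed

lemma support_volume_has_partial_derivative:
  fixes v :: "'n::finite \<Rightarrow> real^'d"
  assumes v: "positively_spanning v" and nd: "nondegenerate v x"
  shows "((\<lambda>t. support_volume v (x + t *\<^sub>R axis i 1)) has_real_derivative facet_volume v i x) (at 0)"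
proof (cases "v i = 0")
  case False
  have "((\<lambda>r. support_volume (facet_normals r v i) (facet_offsets v i x)) \<longlongrightarrow> facet_volume v i x) (at 0)"
    unfolding tendsto_at_iff_sequentially comp_def
  proof (intro allI impI)
    fix X :: "nat \<Rightarrow> real" assume "X \<longlonglongrightarrow> 0"
    then have "(\<lambda>m. facet_normals (X m) v i K) \<longlonglongrightarrow> facet_normals 0 v i K" for K
      unfolding facet_normals_def using False by (cases K) (auto intro!: tendsto_eq_intros)
    then show "(\<lambda>m. support_volume (facet_normals (X m) v i) (facet_offsets v i x)) \<longlonglongrightarrow> facet_volume v i x"
      using support_volume_tendsto[OF positively_spanning_facet_normals[OF v False] _ tendsto_const
        facet_normals_nonzero[OF nd False]] False by (simp add: facet_volume_def)
  qed
  moreover have "\<forall>\<^sub>F r in at 0. (support_volume v (x + (0 + r) *\<^sub>R axis i 1) - support_volume v (x + 0 *\<^sub>R axis i 1)) / r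
      = support_volume (facet_normals r v i) (facet_offsets v i x)"
    by (auto simp: eventually_at_filter difference_quotient_support_volume[OF v False])
  ultimately show ?thesis
    unfolding has_field_derivative_iff by (simp add: tendsto_cong)
next
  case True
  \<comment> \<open>A constraint with zero normal reads \<open>0 \<le> x $ i\<close>. As
    \<open>x $ i\<close> is not 0, its truth value is locally constant, so the derivative is 0, the
    default value of \<open>facet_volume\<close>.\<close>
  then have x: "x $ i \<noteq> 0" using nd by (simp add: nondegenerate_def)
  have "((\<lambda>t. x $ i + t) \<longlongrightarrow> x $ i + 0) (nhds 0)" by (intro tendsto_intros filterlim_ident)
  then have "\<forall>\<^sub>F t in nhds 0. dist (x $ i + t) (x $ i + 0) < \<bar>x $ i\<bar>"
    by (rule tendstoD) (use x in simp)
  then have "\<forall>\<^sub>F t in nhds 0. support_volume v (x + t *\<^sub>R axis i 1) = support_volume v x"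
  proof (rule eventually_mono)
    fix t assume "dist (x $ i + t) (x $ i + 0) < \<bar>x $ i\<bar>"
    then have "0 \<le> x $ i + t \<longleftrightarrow> 0 \<le> x $ i" by (auto simp: dist_real_def)
    then have "v k \<bullet> p \<le> (x + t *\<^sub>R axis i 1) $ k \<longleftrightarrow> v k \<bullet> p \<le> x $ k" for k p
      using True by (auto simp: axis_def)
    then show "support_volume v (x + t *\<^sub>R axis i 1) = support_volume v x"
      by (simp add: support_volume_def support_polytope_def)
  qed
  then have "((\<lambda>t. support_volume v (x + t *\<^sub>R axis i 1)) has_real_derivative 0) (at 0)
     \<longleftrightarrow> ((\<lambda>t. support_volume v x) has_real_derivative 0) (at 0)"
    by (intro DERIV_cong_ev) auto
  then show ?thesis using True by (simp add: facet_volume_def)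
qed

section \<open>Second derivatives of the volume\<close>

lemma eventually_nondegenerate:
  fixes v :: "'n::finite \<Rightarrow> real^'d"
  assumes nd: "nondegenerate v x"
  shows "\<forall>\<^sub>F y in nhds x. nondegenerate v y"
proof -
  have comp: "((\<lambda>y. y $ k) \<longlongrightarrow> x $ k) (nhds x)" for k
    by (intro tendsto_intros filterlim_ident)
  have 1: "\<forall>\<^sub>F y in nhds x. v k \<noteq> 0 \<or> y $ k \<noteq> 0" for k
  proof (cases "v k = 0")
    case True
    then have "x $ k \<noteq> 0" using nd by (simp add: nondegenerate_def)
    from tendsto_imp_eventually_ne[OF comp this] show ?thesis by (rule eventually_mono) simp
  qed simp
  have 2: "\<forall>\<^sub>F y in nhds x. \<forall>c. i \<noteq> k \<longrightarrow> v i \<noteq> 0 \<longrightarrow> v k = c *\<^sub>R v i \<longrightarrow> y $ k \<noteq> c * y $ i" for i k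
  proof (cases "i \<noteq> k \<and> v i \<noteq> 0 \<and> (\<exists>c. v k = c *\<^sub>R v i)")
    case True
    then obtain c where c: "v k = c *\<^sub>R v i" by blast
    \<comment> \<open>The factor is unique because \<open>v i\<close> is nonzero, so the condition
      for all \<open>c\<close> amounts to a single open condition on \<open>y\<close>.\<close>
    have u: "c' = c" if "v k = c' *\<^sub>R v i" for c' using that c True by simp
    have "x $ k - c * x $ i \<noteq> 0" using nd True c unfolding nondegenerate_def by (metis right_minus_eq)
    moreover have "((\<lambda>y. y $ k - c * y $ i) \<longlongrightarrow> x $ k - c * x $ i) (nhds x)"
      by (intro tendsto_intros comp)
    ultimately have "\<forall>\<^sub>F y in nhds x. y $ k - c * y $ i \<noteq> 0"
      by (intro tendsto_imp_eventually_ne)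
    then show ?thesis by (rule eventually_mono) (auto dest: u)
  next
    case False
    then show ?thesis by (intro always_eventually) blast
  qed
  have "\<forall>\<^sub>F y in nhds x. \<forall>k. v k \<noteq> 0 \<or> y $ k \<noteq> 0"
    by (rule eventually_all_finite[OF 1])
  moreover have "\<forall>\<^sub>F y in nhds x. \<forall>i k c. i \<noteq> k \<longrightarrow> v i \<noteq> 0 \<longrightarrow> v k = c *\<^sub>R v i \<longrightarrow> y $ k \<noteq> c * y $ i"
    by (intro eventually_all_finite 2)
  ultimately show ?thesis unfolding nondegenerate_def by (rule eventually_conj)
qed

text \<open>The linear part of the affine map \<open>facet_offsets v i\<close>, that is, its
  derivative at every point.\<close>

definition facet_shift :: "('n::finite \<Rightarrow> real^'d) \<Rightarrow> 'n \<Rightarrow> real^'n \<Rightarrow> real^('n option)" where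
  "facet_shift v i h = (\<chi> K. case K of None \<Rightarrow> 0
     | Some k \<Rightarrow> if k = i then 0 else h $ k - (v k \<bullet> v i) / (v i \<bullet> v i) * h $ i)"

lemma facet_offsets_add: "facet_offsets v i (x + h) = facet_offsets v i x + facet_shift v i h"
  by (auto simp: vec_eq_iff facet_offsets_def facet_shift_def algebra_simps add_divide_distrib split: option.split)

lemma linear_facet_shift: "linear (facet_shift v i)"
  by (intro linearI) (auto simp: vec_eq_iff facet_shift_def algebra_simps add_divide_distrib split: option.split)

lemma tendsto_facet_offsets:
  assumes "(f \<longlongrightarrow> x) F"
  shows "((\<lambda>m. facet_offsets v i (f m)) \<longlongrightarrow> facet_offsets v i x) F"
proof -
  have "((\<lambda>m. facet_offsets v i (f m) $ K) \<longlongrightarrow> facet_offsets v i x $ K) F" for K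
    unfolding facet_offsets_def
    by (cases K) (auto simp del: times_divide_eq_left intro!: tendsto_diff tendsto_mult_left tendsto_const tendsto_vec_nth assms)
  then show ?thesis by (rule vec_tendstoI)
qed

lemma isCont_facet_volume:
  fixes v :: "'n::finite \<Rightarrow> real^'d"
  assumes v: "positively_spanning v" and nd: "nondegenerate v x"
  shows "isCont (facet_volume v i) x"
proof (cases "v i = 0")
  case True
  then have "facet_volume v i = (\<lambda>_. 0)" by (simp add: facet_volume_def fun_eq_iff)
  then show ?thesis by simp
next
  case False
  show ?thesis
    unfolding continuous_at_sequentially comp_def
  proof (intro allI impI)
    fix X assume "X \<longlonglongrightarrow> x"
    then have "(\<lambda>m. facet_offsets v i (X m)) \<longlonglongrightarrow> facet_offsets v i x" by (rule tendsto_facet_offsets)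
    from support_volume_tendsto[OF positively_spanning_facet_normals[OF v False] tendsto_const this facet_normals_nonzero[OF nd False]]
    show "(\<lambda>m. facet_volume v i (X m)) \<longlonglongrightarrow> facet_volume v i x"
      using False by (simp add: facet_volume_def)
  qed
qed

lemma isCont_support_volume:
  fixes v :: "'n::finite \<Rightarrow> real^'d"
  assumes v: "positively_spanning v" and nz: "\<And>k. v k \<noteq> 0 \<or> x $ k \<noteq> 0"
  shows "isCont (support_volume v) x"
  unfolding continuous_at_sequentially comp_def
  using support_volume_tendsto[OF v tendsto_const _ nz] by blast

text \<open>Existence of the partial derivatives nearby and their continuity at \<open>x\<close>
  suffice. The coordinates of the increment are switched on one at a time, and each switch is
  bounded by the mean value inequality after subtracting the linear term.\<close>

lemma has_derivative_of_partials:
  fixes f :: "real^'n \<Rightarrow> real"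
  assumes partials: "\<forall>\<^sub>F y in nhds x. \<forall>i. ((\<lambda>t. f (y + t *\<^sub>R axis i 1)) has_real_derivative g i y) (at 0)"
    and cont: "\<And>i. isCont (g i) x"
  shows "(f has_derivative (\<lambda>h. \<Sum>i\<in>UNIV. h $ i * g i x)) (at x)"
  unfolding has_derivative_at_alt
proof (intro conjI allI impI)
  show "bounded_linear (\<lambda>h. \<Sum>i\<in>UNIV. h $ i * g i x)"
    unfolding linear_conv_bounded_linear[symmetric]
    by (intro linearI) (auto simp: algebra_simps sum.distrib sum_distrib_left)
  fix \<epsilon> :: real assume "\<epsilon> > 0"
  define \<eta> where "\<eta> = \<epsilon> / CARD('n)"
  have \<eta>: "\<eta> > 0" using \<open>\<epsilon> > 0\<close> by (simp add: \<eta>_def)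
  have "\<forall>\<^sub>F y in nhds x. \<bar>g i y - g i x\<bar> < \<eta>" for i
  proof -
    have "(g i \<longlongrightarrow> g i x) (nhds x)" using cont[of i] by (simp add: isCont_def tendsto_at_iff_tendsto_nhds)
    from tendstoD[OF this \<eta>] show ?thesis by (simp add: dist_real_def)
  qed
  then have "\<forall>\<^sub>F y in nhds x. \<forall>i. \<bar>g i y - g i x\<bar> < \<eta>" by (rule eventually_all_finite)
  with partials have "\<forall>\<^sub>F y in nhds x. \<forall>i. ((\<lambda>t. f (y + t *\<^sub>R axis i 1)) has_real_derivative g i y) (at 0) \<and> \<bar>g i y - g i x\<bar> < \<eta>"
    by eventually_elim auto
  then obtain \<delta> where \<delta>: "\<delta> > 0"
    and P: "\<And>y i. dist y x < \<delta> \<Longrightarrow> ((\<lambda>t. f (y + t *\<^sub>R axis i 1)) has_real_derivative g i y) (at 0)"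
    and C: "\<And>y i. dist y x < \<delta> \<Longrightarrow> \<bar>g i y - g i x\<bar> < \<eta>"
    unfolding eventually_nhds_metric by blast
  have step: "\<bar>f (x + (\<chi> i. if i \<in> S then h $ i else 0)) - f x - (\<Sum>i\<in>S. h $ i * g i x)\<bar> \<le> \<eta> * (\<Sum>i\<in>S. \<bar>h $ i\<bar>)"
    if h: "norm h < \<delta>" and "finite S" for h S
    using \<open>finite S\<close>
  proof (induction S)
    case empty
    have "(\<chi> i. 0) = (0 :: real^'n)" by (simp add: vec_eq_iff)
    then show ?case by simp
  next
    case (insert j S)
    define z where "z = x + (\<chi> i. if i \<in> S then h $ i else 0)"
    define \<phi> where "\<phi> t = f (z + t *\<^sub>R axis j 1) - t * g j x" for t
    have z': "x + (\<chi> i. if i \<in> insert j S then h $ i else 0) = z + (h $ j) *\<^sub>R axis j 1"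
      using insert.hyps by (auto simp: z_def vec_eq_iff axis_def)
    \<comment> \<open>Partial increments stay in the ball, because none of their coordinates exceeds
      that of \<open>h\<close> in absolute value.\<close>
    have near: "dist (z + t *\<^sub>R axis j 1) x < \<delta>" if "t \<in> closed_segment 0 (h $ j)" for t
    proof -
      have "\<bar>t\<bar> \<le> \<bar>h $ j\<bar>" using that by (auto simp: closed_segment_eq_real_ivl split: if_splits)
      then have "norm (z + t *\<^sub>R axis j 1 - x) \<le> norm h"
        using insert.hyps by (intro norm_le_componentwise_cart) (auto simp: z_def axis_def)
      then show ?thesis using h by (simp add: dist_norm)
    qed
    have "norm (\<phi> (h $ j) - \<phi> 0) \<le> \<eta> * norm (h $ j - 0)"
    proof (rule field_differentiable_bound[of "closed_segment 0 (h $ j)"])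
      fix t assume t: "t \<in> closed_segment 0 (h $ j)"
      have "((\<lambda>s. f ((z + t *\<^sub>R axis j 1) + s *\<^sub>R axis j 1)) has_real_derivative g j (z + t *\<^sub>R axis j 1)) (at 0)"
        by (rule P[OF near[OF t]])
      then have "((\<lambda>s. f (z + (s + t) *\<^sub>R axis j 1)) has_real_derivative g j (z + t *\<^sub>R axis j 1)) (at 0)"
        by (simp add: algebra_simps)
      then have "((\<lambda>s. f (z + s *\<^sub>R axis j 1)) has_real_derivative g j (z + t *\<^sub>R axis j 1)) (at t)"
        using DERIV_shift[of "\<lambda>s. f (z + s *\<^sub>R axis j 1)" _ 0 t] by simp
      then have "(\<phi> has_real_derivative g j (z + t *\<^sub>R axis j 1) - g j x) (at t)"
        unfolding \<phi>_def by (auto intro!: derivative_eq_intros)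
      then show "(\<phi> has_real_derivative g j (z + t *\<^sub>R axis j 1) - g j x) (at t within closed_segment 0 (h $ j))"
        by (rule has_field_derivative_at_within)
      show "norm (g j (z + t *\<^sub>R axis j 1) - g j x) \<le> \<eta>"
        using C[OF near[OF t], of j] by simp
    qed auto
    then have "\<bar>f (z + (h $ j) *\<^sub>R axis j 1) - f z - h $ j * g j x\<bar> \<le> \<eta> * \<bar>h $ j\<bar>"
      by (simp add: \<phi>_def algebra_simps)
    then show ?case
      using insert unfolding z' by (simp add: z_def algebra_simps)
  qed
  show "\<exists>\<delta>>0. \<forall>y. norm (y - x) < \<delta> \<longrightarrow> norm (f y - f x - (\<Sum>i\<in>UNIV. (y - x) $ i * g i x)) \<le> \<epsilon> * norm (y - x)"
  proof (intro exI[of _ \<delta>] conjI allI impI \<delta>)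
    fix y assume y: "norm (y - x) < \<delta>"
    have "norm (f y - f x - (\<Sum>i\<in>UNIV. (y - x) $ i * g i x)) \<le> \<eta> * (\<Sum>i\<in>UNIV. \<bar>(y - x) $ i\<bar>)"
      using step[OF y, of UNIV] by (simp del: vector_minus_component)
    also have "(\<Sum>i\<in>UNIV. \<bar>(y - x) $ i\<bar>) \<le> (\<Sum>i\<in>(UNIV::'n set). norm (y - x))"
      by (intro sum_mono component_le_norm_cart)
    then have "\<eta> * (\<Sum>i\<in>UNIV. \<bar>(y - x) $ i\<bar>) \<le> \<eta> * (\<Sum>i\<in>(UNIV::'n set). norm (y - x))"
      using \<eta> by (intro mult_left_mono) auto
    also have "\<dots> = \<epsilon> * norm (y - x)" by (simp add: \<eta>_def)
    finally show "norm (f y - f x - (\<Sum>i\<in>UNIV. (y - x) $ i * g i x)) \<le> \<epsilon> * norm (y - x)" .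
  qed
qed

lemma has_derivative_along_line:
  assumes "(f has_derivative D) (at (x + t *\<^sub>R h))"
  shows "((\<lambda>s. f (x + s *\<^sub>R h)) has_real_derivative D h) (at t)"
proof -
  have "((\<lambda>s. x + s *\<^sub>R h) has_derivative (\<lambda>s. s *\<^sub>R h)) (at t)"
    by (auto intro!: derivative_eq_intros)
  from diff_chain_at[OF this assms] have "((\<lambda>s. f (x + s *\<^sub>R h)) has_derivative (\<lambda>s. D (s *\<^sub>R h))) (at t)"
    by (simp add: comp_def)
  moreover have "linear D" using assms by (rule has_derivative_linear)
  ultimately show ?thesis
    by (simp add: has_field_derivative_def linear_scale mult_commute_abs)
qed

lemma support_volume_has_derivative:
  fixes v :: "'n::finite \<Rightarrow> real^'d"
  assumes v: "positively_spanning v" and nd: "nondegenerate v x"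
  shows "(support_volume v has_derivative (\<lambda>h. \<Sum>i\<in>UNIV. h $ i * facet_volume v i x)) (at x)"
proof (rule has_derivative_of_partials)
  show "\<forall>\<^sub>F y in nhds x. \<forall>i. ((\<lambda>t. support_volume v (y + t *\<^sub>R axis i 1)) has_real_derivative facet_volume v i y) (at 0)"
    using eventually_nondegenerate[OF nd]
    by (rule eventually_mono) (auto intro: support_volume_has_partial_derivative v)
qed (rule isCont_facet_volume[OF v nd])

text \<open>One level of nondegeneracy for each derivative: the prisms over the facets must have
  differentiable volumes, too.\<close>

definition regular :: "('n::finite \<Rightarrow> real^'d) \<Rightarrow> real^'n \<Rightarrow> bool" where
  "regular v x \<longleftrightarrow> nondegenerate v x \<and>
     (\<forall>i. v i \<noteq> 0 \<longrightarrow> nondegenerate (facet_normals 0 v i) (facet_offsets v i x))"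

text \<open>The chain rule: the gradient of the prism volume, applied to the change of the prism
  offsets that \<open>h\<close> induces.\<close>

definition facet_volume_deriv :: "('n::finite \<Rightarrow> real^'d) \<Rightarrow> 'n \<Rightarrow> real^'n \<Rightarrow> real^'n \<Rightarrow> real" where
  "facet_volume_deriv v i x h = (if v i = 0 then 0 else
     \<Sum>K\<in>UNIV. facet_shift v i h $ K * facet_volume (facet_normals 0 v i) K (facet_offsets v i x))"

lemma facet_volume_has_derivative:
  fixes v :: "'n::finite \<Rightarrow> real^'d"
  assumes v: "positively_spanning v" and reg: "regular v x"
  shows "(facet_volume v i has_derivative facet_volume_deriv v i x) (at x)"
proof (cases "v i = 0")
  case True
  then have "facet_volume v i = (\<lambda>_. 0)" "facet_volume_deriv v i x = (\<lambda>_. 0)"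
    by (simp_all add: facet_volume_def facet_volume_deriv_def fun_eq_iff)
  then show ?thesis by simp
next
  case False
  have eq: "facet_offsets v i = (\<lambda>y. facet_offsets v i 0 + facet_shift v i y)"
    using facet_offsets_add[of v i 0, simplified] by (rule ext)
  have "(facet_shift v i has_derivative facet_shift v i) (at x)"
    by (intro bounded_linear_imp_has_derivative linear_conv_bounded_linear[THEN iffD1] linear_facet_shift)
  then have "((\<lambda>y. facet_offsets v i 0 + facet_shift v i y) has_derivative (\<lambda>h. 0 + facet_shift v i h)) (at x)"
    by (intro has_derivative_add has_derivative_const)
  then have "(facet_offsets v i has_derivative facet_shift v i) (at x)"
    by (subst eq) simp
  from diff_chain_at[OF this support_volume_has_derivative[OF positively_spanning_facet_normals[OF v False]]]
  have "((\<lambda>y. support_volume (facet_normals 0 v i) (facet_offsets v i y)) has_derivative facet_volume_deriv v i x) (at x)"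
    using reg False by (simp add: comp_def regular_def facet_volume_deriv_def[abs_def])
  then show ?thesis using False by (simp add: facet_volume_def[abs_def])
qed

text \<open>Moving \<open>x $ j\<close> alone moves just the side of the prism that comes from
  constraint \<open>j\<close>, at unit speed. What remains is the area of that side, which is itself
  a prism over the (possibly empty) ridge of \<open>i\<close> and \<open>j\<close>, up to
  normalization.\<close>

lemma facet_volume_deriv_axis:
  assumes "j \<noteq> i"
  shows "facet_volume_deriv v i x (axis j 1) =
    (if v i = 0 then 0 else facet_volume (facet_normals 0 v i) (Some j) (facet_offsets v i x))"
proof -
  have "facet_shift v i (axis j 1) $ K = (if K = Some j then 1 else 0)" for K
    using assms by (auto simp: facet_shift_def axis_def split: option.split)
  then show ?thesis by (simp add: facet_volume_deriv_def if_distrib[of "\<lambda>c. c * _"] cong: if_cong)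
qed

lemma facet_volume_deriv_expand:
  fixes v :: "'n::finite \<Rightarrow> real^'d"
  assumes "positively_spanning v" "regular v x"
  shows "facet_volume_deriv v i x h = (\<Sum>j\<in>UNIV. h $ j * facet_volume_deriv v i x (axis j 1))"
proof -
  have lin: "linear (facet_volume_deriv v i x)"
    using facet_volume_has_derivative[OF assms] by (rule has_derivative_linear)
  have "facet_volume_deriv v i x h = facet_volume_deriv v i x (\<Sum>j\<in>UNIV. h $ j *\<^sub>R axis j 1)"
    by (simp add: basis_expansion[of h, unfolded scalar_mult_eq_scaleR])
  also have "\<dots> = (\<Sum>j\<in>UNIV. h $ j * facet_volume_deriv v i x (axis j 1))"
    by (simp add: linear_sum[OF lin] linear_scale[OF lin])
  finally show ?thesis .
qed

text \<open>Young's version of the symmetry of second derivatives, where \<open>g\<close> is known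
  to be differentiable only at the point \<open>x\<close>. The mean value theorem in direction
  \<open>i\<close> and two first-order expansions of \<open>g\<close> at \<open>x\<close> give the
  limit, while the second difference itself is symmetric in \<open>i\<close> and
  \<open>j\<close>.\<close>

lemma second_difference_limit:
  fixes f :: "real^'n \<Rightarrow> real"
  assumes partials: "\<forall>\<^sub>F y in nhds x. ((\<lambda>t. f (y + t *\<^sub>R axis i 1)) has_real_derivative g y) (at 0)"
    and D: "(g has_derivative D) (at x)"
  shows "((\<lambda>s. (f (x + s *\<^sub>R axis i 1 + s *\<^sub>R axis j 1) - f (x + s *\<^sub>R axis i 1) - f (x + s *\<^sub>R axis j 1) + f x) / s\<^sup>2)
     \<longlongrightarrow> D (axis j 1)) (at_right 0)"
proof (rule tendstoI)
  fix \<epsilon> :: real assume "\<epsilon> > 0"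
  \<comment> \<open>The expansions are taken at distances at most \<open>2 * s\<close> and
    \<open>s\<close>, which makes an error of \<open>3 * \<eta>\<close> after division by
    \<open>s\<close>; the factor 4 keeps it strictly below \<epsilon>.\<close>
  define \<eta> where "\<eta> = \<epsilon> / 4"
  have "\<eta> > 0" using \<open>\<epsilon> > 0\<close> by (simp add: \<eta>_def)
  obtain d1 where d1: "d1 > 0" "\<And>y. dist y x < d1 \<Longrightarrow> ((\<lambda>t. f (y + t *\<^sub>R axis i 1)) has_real_derivative g y) (at 0)"
    using partials unfolding eventually_nhds_metric by blast
  obtain d2 where d2: "d2 > 0" "\<And>y. norm (y - x) < d2 \<Longrightarrow> norm (g y - g x - D (y - x)) \<le> \<eta> * norm (y - x)"
    using D \<open>\<eta> > 0\<close> unfolding has_derivative_at_alt by blast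
  have lin: "linear D" using D by (rule has_derivative_linear)
  let ?\<Delta> = "\<lambda>s. f (x + s *\<^sub>R axis i 1 + s *\<^sub>R axis j 1) - f (x + s *\<^sub>R axis i 1) - f (x + s *\<^sub>R axis j 1) + f x"
  have "dist (?\<Delta> s / s\<^sup>2) (D (axis j 1)) < \<epsilon>" if s: "0 < s" "s < min d1 d2 / 2" for s
  proof -
    have nb: "norm (t *\<^sub>R axis i 1 + u *\<^sub>R axis j 1 :: real^'n) \<le> t + u" if "0 \<le> t" "0 \<le> u" for t u
      using norm_triangle_ineq[of "t *\<^sub>R axis i 1 :: real^'n" "u *\<^sub>R axis j 1"] that by simp
    define \<phi> where "\<phi> t = f (x + t *\<^sub>R axis i 1 + s *\<^sub>R axis j 1) - f (x + t *\<^sub>R axis i 1)" for t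
    define \<phi>' where "\<phi>' t = g (x + t *\<^sub>R axis i 1 + s *\<^sub>R axis j 1) - g (x + t *\<^sub>R axis i 1)" for t
    have "\<exists>\<xi>. 0 < \<xi> \<and> \<xi> < s \<and> \<phi> s - \<phi> 0 = (s - 0) * \<phi>' \<xi>"
    proof (rule MVT2[OF s(1)])
      fix t assume t: "0 \<le> t" "t \<le> s"
      have shift: "((\<lambda>r. f (b + r *\<^sub>R axis i 1)) has_real_derivative g (b + t *\<^sub>R axis i 1)) (at t)"
        if "dist (b + t *\<^sub>R axis i 1) x < d1" for b
        using d1(2)[OF that] DERIV_shift[of "\<lambda>r. f (b + r *\<^sub>R axis i 1)" _ 0 t]
        by (simp add: algebra_simps)
      have "dist ((x + s *\<^sub>R axis j 1) + t *\<^sub>R axis i 1) x < d1" "dist (x + t *\<^sub>R axis i 1) x < d1"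
        using nb[of t s] nb[of t 0] t s by (auto simp: dist_norm algebra_simps)
      then show "(\<phi> has_real_derivative \<phi>' t) (at t)"
        unfolding \<phi>_def \<phi>'_def
        using DERIV_diff[OF shift[of "x + s *\<^sub>R axis j 1"] shift[of x]] by (simp add: algebra_simps)
    qed
    then obtain \<xi> where \<xi>: "0 < \<xi>" "\<xi> < s" "\<phi> s - \<phi> 0 = s * \<phi>' \<xi>" by auto
    have \<Delta>: "?\<Delta> s = s * \<phi>' \<xi>" using \<xi>(3) by (simp add: \<phi>_def algebra_simps)
    let ?a = "\<xi> *\<^sub>R axis i 1 + s *\<^sub>R axis j 1 :: real^'n" and ?b = "\<xi> *\<^sub>R axis i 1 :: real^'n"
    have na: "norm ?a \<le> 2 * s" "norm ?b \<le> s" using nb[of \<xi> s] nb[of \<xi> 0] \<xi> s by auto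
    have "norm (g (x + ?a) - g x - D ?a) \<le> \<eta> * norm ?a" "norm (g (x + ?b) - g x - D ?b) \<le> \<eta> * norm ?b"
      using d2(2)[of "x + ?a"] d2(2)[of "x + ?b"] na s by auto
    moreover have "\<eta> * norm ?a \<le> \<eta> * (2 * s)" "\<eta> * norm ?b \<le> \<eta> * s"
      using na \<open>\<eta> > 0\<close> by (auto intro: mult_left_mono)
    moreover have "D ?a - D ?b = s * D (axis j 1)"
      by (simp add: linear_add[OF lin] linear_scale[OF lin])
    ultimately have "\<bar>\<phi>' \<xi> - s * D (axis j 1)\<bar> \<le> \<eta> * 3 * s"
      by (simp add: \<phi>'_def add.assoc)
    moreover have eq: "?\<Delta> s / s\<^sup>2 - D (axis j 1) = (\<phi>' \<xi> - s * D (axis j 1)) / s"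
      using s unfolding \<Delta> by (simp add: field_simps power2_eq_square)
    ultimately have "\<bar>?\<Delta> s / s\<^sup>2 - D (axis j 1)\<bar> \<le> \<eta> * 3"
      using s unfolding eq by (simp add: divide_le_eq)
    then show ?thesis using \<open>\<epsilon> > 0\<close> by (simp add: dist_real_def \<eta>_def)
  qed
  then show "\<forall>\<^sub>F s in at_right 0. dist (?\<Delta> s / s\<^sup>2) (D (axis j 1)) < \<epsilon>"
    using d1(1) d2(1) by (intro eventually_at_rightI[of 0 "min d1 d2 / 2"]) auto
qed

lemma facet_volume_deriv_symmetric:
  fixes v :: "'n::finite \<Rightarrow> real^'d"
  assumes v: "positively_spanning v" and reg: "regular v x"
  shows "facet_volume_deriv v i x (axis j 1) = facet_volume_deriv v j x (axis i 1)"
proof -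
  have nd: "nondegenerate v x" using reg by (simp add: regular_def)
  have "\<forall>\<^sub>F y in nhds x. ((\<lambda>t. support_volume v (y + t *\<^sub>R axis k 1)) has_real_derivative facet_volume v k y) (at 0)" for k
    using eventually_nondegenerate[OF nd]
    by (rule eventually_mono) (auto intro: support_volume_has_partial_derivative v)
  note lim = second_difference_limit[OF this facet_volume_has_derivative[OF v reg]]
  show ?thesis
    by (rule tendsto_unique[OF _ lim[of i j]]) (use lim[of j i] in \<open>simp_all add: algebra_simps\<close>)
qed

section \<open>Euler identities and adjacent facets\<close>

lemma support_volume_scale:
  fixes v :: "'n::finite \<Rightarrow> real^'d"
  assumes "c > 0"
  shows "support_volume v (c *\<^sub>R x) = c ^ CARD('d) * support_volume v x"
proof -
  have "support_polytope v (c *\<^sub>R x) = (\<lambda>p. c *\<^sub>R p + 0) ` support_polytope v x"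
  proof (intro equalityI subsetI)
    fix p assume p: "p \<in> support_polytope v (c *\<^sub>R x)"
    have "p = c *\<^sub>R (inverse c *\<^sub>R p) + 0" using assms by simp
    moreover have "inverse c *\<^sub>R p \<in> support_polytope v x"
      using p assms by (simp add: support_polytope_def field_simps)
    ultimately show "p \<in> (\<lambda>p. c *\<^sub>R p + 0) ` support_polytope v x" by blast
  qed (use assms in \<open>auto simp: support_polytope_def\<close>)
  then show ?thesis
    using assms measure_lebesgue_affine[of c 0 "support_polytope v x"] by (simp add: support_volume_def)
qed

definition translation_offsets :: "('n::finite \<Rightarrow> real^'d) \<Rightarrow> real^'d \<Rightarrow> real^'n" where
  "translation_offsets v a = (\<chi> i. v i \<bullet> a)"

lemma support_volume_translate:
  "support_volume v (x + translation_offsets v a) = support_volume v x"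
proof -
  have "support_polytope v (x + translation_offsets v a) = (+) a ` support_polytope v x"
  proof (intro equalityI subsetI)
    fix p assume "p \<in> support_polytope v (x + translation_offsets v a)"
    then have "p - a \<in> support_polytope v x"
      by (simp add: support_polytope_def translation_offsets_def inner_diff_right algebra_simps)
    then show "p \<in> (+) a ` support_polytope v x" by (metis add.commute diff_add_cancel image_eqI)
  qed (auto simp: support_polytope_def translation_offsets_def inner_add_right)
  then show ?thesis by (simp add: support_volume_def measure_translation)
qed

lemma nondegenerate_scale: "c > 0 \<Longrightarrow> nondegenerate v x \<Longrightarrow> nondegenerate v (c *\<^sub>R x)"
  unfolding nondegenerate_def by (auto simp: mult.left_commute[of _ c])

lemma nondegenerate_translate: "nondegenerate v x \<Longrightarrow> nondegenerate v (x + translation_offsets v a)"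
  unfolding nondegenerate_def translation_offsets_def by (auto simp: algebra_simps)

lemma support_volume_euler:
  fixes v :: "'n::finite \<Rightarrow> real^'d"
  assumes v: "positively_spanning v" and nd: "nondegenerate v x"
  shows "(\<Sum>i\<in>UNIV. x $ i * facet_volume v i x) = CARD('d) * support_volume v x"
proof -
  have d1: "((\<lambda>s. support_volume v (0 + s *\<^sub>R x)) has_real_derivative (\<Sum>i\<in>UNIV. x $ i * facet_volume v i x)) (at 1)"
    using support_volume_has_derivative[OF v nd] by (intro has_derivative_along_line) simp
  have d2: "((\<lambda>s. s ^ CARD('d) * support_volume v x) has_real_derivative CARD('d) * support_volume v x) (at 1)"
    by (auto intro!: derivative_eq_intros)
  have ev: "\<forall>\<^sub>F s in nhds 1. support_volume v (0 + s *\<^sub>R x) = s ^ CARD('d) * support_volume v x"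
    using eventually_nhds_in_open[of "{0<..}" "1::real"]
    by (auto elim!: eventually_mono simp: support_volume_scale)
  show ?thesis
    using d1 d2 unfolding DERIV_cong_ev[OF refl ev refl] by (rule DERIV_unique)
qed

text \<open>The prism has fixed height 1, so its volume is not visibly homogeneous in
  \<open>x\<close>. The degree is read off by differentiating the scaling law of the volume in
  direction \<open>i\<close>.\<close>

lemma facet_volume_scale:
  fixes v :: "'n::finite \<Rightarrow> real^'d"
  assumes v: "positively_spanning v" and nd: "nondegenerate v x" and c: "c > 0"
  shows "facet_volume v i (c *\<^sub>R x) = c ^ (CARD('d) - 1) * facet_volume v i x"
proof -
  have "((\<lambda>s. support_volume v (c *\<^sub>R x + s *\<^sub>R axis i 1)) has_real_derivative facet_volume v i (c *\<^sub>R x)) (at 0)"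
    by (intro support_volume_has_partial_derivative v nondegenerate_scale c nd)
  moreover have "((\<lambda>s. support_volume v (x + s *\<^sub>R axis i 1)) has_real_derivative facet_volume v i x) (at (0 / c))"
    using support_volume_has_partial_derivative[OF v nd] by simp
  then have "((\<lambda>s. support_volume v (x + (s / c) *\<^sub>R axis i 1)) has_real_derivative facet_volume v i x * (1 / c)) (at 0)"
    using DERIV_chain2[of "\<lambda>s. support_volume v (x + s *\<^sub>R axis i 1)" _ "\<lambda>s. s / c" 0 "1 / c"]
      DERIV_cdivide[OF DERIV_ident, of c] by auto
  then have "((\<lambda>s. c ^ CARD('d) * support_volume v (x + (s / c) *\<^sub>R axis i 1)) has_real_derivative c ^ CARD('d) * (facet_volume v i x * (1 / c))) (at 0)"
    by (rule DERIV_cmult)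
  moreover have "c ^ CARD('d) * support_volume v (x + (s / c) *\<^sub>R axis i 1) = support_volume v (c *\<^sub>R x + s *\<^sub>R axis i 1)" for s
    using c support_volume_scale[OF c, of v "x + (s / c) *\<^sub>R axis i 1"] by (simp add: scaleR_add_right)
  ultimately have "facet_volume v i (c *\<^sub>R x) = c ^ CARD('d) * (facet_volume v i x * (1 / c))"
    by (simp add: DERIV_unique)
  also have "c ^ CARD('d) = c * c ^ (CARD('d) - 1)"
    by (simp add: power_eq_if)
  finally show ?thesis using c by simp
qed

lemma facet_volume_translate:
  fixes v :: "'n::finite \<Rightarrow> real^'d"
  assumes v: "positively_spanning v" and nd: "nondegenerate v x"
  shows "facet_volume v i (x + translation_offsets v a) = facet_volume v i x"
proof -
  have "((\<lambda>s. support_volume v (x + translation_offsets v a + s *\<^sub>R axis i 1)) has_real_derivative facet_volume v i (x + translation_offsets v a)) (at 0)"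
    by (intro support_volume_has_partial_derivative v nondegenerate_translate nd)
  moreover have "support_volume v (x + translation_offsets v a + s *\<^sub>R axis i 1) = support_volume v (x + s *\<^sub>R axis i 1)" for s
    using support_volume_translate[of v "x + s *\<^sub>R axis i 1" a] by (simp add: algebra_simps)
  ultimately show ?thesis
    using support_volume_has_partial_derivative[OF v nd] by (simp add: DERIV_unique)
qed

lemma facet_volume_deriv_euler:
  fixes v :: "'n::finite \<Rightarrow> real^'d"
  assumes v: "positively_spanning v" and reg: "regular v x"
  shows "facet_volume_deriv v i x x = real (CARD('d) - 1) * facet_volume v i x"
proof -
  have nd: "nondegenerate v x" using reg by (simp add: regular_def)
  have d1: "((\<lambda>s. facet_volume v i (0 + s *\<^sub>R x)) has_real_derivative facet_volume_deriv v i x x) (at 1)"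
    using facet_volume_has_derivative[OF v reg] by (intro has_derivative_along_line) simp
  have d2: "((\<lambda>s. s ^ (CARD('d) - 1) * facet_volume v i x) has_real_derivative real (CARD('d) - 1) * facet_volume v i x) (at 1)"
    by (auto intro!: derivative_eq_intros)
  have ev: "\<forall>\<^sub>F s in nhds 1. facet_volume v i (0 + s *\<^sub>R x) = s ^ (CARD('d) - 1) * facet_volume v i x"
    using eventually_nhds_in_open[of "{0<..}" "1::real"]
    by (auto elim!: eventually_mono simp: facet_volume_scale[OF v nd])
  show ?thesis
    using d1 d2 unfolding DERIV_cong_ev[OF refl ev refl] by (rule DERIV_unique)
qed

text \<open>The easy inclusion for the kernel: facet volumes stay constant along a
  translation.\<close>

lemma facet_volume_deriv_translation:
  fixes v :: "'n::finite \<Rightarrow> real^'d"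
  assumes v: "positively_spanning v" and reg: "regular v x"
  shows "facet_volume_deriv v i x (translation_offsets v a) = 0"
proof -
  have nd: "nondegenerate v x" using reg by (simp add: regular_def)
  have "((\<lambda>s. facet_volume v i (x + s *\<^sub>R translation_offsets v a)) has_real_derivative facet_volume_deriv v i x (translation_offsets v a)) (at 0)"
    using facet_volume_has_derivative[OF v reg] by (intro has_derivative_along_line) simp
  moreover have "s *\<^sub>R translation_offsets v a = translation_offsets v (s *\<^sub>R a)" for s
    by (simp add: translation_offsets_def vec_eq_iff)
  ultimately have "((\<lambda>s. facet_volume v i x) has_real_derivative facet_volume_deriv v i x (translation_offsets v a)) (at 0)"
    by (simp add: facet_volume_translate[OF v nd])
  then show ?thesis using DERIV_unique DERIV_const by blast
qed

section \<open>Positivity of volumes, facets and ridges\<close>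

lemma support_volume_nonneg: "0 \<le> support_volume v x"
  by (simp add: support_volume_def)

lemma facet_volume_nonneg: "0 \<le> facet_volume v i x"
  by (simp add: facet_volume_def support_volume_nonneg)

lemma open_strict_polytope:
  fixes v :: "'n::finite \<Rightarrow> real^'d"
  shows "open {p. \<forall>k. v k \<bullet> p < x $ k}"
proof -
  have "{p. \<forall>k. v k \<bullet> p < x $ k} = (\<Inter>k. {p. v k \<bullet> p < x $ k})" by auto
  then show ?thesis by (auto intro!: open_INT open_Collect_less continuous_intros)
qed

lemma support_volume_pos_iff:
  fixes v :: "'n::finite \<Rightarrow> real^'d"
  assumes v: "positively_spanning v" and nz: "\<And>k. v k \<noteq> 0 \<or> x $ k \<noteq> 0"
  shows "0 < support_volume v x \<longleftrightarrow> (\<exists>p. \<forall>k. v k \<bullet> p < x $ k)"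
proof
  assume "0 < support_volume v x"
  then have "\<not> negligible (support_polytope v x)"
    using negligible_imp_measure0[of "support_polytope v x"] unfolding support_volume_def by linarith
  moreover have "negligible (\<Union>k. {p. v k \<bullet> p = x $ k})"
    using nz by (intro negligible_Union finite_imageI) (auto simp: negligible_hyperplane)
  ultimately have "\<not> support_polytope v x \<subseteq> (\<Union>k. {p. v k \<bullet> p = x $ k})"
    by (meson negligible_subset)
  then obtain p where "p \<in> support_polytope v x" "\<And>k. v k \<bullet> p \<noteq> x $ k" by blast
  then show "\<exists>p. \<forall>k. v k \<bullet> p < x $ k" by (auto simp: support_polytope_def less_le)
next
  assume "\<exists>p. \<forall>k. v k \<bullet> p < x $ k"
  then have "{p. \<forall>k. v k \<bullet> p < x $ k} \<noteq> {}" by blast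
  with open_strict_polytope[of v x] have "\<not> negligible {p. \<forall>k. v k \<bullet> p < x $ k}" using open_not_negligible by blast
  then have "\<not> negligible (support_polytope v x)"
    by (rule contrapos_nn) (auto elim!: negligible_subset simp: support_polytope_def less_imp_le)
  then show "0 < support_volume v x"
    using negligible_iff_measure0[OF lmeasurable_support_polytope[OF v]] support_volume_nonneg[of v x]
    unfolding support_volume_def by (metis less_eq_real_def)
qed

lemma facet_normals_simps:
  "facet_normals 0 v i None = - v i"
  "facet_normals 0 v i (Some i) = v i"
  "k \<noteq> i \<Longrightarrow> facet_normals 0 v i (Some k) = v k - ((v k \<bullet> v i) / (v i \<bullet> v i)) *\<^sub>R v i"
  by (simp_all add: facet_normals_def)

lemma facet_offsets_simps:
  "facet_offsets v i x $ None = 0"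
  "facet_offsets v i x $ Some i = 1"
  "k \<noteq> i \<Longrightarrow> facet_offsets v i x $ Some k = x $ k - (v k \<bullet> v i) / (v i \<bullet> v i) * x $ i"
  by (simp_all add: facet_offsets_def)

lemma all_option_split: "(\<forall>K. Q K) \<longleftrightarrow> Q None \<and> Q (Some i) \<and> (\<forall>k. k \<noteq> i \<longrightarrow> Q (Some k))"
  by (metis option.exhaust)

text \<open>Sliding a point along \<open>v i\<close> does not change its inner products with the
  projected normals, so points can be moved from the prism to the hyperplane of facet
  \<open>i\<close> and back. The set \<open>J\<close> of further tight constraints is empty for
  facets and a singleton for ridges.\<close>

lemma facet_strict_points:
  fixes v :: "'n::finite \<Rightarrow> real^'d"
  assumes "v i \<noteq> 0" "i \<notin> J"
  shows "(\<exists>q. (\<forall>j\<in>J. facet_normals 0 v i (Some j) \<bullet> q = facet_offsets v i x $ Some j) \<and>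
      (\<forall>K. K \<notin> Some ` J \<longrightarrow> facet_normals 0 v i K \<bullet> q < facet_offsets v i x $ K)) \<longleftrightarrow>
    (\<exists>p. v i \<bullet> p = x $ i \<and> (\<forall>j\<in>J. v j \<bullet> p = x $ j) \<and> (\<forall>k. k \<noteq> i \<longrightarrow> k \<notin> J \<longrightarrow> v k \<bullet> p < x $ k))"
    (is "(\<exists>q. ?Q q) \<longleftrightarrow> (\<exists>p. ?P p)")
proof
  let ?n = "v i \<bullet> v i"
  have n: "?n > 0" using assms by simp
  let ?l = "\<lambda>k q. v k \<bullet> q - (v k \<bullet> v i) / ?n * (v i \<bullet> q)" and ?r = "\<lambda>k. x $ k - (v k \<bullet> v i) / ?n * x $ i"
  have simps: "facet_normals 0 v i (Some k) \<bullet> q = ?l k q" "facet_offsets v i x $ Some k = ?r k" if "k \<noteq> i" for k q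
    using that by (simp_all add: facet_normals_simps facet_offsets_simps inner_diff_left)
  have J: "j \<noteq> i" if "j \<in> J" for j using that assms(2) by blast
  have Q: "?Q q \<longleftrightarrow> 0 < v i \<bullet> q \<and> v i \<bullet> q < 1 \<and> (\<forall>j\<in>J. ?l j q = ?r j) \<and>
      (\<forall>k. k \<noteq> i \<longrightarrow> k \<notin> J \<longrightarrow> ?l k q < ?r k)" for q
    unfolding all_option_split[of _ i] using assms(2) J
    by (auto simp: facet_normals_simps(1,2) facet_offsets_simps(1,2) simps)
  {
    assume "\<exists>q. ?Q q"
    then obtain q where q: "\<And>j. j \<in> J \<Longrightarrow> ?l j q = ?r j" "\<And>k. k \<noteq> i \<Longrightarrow> k \<notin> J \<Longrightarrow> ?l k q < ?r k"
      unfolding Q by blast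
    let ?p = "q + ((x $ i - v i \<bullet> q) / ?n) *\<^sub>R v i"
    have vk: "v k \<bullet> ?p = ?l k q - ?r k + x $ k" for k
      by (simp add: inner_add_right algebra_simps diff_divide_distrib)
    have "v i \<bullet> ?p = x $ i" using n by (simp add: inner_add_right)
    moreover have "v j \<bullet> ?p = x $ j" if "j \<in> J" for j unfolding vk using q(1)[OF that] by simp
    moreover have "v k \<bullet> ?p < x $ k" if "k \<noteq> i" "k \<notin> J" for k unfolding vk using q(2)[OF that] by simp
    ultimately show "\<exists>p. ?P p" by blast
  next
    assume "\<exists>p. ?P p"
    then obtain p where p: "v i \<bullet> p = x $ i" "\<And>j. j \<in> J \<Longrightarrow> v j \<bullet> p = x $ j"
      "\<And>k. k \<noteq> i \<Longrightarrow> k \<notin> J \<Longrightarrow> v k \<bullet> p < x $ k" by blast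
    \<comment> \<open>Height \<open>1/2\<close> lies strictly between the two ends of the
      prism.\<close>
    let ?q = "p + ((1/2 - x $ i) / ?n) *\<^sub>R v i"
    have vi: "v i \<bullet> ?q = 1/2" using n p by (simp add: inner_add_right)
    have lk: "?l k ?q = v k \<bullet> p - x $ k + ?r k" for k
      unfolding vi by (simp add: inner_add_right algebra_simps diff_divide_distrib)
    have "?l j ?q = ?r j" if "j \<in> J" for j unfolding lk using p(2)[OF that] by simp
    moreover have "?l k ?q < ?r k" if "k \<noteq> i" "k \<notin> J" for k unfolding lk using p(3)[OF that] by simp
    moreover have "0 < v i \<bullet> ?q" "v i \<bullet> ?q < 1" unfolding vi by simp_all
    ultimately show "\<exists>q. ?Q q" unfolding Q by blast
  }
qed

lemma facet_volume_pos_iff: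
  fixes v :: "'n::finite \<Rightarrow> real^'d"
  assumes v: "positively_spanning v" and nd: "nondegenerate v x"
  shows "0 < facet_volume v i x \<longleftrightarrow> (\<exists>p. v i \<bullet> p = x $ i \<and> (\<forall>k. k \<noteq> i \<longrightarrow> v k \<bullet> p < x $ k))"
proof (cases "v i = 0")
  case True
  then show ?thesis using nd by (auto simp: facet_volume_def nondegenerate_def)
next
  case False
  then have "0 < facet_volume v i x \<longleftrightarrow> (\<exists>q. \<forall>K. facet_normals 0 v i K \<bullet> q < facet_offsets v i x $ K)"
    by (simp add: facet_volume_def support_volume_pos_iff[OF positively_spanning_facet_normals[OF v False] facet_normals_nonzero[OF nd False]])
  also have "\<dots> \<longleftrightarrow> (\<exists>p. v i \<bullet> p = x $ i \<and> (\<forall>k. k \<noteq> i \<longrightarrow> v k \<bullet> p < x $ k))"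
    using facet_strict_points[of v i "{}" x] False by simp
  finally show ?thesis .
qed

lemma facet_volume_deriv_pos_iff:
  fixes v :: "'n::finite \<Rightarrow> real^'d"
  assumes v: "positively_spanning v" and reg: "regular v x" and "j \<noteq> i"
  shows "0 < facet_volume_deriv v i x (axis j 1) \<longleftrightarrow>
    (\<exists>p. v i \<bullet> p = x $ i \<and> v j \<bullet> p = x $ j \<and> (\<forall>k. k \<noteq> i \<longrightarrow> k \<noteq> j \<longrightarrow> v k \<bullet> p < x $ k))"
proof (cases "v i = 0")
  case True
  moreover have "x $ i \<noteq> 0" using reg True unfolding regular_def nondegenerate_def by metis
  ultimately show ?thesis by (simp add: facet_volume_deriv_def)
next
  case False
  then have nd: "nondegenerate (facet_normals 0 v i) (facet_offsets v i x)"
    using reg by (simp add: regular_def)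
  have "0 < facet_volume_deriv v i x (axis j 1) \<longleftrightarrow>
     (\<exists>q. facet_normals 0 v i (Some j) \<bullet> q = facet_offsets v i x $ (Some j) \<and>
      (\<forall>K. K \<noteq> Some j \<longrightarrow> facet_normals 0 v i K \<bullet> q < facet_offsets v i x $ K))"
    using False by (simp add: facet_volume_deriv_axis[OF \<open>j \<noteq> i\<close>]
      facet_volume_pos_iff[OF positively_spanning_facet_normals[OF v False] nd])
  also have "\<dots> \<longleftrightarrow> (\<exists>p. v i \<bullet> p = x $ i \<and> v j \<bullet> p = x $ j \<and> (\<forall>k. k \<noteq> i \<longrightarrow> k \<noteq> j \<longrightarrow> v k \<bullet> p < x $ k))"
    using facet_strict_points[of v i "{j}" x] False \<open>j \<noteq> i\<close> by simp
  finally show ?thesis .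
qed

lemma facet_volume_deriv_axis_nonneg: "j \<noteq> i \<Longrightarrow> 0 \<le> facet_volume_deriv v i x (axis j 1)"
  by (simp add: facet_volume_deriv_axis facet_volume_nonneg)

text \<open>A ray from an interior point leaves the polytope, but possibly through a
  lower-dimensional face, which would not give a positive facet volume. A generic starting point
  meets the boundary hyperplanes at distinct times, so that exactly one constraint is tight at the
  exit.\<close>

lemma ray_hits_facet:
  fixes v :: "'n::finite \<Rightarrow> real^'d"
  assumes v: "positively_spanning v" and nd: "nondegenerate v x"
    and int: "\<forall>k. v k \<bullet> p0 < x $ k" and "u \<noteq> 0"
  shows "\<exists>k. 0 < v k \<bullet> u \<and> 0 < facet_volume v k x"
proof -
  \<comment> \<open>The starting points whose ray meets the hyperplanes \<open>k\<close> and
    \<open>l\<close> at the same time. Multiplying out the denominators leaves a linear equation in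
    \<open>q\<close>, nontrivial by nondegeneracy.\<close>
  define T where "T k l = {q. (x $ k - v k \<bullet> q) * (v l \<bullet> u) = (x $ l - v l \<bullet> q) * (v k \<bullet> u)}" for k l
  define I where "I = {k. 0 < v k \<bullet> u}"
  have I: "I \<noteq> {}" using v \<open>u \<noteq> 0\<close> unfolding I_def positively_spanning_def by (auto simp: not_less[symmetric])
  have neg: "negligible (T k l)" if "k \<in> I" "l \<in> I" "k \<noteq> l" for k l
  proof -
    let ?n = "(v l \<bullet> u) *\<^sub>R v k - (v k \<bullet> u) *\<^sub>R v l" and ?b = "x $ k * (v l \<bullet> u) - x $ l * (v k \<bullet> u)"
    have pos: "0 < v k \<bullet> u" "0 < v l \<bullet> u" using that by (auto simp: I_def)
    have "?n \<noteq> 0 \<or> ?b \<noteq> 0"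
    proof (rule ccontr)
      assume "\<not> (?n \<noteq> 0 \<or> ?b \<noteq> 0)"
      then have "(v k \<bullet> u) *\<^sub>R v l = (v l \<bullet> u) *\<^sub>R v k" "x $ l * (v k \<bullet> u) = x $ k * (v l \<bullet> u)" by auto
      moreover have "v l = (1 / (v k \<bullet> u)) *\<^sub>R ((v k \<bullet> u) *\<^sub>R v l)" using pos by simp
      ultimately have "v l = ((v l \<bullet> u) / (v k \<bullet> u)) *\<^sub>R v k" "x $ l = (v l \<bullet> u) / (v k \<bullet> u) * x $ k"
        using pos by (simp_all add: field_simps)
      moreover have "v k \<noteq> 0" using pos by auto
      ultimately show False using nd that(3) unfolding nondegenerate_def by blast
    qed
    then have "negligible {q. ?n \<bullet> q = ?b}" by (rule negligible_hyperplane)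
    moreover have "T k l \<subseteq> {q. ?n \<bullet> q = ?b}"
      by (auto simp: T_def inner_diff_left algebra_simps)
    ultimately show ?thesis by (rule negligible_subset)
  qed
  have "negligible (\<Union>k\<in>I. \<Union>l\<in>I - {k}. T k l)"
    by (intro negligible_Union finite_imageI finite) (auto intro!: negligible_Union finite_imageI neg)
  moreover have "\<not> negligible {q. \<forall>k. v k \<bullet> q < x $ k}"
    by (rule open_not_negligible) (use int open_strict_polytope[of v x] in auto)
  ultimately have "\<not> {q. \<forall>k. v k \<bullet> q < x $ k} \<subseteq> (\<Union>k\<in>I. \<Union>l\<in>I - {k}. T k l)"
    by (meson negligible_subset)
  then obtain q where q: "\<And>k. v k \<bullet> q < x $ k" and nt: "\<And>k l. k \<in> I \<Longrightarrow> l \<in> I \<Longrightarrow> k \<noteq> l \<Longrightarrow> q \<notin> T k l"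
    by blast
  define t where "t k = (x $ k - v k \<bullet> q) / (v k \<bullet> u)" for k
  obtain k where "is_arg_min t (\<lambda>k. k \<in> I) k"
    using ex_is_arg_min_if_finite[of I t] I by auto
  then have k: "k \<in> I" "\<And>l. l \<in> I \<Longrightarrow> t k \<le> t l" by (auto simp: is_arg_min_linorder)
  have ku: "0 < v k \<bullet> u" using k(1) by (simp add: I_def)
  have tk: "t k > 0" using q[of k] ku by (simp add: t_def)
  have "v k \<bullet> (q + t k *\<^sub>R u) = x $ k" using ku by (simp add: inner_add_right t_def)
  moreover have "v l \<bullet> (q + t k *\<^sub>R u) < x $ l" if "l \<noteq> k" for l
  proof (cases "l \<in> I")
    case True
    then have lu: "0 < v l \<bullet> u" by (simp add: I_def)
    have "t k \<noteq> t l" using nt[OF k(1) True] that ku lu by (auto simp: T_def t_def field_simps)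
    then have "t k < t l" using k(2)[OF True] by simp
    then have "t k * (v l \<bullet> u) < t l * (v l \<bullet> u)" using lu by simp
    also have "\<dots> = x $ l - v l \<bullet> q" using lu by (simp add: t_def)
    finally show ?thesis by (simp add: inner_add_right)
  next
    case False
    then have "t k * (v l \<bullet> u) \<le> 0" using tk by (simp add: I_def mult_nonneg_nonpos)
    then show ?thesis using q[of l] by (simp add: inner_add_right)
  qed
  ultimately have "0 < facet_volume v k x" unfolding facet_volume_pos_iff[OF v nd] by blast
  then show ?thesis using ku by blast
qed

text \<open>If two sides of the prism over facet \<open>i\<close>, coming from \<open>j\<close> and
  \<open>k\<close>, have the same hyperplane, then hyperplane \<open>k\<close> contains the
  intersection of hyperplanes \<open>i\<close> and \<open>j\<close>, and this is what
  \<open>R\<close> excludes. The ends of the prism are perpendicular to its sides and cannot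
  interfere.\<close>

lemma regularI:
  fixes v :: "'n::finite \<Rightarrow> real^'d"
  assumes nd: "nondegenerate v x"
    and R: "\<And>i j k a b. \<lbrakk>i \<noteq> j; i \<noteq> k; j \<noteq> k; v i \<noteq> 0; \<And>c. v j \<noteq> c *\<^sub>R v i; v k = a *\<^sub>R v i + b *\<^sub>R v j\<rbrakk>
        \<Longrightarrow> x $ k \<noteq> a * x $ i + b * x $ j"
  shows "regular v x"
  unfolding regular_def
proof (intro conjI allI impI nd)
  fix i assume vi: "v i \<noteq> 0"
  let ?w = "facet_normals 0 v i" and ?y = "facet_offsets v i x"
  have nz: "?w K \<noteq> 0 \<or> ?y $ K \<noteq> 0" for K by (rule facet_normals_nonzero[OF nd vi])
  have orth: "?w (Some l) \<bullet> v i = 0" if "l \<noteq> i" for l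
    using that vi by (simp add: facet_normals_def inner_diff_left)
  have n: "v i \<bullet> v i \<noteq> 0" using vi by simp
  have "?y $ L \<noteq> c * ?y $ K" if KL: "K \<noteq> L" "?w K \<noteq> 0" "?w L = c *\<^sub>R ?w K" for K L c
  proof -
    have inner: "?w L \<bullet> v i = c * (?w K \<bullet> v i)" using KL(3) by simp
    consider "K \<in> {None, Some i}" "L \<in> {None, Some i}" | l where "K \<in> {None, Some i}" "L = Some l" "l \<noteq> i"
      | k where "K = Some k" "k \<noteq> i" "L \<in> {None, Some i}" | k l where "K = Some k" "k \<noteq> i" "L = Some l" "l \<noteq> i"
      by (cases K; cases L) auto
    then show ?thesis
    proof cases
      case 1
      then have "(c + 1) * (v i \<bullet> v i) = 0" using KL(1) inner by (auto simp: facet_normals_def algebra_simps)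
      \<comment> \<open>The two ends have opposite normals but offsets 0 and 1, so their hyperplanes
        differ.\<close>
      then have "c = -1" using n by simp
      then show ?thesis using 1 KL(1) by (auto simp: facet_offsets_def)
    next
      case 2
      then have "c = 0" using inner n orth[of l] by (auto simp: facet_normals_def)
      then show ?thesis using KL(3) nz[of L] by auto
    next
      case 3
      then show ?thesis using inner n orth[of k] by (auto simp: facet_normals_def)
    next
      case 4
      let ?c = "\<lambda>k. (v k \<bullet> v i) / (v i \<bullet> v i)"
      have wk: "?w K = v k - ?c k *\<^sub>R v i" "?w L = v l - ?c l *\<^sub>R v i"
        using 4 by (auto simp: facet_normals_def)
      have "v k \<noteq> b *\<^sub>R v i" for b using KL(2) wk(1) n by auto
      moreover have "v l = (?c l - c * ?c k) *\<^sub>R v i + c *\<^sub>R v k"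
        using KL(3) unfolding wk by (simp add: algebra_simps)
      ultimately have "x $ l \<noteq> (?c l - c * ?c k) * x $ i + c * x $ k"
        using R[of i k l] 4 KL(1) vi by auto
      then show ?thesis using 4 by (auto simp: facet_offsets_def algebra_simps)
    qed
  qed
  then show "nondegenerate ?w ?y" using nz unfolding nondegenerate_def by blast
qed

section \<open>The Brunn-Minkowski inequality\<close>

text \<open>The class on which the Hadwiger-Ohmann induction runs. Empty boxes are excluded so that
  a family with at least one member has positive volume.\<close>

definition box_family :: "'a::euclidean_space set set \<Rightarrow> bool" where
  "box_family \<A> \<longleftrightarrow> finite \<A> \<and> (\<forall>A\<in>\<A>. A \<noteq> {} \<and> (\<exists>a b. A = box a b)) \<and> pairwise disjnt \<A>"

lemma box_familyD:
  assumes "box_family \<A>"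
  shows "finite \<A>" "A \<in> \<A> \<Longrightarrow> A \<noteq> {}" "A \<in> \<A> \<Longrightarrow> \<exists>a b. A = box a b" "pairwise disjnt \<A>"
  using assms by (simp_all add: box_family_def)

lemma box_Int_open_halfspace:
  fixes k :: "'a::euclidean_space"
  assumes "k \<in> Basis"
  shows "\<exists>b'. box a b \<inter> {x. x \<bullet> k < c} = box a b'" "\<exists>a'. box a b \<inter> {x. c < x \<bullet> k} = box a' b"
proof -
  have *: "(z + s *\<^sub>R k) \<bullet> i = (if i = k then z \<bullet> k + s else z \<bullet> i)" if "i \<in> Basis" for z i :: 'a and s
    using that assms by (simp add: inner_add_left inner_Basis)
  define b' where "b' = b + (min (b \<bullet> k) c - b \<bullet> k) *\<^sub>R k"
  define a' where "a' = a + (max (a \<bullet> k) c - a \<bullet> k) *\<^sub>R k"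
  have b: "b' \<bullet> i = (if i = k then min (b \<bullet> k) c else b \<bullet> i)"
    and a: "a' \<bullet> i = (if i = k then max (a \<bullet> k) c else a \<bullet> i)" if "i \<in> Basis" for i
    unfolding b'_def a'_def using *[OF that] by simp_all
  have "x \<in> box a b \<inter> {x. x \<bullet> k < c} \<longleftrightarrow> x \<in> box a b'" for x
  proof -
    have "(\<forall>i\<in>Basis. x \<bullet> i < b' \<bullet> i) \<longleftrightarrow> (\<forall>i\<in>Basis. x \<bullet> i < b \<bullet> i) \<and> x \<bullet> k < c"
      using assms by (metis (full_types) b min_less_iff_conj)
    then show ?thesis by (auto simp: mem_box)
  qed
  then show "\<exists>b'. box a b \<inter> {x. x \<bullet> k < c} = box a b'" by blast
  have "x \<in> box a b \<inter> {x. c < x \<bullet> k} \<longleftrightarrow> x \<in> box a' b" for x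
  proof -
    have "(\<forall>i\<in>Basis. a' \<bullet> i < x \<bullet> i) \<longleftrightarrow> (\<forall>i\<in>Basis. a \<bullet> i < x \<bullet> i) \<and> c < x \<bullet> k"
      using assms by (metis (full_types) a max_less_iff_conj)
    then show ?thesis by (auto simp: mem_box)
  qed
  then show "\<exists>a'. box a b \<inter> {x. c < x \<bullet> k} = box a' b" by blast
qed

text \<open>The bound counts only boxes that meet \<open>H\<close>: a box on the far side of the cut
  makes the family strictly smaller, which drives the induction.\<close>

lemma box_family_cut:
  fixes k :: "'a::euclidean_space"
  assumes \<A>: "box_family \<A>" and "k \<in> Basis" and H: "H = {x. x \<bullet> k < c} \<or> H = {x. c < x \<bullet> k}"
  obtains \<B> where "box_family \<B>" "\<Union>\<B> = \<Union>\<A> \<inter> H" "card \<B> \<le> card {A\<in>\<A>. A \<inter> H \<noteq> {}}"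
proof
  let ?\<B> = "(\<lambda>A. A \<inter> H) ` {A\<in>\<A>. A \<inter> H \<noteq> {}}"
  have fin: "finite \<A>" using \<A> by (simp add: box_family_def)
  have "\<exists>a b. A \<inter> H = box a b" if A: "A \<in> \<A>" for A
  proof -
    obtain a b where "A = box a b" using box_familyD(3)[OF \<A> A] by blast
    from H show ?thesis
    proof
      assume "H = {x. x \<bullet> k < c}"
      then show ?thesis using box_Int_open_halfspace(1)[OF \<open>k \<in> Basis\<close>, of a b c] \<open>A = box a b\<close> by blast
    next
      assume "H = {x. c < x \<bullet> k}"
      then show ?thesis using box_Int_open_halfspace(2)[OF \<open>k \<in> Basis\<close>, of a b c] \<open>A = box a b\<close> by blast
    qed
  qed
  moreover have "pairwise disjnt ?\<B>"
  proof (rule pairwiseI)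
    fix X Y assume "X \<in> ?\<B>" "Y \<in> ?\<B>" "X \<noteq> Y"
    then obtain A B where "A \<in> \<A>" "B \<in> \<A>" "X = A \<inter> H" "Y = B \<inter> H" by auto
    moreover from this \<open>X \<noteq> Y\<close> have "disjnt A B"
      using pairwiseD[OF box_familyD(4)[OF \<A>]] by metis
    ultimately show "disjnt X Y" by (auto simp: disjnt_def)
  qed
  ultimately show "box_family ?\<B>"
    using fin unfolding box_family_def by auto
  show "\<Union>?\<B> = \<Union>\<A> \<inter> H" by auto
  show "card ?\<B> \<le> card {A\<in>\<A>. A \<inter> H \<noteq> {}}"
    using fin by (intro card_image_le) simp
qed

lemma box_family_Union:
  assumes "box_family \<A>"
  shows "open (\<Union>\<A>)" "bounded (\<Union>\<A>)" "\<Union>\<A> \<in> lmeasurable"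
proof -
  show "open (\<Union>\<A>)" using assms by (auto simp: box_family_def intro!: open_Union)
  show "bounded (\<Union>\<A>)" using assms by (auto simp: box_family_def intro!: bounded_Union)
  then show "\<Union>\<A> \<in> lmeasurable" using \<open>open (\<Union>\<A>)\<close> by (rule lmeasurable_open)
qed

lemma measure_open_pos:
  assumes "open S" "S \<noteq> {}" "S \<in> lmeasurable"
  shows "0 < measure lebesgue S"
  using open_not_negligible[OF assms(1,2)] negligible_iff_measure0[OF assms(3)]
  by (metis measure_nonneg less_eq_real_def)

lemma measure_box_family_pos:
  assumes "box_family \<A>" "\<A> \<noteq> {}"
  shows "0 < measure lebesgue (\<Union>\<A>)"
proof (rule measure_open_pos)
  obtain A where "A \<in> \<A>" using assms(2) by blast
  then show "\<Union>\<A> \<noteq> {}" using box_familyD(2)[OF assms(1)] by blast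
qed (use box_family_Union[OF assms(1)] in auto)

lemma measure_halfspace_split:
  fixes k :: "'a::euclidean_space"
  assumes "S \<in> lmeasurable" "k \<noteq> 0"
  shows "measure lebesgue S = measure lebesgue (S \<inter> {x. x \<bullet> k < c}) + measure lebesgue (S \<inter> {x. c < x \<bullet> k})"
    and "S \<inter> {x. x \<bullet> k < c} \<in> lmeasurable" and "S \<inter> {x. c < x \<bullet> k} \<in> lmeasurable"
proof -
  have H: "{x. x \<bullet> k < c} \<in> sets lebesgue" "{x. c < x \<bullet> k} \<in> sets lebesgue"
    using open_Collect_less[of "\<lambda>x. x \<bullet> k" "\<lambda>_. c"] open_Collect_less[of "\<lambda>_. c" "\<lambda>x. x \<bullet> k"]
    by (simp_all add: borel_open continuous_intros)
  then show m: "S \<inter> {x. x \<bullet> k < c} \<in> lmeasurable" "S \<inter> {x. c < x \<bullet> k} \<in> lmeasurable"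
    using assms by (auto intro: fmeasurable_Int_fmeasurable)
  have N: "negligible {x. k \<bullet> x = c}" using assms by (simp add: negligible_hyperplane)
  have "measure lebesgue S = measure lebesgue ((S \<inter> {x. x \<bullet> k < c}) \<union> (S \<inter> {x. c < x \<bullet> k}))"
  proof (rule measure_negligible_symdiff[OF assms(1), symmetric])
    show "negligible (S - (S \<inter> {x. x \<bullet> k < c} \<union> S \<inter> {x. c < x \<bullet> k}) \<union> (S \<inter> {x. x \<bullet> k < c} \<union> S \<inter> {x. c < x \<bullet> k} - S))"
      by (rule negligible_subset[OF N]) (auto simp: inner_commute)
  qed
  also have "\<dots> = measure lebesgue (S \<inter> {x. x \<bullet> k < c}) + measure lebesgue (S \<inter> {x. c < x \<bullet> k})"
  proof (rule measure_Un_negligible_Int[OF m])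
    have "S \<inter> {x. x \<bullet> k < c} \<inter> (S \<inter> {x. c < x \<bullet> k}) = {}" by auto
    then show "negligible (S \<inter> {x. x \<bullet> k < c} \<inter> (S \<inter> {x. c < x \<bullet> k}))" by simp
  qed
  finally show "measure lebesgue S = measure lebesgue (S \<inter> {x. x \<bullet> k < c}) + measure lebesgue (S \<inter> {x. c < x \<bullet> k})" .
qed

text \<open>The measure below height \<open>c\<close> depends continuously on \<open>c\<close>
  because hyperplanes are null sets, and boundedness of \<open>S\<close> supplies the extreme
  values, so the intermediate value theorem applies.\<close>

lemma halfspace_measure_attained:
  fixes k :: "'a::euclidean_space"
  assumes S: "open S" "bounded S" and k: "k \<noteq> 0" and r: "0 \<le> r" "r \<le> measure lebesgue S"
  obtains c where "measure lebesgue (S \<inter> {x. x \<bullet> k < c}) = r"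
proof -
  have lm: "S \<in> lmeasurable" using S by (simp add: lmeasurable_open)
  obtain B where B: "\<And>x. x \<in> S \<Longrightarrow> norm x \<le> B" using S(2) by (auto simp: bounded_iff)
  define R where "R = (\<bar>B\<bar> + 1) * norm k"
  have R: "\<bar>x \<bullet> k\<bar> < R" if "x \<in> S" for x
  proof -
    have "\<bar>x \<bullet> k\<bar> \<le> norm x * norm k" by (rule Cauchy_Schwarz_ineq2)
    also have "\<dots> < (\<bar>B\<bar> + 1) * norm k" using B[OF that] k by (intro mult_strict_right_mono) auto
    finally show ?thesis by (simp add: R_def)
  qed
  have "0 \<le> R" by (simp add: R_def)
  define f where "f c = measure lebesgue (S \<inter> {x. x \<bullet> k < c})" for c
  have "isCont f c" for c
    unfolding continuous_at_sequentially comp_def f_def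
  proof (intro allI impI)
    fix X assume X: "X \<longlonglongrightarrow> c"
    have "(\<lambda>m. integral\<^sup>L lebesgue (indicator (S \<inter> {x. x \<bullet> k < X m}) :: _ \<Rightarrow> real)) \<longlonglongrightarrow> integral\<^sup>L lebesgue (indicator (S \<inter> {x. x \<bullet> k < c}))"
    proof (rule integral_dominated_convergence[where w="indicator S"])
      show "indicator (S \<inter> {x. x \<bullet> k < c}) \<in> borel_measurable lebesgue" for c
        using measure_halfspace_split(2)[OF lm k] by (intro borel_measurable_indicator) (auto simp: fmeasurableD)
      then show "indicator (S \<inter> {x. x \<bullet> k < X m}) \<in> borel_measurable lebesgue" for m .
      show "integrable lebesgue (indicator S :: _ \<Rightarrow> real)"
        using lm by (simp add: lmeasurable_iff_integrable[symmetric])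
      have "AE p in lebesgue. p \<notin> {x. k \<bullet> x = c}"
        using k by (intro AE_lebesgue_not_in negligible_hyperplane) simp
      then show "AE p in lebesgue. (\<lambda>m. indicator (S \<inter> {x. x \<bullet> k < X m}) p :: real) \<longlonglongrightarrow> indicator (S \<inter> {x. x \<bullet> k < c}) p"
      proof (rule eventually_mono)
        fix p assume "p \<notin> {x. k \<bullet> x = c}"
        then consider "p \<bullet> k < c" | "c < p \<bullet> k" by (fastforce simp: inner_commute)
        then have "\<forall>\<^sub>F m in sequentially. p \<bullet> k < X m \<longleftrightarrow> p \<bullet> k < c"
        proof cases
          case 1
          from order_tendstoD(1)[OF X this] show ?thesis by (rule eventually_mono) (use 1 in simp)
        next
          case 2
          from order_tendstoD(2)[OF X this] show ?thesis by (rule eventually_mono) (use 2 in simp)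
        qed
        then show "(\<lambda>m. indicator (S \<inter> {x. x \<bullet> k < X m}) p :: real) \<longlonglongrightarrow> indicator (S \<inter> {x. x \<bullet> k < c}) p"
          by (intro tendsto_eventually) (auto elim!: eventually_mono simp: indicator_def)
      qed
      show "AE p in lebesgue. norm (indicator (S \<inter> {x. x \<bullet> k < X m}) p :: real) \<le> indicator S p" for m
        by (intro AE_I2) (auto simp: indicator_def)
    qed
    then show "(\<lambda>m. measure lebesgue (S \<inter> {x. x \<bullet> k < X m})) \<longlonglongrightarrow> measure lebesgue (S \<inter> {x. x \<bullet> k < c})"
      by simp
  qed
  then have cont: "continuous_on {-R..R} f" by (simp add: continuous_at_imp_continuous_on)
  have "S \<inter> {x. x \<bullet> k < - R} = {}" "S \<inter> {x. x \<bullet> k < R} = S" using R by fastforce+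
  then have "f (- R) \<le> r" "r \<le> f R" using r by (simp_all add: f_def)
  from IVT'[OF this _ cont] \<open>0 \<le> R\<close> obtain c where "f c = r" by auto
  then show thesis using that by (simp add: f_def)
qed

text \<open>The sides of the box of midpoints are the averages of the given sides, so this is the
  arithmetic-geometric mean inequality in each coordinate.\<close>

lemma midpoint_measure_box:
  fixes a b a' b' :: "'a::euclidean_space"
  assumes ne: "box a b \<noteq> {}" "box a' b' \<noteq> {}" and C: "C \<in> lmeasurable"
    and mid: "\<And>p q. p \<in> box a b \<Longrightarrow> q \<in> box a' b' \<Longrightarrow> (1/2) *\<^sub>R (p + q) \<in> C"
  shows "measure lebesgue (box a b) * measure lebesgue (box a' b') \<le> (measure lebesgue C)\<^sup>2"
proof -
  have lt: "a \<bullet> i < b \<bullet> i" "a' \<bullet> i < b' \<bullet> i" if "i \<in> Basis" for i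
    using ne that by (auto simp: box_ne_empty)
  let ?l = "(1/2) *\<^sub>R (a + a')" and ?u = "(1/2) *\<^sub>R (b + b')"
  have sub: "box ?l ?u \<subseteq> C"
  proof
    fix z assume z: "z \<in> box ?l ?u"
    \<comment> \<open>\<open>t i\<close> is the relative position of \<open>z\<close> within side
      \<open>i\<close>; the points \<open>p\<close> and \<open>q\<close> with the same relative
      positions in their boxes have midpoint \<open>z\<close>.\<close>
    define t where "t i = (z \<bullet> i - ?l \<bullet> i) / (?u \<bullet> i - ?l \<bullet> i)" for i
    have t: "0 < t i" "t i < 1" "?l \<bullet> i + t i * (?u \<bullet> i - ?l \<bullet> i) = z \<bullet> i" if "i \<in> Basis" for i
      using z lt[OF that] that by (auto simp: t_def mem_box inner_add_left field_simps)
    define p where "p = (\<Sum>i\<in>Basis. (a \<bullet> i + t i * (b \<bullet> i - a \<bullet> i)) *\<^sub>R i)"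
    define q where "q = (\<Sum>i\<in>Basis. (a' \<bullet> i + t i * (b' \<bullet> i - a' \<bullet> i)) *\<^sub>R i)"
    have pi: "p \<bullet> i = a \<bullet> i + t i * (b \<bullet> i - a \<bullet> i)" and qi: "q \<bullet> i = a' \<bullet> i + t i * (b' \<bullet> i - a' \<bullet> i)"
      if "i \<in> Basis" for i using that by (simp_all add: p_def q_def)
    have conv: "x < x + s * (y - x) \<and> x + s * (y - x) < y" if "0 < s" "s < 1" "x < y" for x y s :: real
    proof -
      have "0 < s * (y - x)" "0 < (1 - s) * (y - x)" using that by simp_all
      then show ?thesis by (simp add: algebra_simps)
    qed
    have "p \<in> box a b" "q \<in> box a' b'"
      using conv[OF t(1,2) lt(1)] conv[OF t(1,2) lt(2)] by (auto simp: mem_box pi qi)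
    then have "(1/2) *\<^sub>R (p + q) \<in> C" by (rule mid)
    moreover have "(1/2) *\<^sub>R (p + q) = z"
    proof (rule euclidean_eqI)
      fix i :: 'a assume i: "i \<in> Basis"
      then show "(1/2) *\<^sub>R (p + q) \<bullet> i = z \<bullet> i"
        unfolding t(3)[OF i, symmetric] by (simp add: pi qi inner_add_left algebra_simps)
    qed
    ultimately show "z \<in> C" by simp
  qed
  have m: "measure lebesgue (box l u) = (\<Prod>i\<in>Basis. u \<bullet> i - l \<bullet> i)" if "\<And>i. i \<in> Basis \<Longrightarrow> l \<bullet> i < u \<bullet> i" for l u :: 'a
  proof -
    have "measure lebesgue (box l u) = measure lborel (box l u)" by (simp add: measure_completion)
    also have "\<dots> = (\<Prod>i\<in>Basis. (u - l) \<bullet> i)" using that by (intro measure_lborel_box) (simp add: less_imp_le)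
    finally show ?thesis by (simp add: inner_diff_left)
  qed
  have mab: "measure lebesgue (box a b) = (\<Prod>i\<in>Basis. b \<bullet> i - a \<bullet> i)"
    "measure lebesgue (box a' b') = (\<Prod>i\<in>Basis. b' \<bullet> i - a' \<bullet> i)"
    by (rule m, erule lt)+
  have "measure lebesgue (box a b) * measure lebesgue (box a' b')
      = (\<Prod>i\<in>Basis. (b \<bullet> i - a \<bullet> i) * (b' \<bullet> i - a' \<bullet> i))"
    unfolding mab by (simp add: prod.distrib)
  also have "\<dots> \<le> (\<Prod>i\<in>Basis. (?u \<bullet> i - ?l \<bullet> i)\<^sup>2)"
  proof (rule prod_mono)
    fix i :: 'a assume i: "i \<in> Basis"
    have "(?u \<bullet> i - ?l \<bullet> i)\<^sup>2 - (b \<bullet> i - a \<bullet> i) * (b' \<bullet> i - a' \<bullet> i) = (((b \<bullet> i - a \<bullet> i) - (b' \<bullet> i - a' \<bullet> i)) / 2)\<^sup>2"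
      by (simp add: inner_add_left power2_eq_square field_simps)
    then have "(b \<bullet> i - a \<bullet> i) * (b' \<bullet> i - a' \<bullet> i) \<le> (?u \<bullet> i - ?l \<bullet> i)\<^sup>2"
      by (metis zero_le_power2 diff_ge_0_iff_ge)
    then show "0 \<le> (b \<bullet> i - a \<bullet> i) * (b' \<bullet> i - a' \<bullet> i) \<and> (b \<bullet> i - a \<bullet> i) * (b' \<bullet> i - a' \<bullet> i) \<le> (?u \<bullet> i - ?l \<bullet> i)\<^sup>2"
      using lt[OF i] by simp
  qed
  also have "\<dots> = (measure lebesgue (box ?l ?u))\<^sup>2"
    using lt by (subst m) (simp_all add: inner_add_left prod_power_distrib add_strict_mono)
  also have "\<dots> \<le> (measure lebesgue C)\<^sup>2"
    using sub C by (intro power_mono measure_mono_fmeasurable) auto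
  finally show ?thesis .
qed

text \<open>The multiplicative form carries no exponent that depends on the dimension. Quantifying
  over measurable \<open>C\<close> that contain all midpoints avoids the measurability of the
  Minkowski sum.\<close>

definition midpoint_inequality :: "'a::euclidean_space set set \<Rightarrow> 'a set set \<Rightarrow> bool" where
  "midpoint_inequality \<A> \<B> \<longleftrightarrow> (\<forall>C\<in>lmeasurable. (\<forall>p\<in>\<Union>\<A>. \<forall>q\<in>\<Union>\<B>. (1/2) *\<^sub>R (p + q) \<in> C) \<longrightarrow>
     measure lebesgue (\<Union>\<A>) * measure lebesgue (\<Union>\<B>) \<le> (measure lebesgue C)\<^sup>2)"

lemma midpoint_inequality_commute: "midpoint_inequality \<A> \<B> \<Longrightarrow> midpoint_inequality \<B> \<A>"
  unfolding midpoint_inequality_def by (metis add.commute mult.commute)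

lemma disjoint_boxes_separated:
  fixes a b c d :: "'a::euclidean_space"
  assumes "box a b \<noteq> {}" "box c d \<noteq> {}" "box a b \<inter> box c d = {}"
  obtains k s where "k \<in> Basis"
    "box a b \<subseteq> {x. x \<bullet> k < s} \<and> box c d \<subseteq> {x. s < x \<bullet> k} \<or> box c d \<subseteq> {x. x \<bullet> k < s} \<and> box a b \<subseteq> {x. s < x \<bullet> k}"
proof -
  obtain i where i: "i \<in> Basis" "b \<bullet> i \<le> c \<bullet> i \<or> d \<bullet> i \<le> a \<bullet> i"
    using assms unfolding disjoint_interval(4) box_ne_empty by (metis not_le)
  then consider "b \<bullet> i \<le> c \<bullet> i" | "d \<bullet> i \<le> a \<bullet> i" by blast
  then show thesis
  proof cases
    case 1
    then have "box a b \<subseteq> {x. x \<bullet> i < b \<bullet> i}" "box c d \<subseteq> {x. b \<bullet> i < x \<bullet> i}"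
      using i(1) by (force simp: mem_box)+
    then show thesis using i(1) that by blast
  next
    case 2
    then have "box c d \<subseteq> {x. x \<bullet> i < d \<bullet> i}" "box a b \<subseteq> {x. d \<bullet> i < x \<bullet> i}"
      using i(1) by (force simp: mem_box)+
    then show thesis using i(1) that by blast
  qed
qed

text \<open>A coordinate hyperplane separates two boxes of \<open>\<A>\<close>, and a parallel one
  cuts \<open>\<B>\<close> in the same volume ratio. Midpoints of the lower parts and midpoints of
  the upper parts lie on different sides of the hyperplane halfway between, so the two inductive
  bounds add up.\<close>

lemma midpoint_inequality_cut:
  fixes \<A> \<B> :: "'a::euclidean_space set set"
  assumes \<A>: "box_family \<A>" and \<B>: "box_family \<B>" "\<B> \<noteq> {}" and card: "2 \<le> card \<A>"
    and IH: "\<And>(\<A>' :: 'a set set) (\<B>' :: 'a set set). box_family \<A>' \<Longrightarrow> box_family \<B>' \<Longrightarrow> \<A>' \<noteq> {} \<Longrightarrow> \<B>' \<noteq> {} \<Longrightarrow>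
      card \<A>' + card \<B>' < card \<A> + card \<B> \<Longrightarrow> midpoint_inequality \<A>' \<B>'"
  shows "midpoint_inequality \<A> \<B>"
  unfolding midpoint_inequality_def
proof (intro ballI impI)
  fix C :: "'a set" assume C: "C \<in> lmeasurable" and mid: "\<forall>p\<in>\<Union>\<A>. \<forall>q\<in>\<Union>\<B>. (1/2) *\<^sub>R (p + q) \<in> C"
  have fin: "finite \<A>" "finite \<B>" using \<A> \<B> by (auto simp: box_family_def)
  have "\<not> is_singleton \<A>" using card by (auto simp: is_singleton_altdef)
  moreover have "\<A> \<noteq> {}" using card by auto
  ultimately obtain X Y where XY: "X \<in> \<A>" "Y \<in> \<A>" "X \<noteq> Y"
    by (metis is_singletonI' )
  then have ne: "X \<noteq> {}" "Y \<noteq> {}" and disj: "X \<inter> Y = {}" and bx: "\<exists>a b. X = box a b" "\<exists>a b. Y = box a b"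
    using \<A> by (auto simp: box_family_def pairwise_def disjnt_def)
  obtain A1 A2 k s where A12: "A1 \<in> \<A>" "A2 \<in> \<A>" "k \<in> Basis" "A1 \<subseteq> {x. x \<bullet> k < s}" "A2 \<subseteq> {x. s < x \<bullet> k}" "A1 \<noteq> {}" "A2 \<noteq> {}"
    using bx disjoint_boxes_separated[of _ _ _ _ thesis] ne disj XY(1,2) by metis
  have k0: "k \<noteq> 0" using A12(3) by auto
  let ?L = "\<lambda>c. {x. x \<bullet> k < c}" and ?G = "\<lambda>c. {x. c < x \<bullet> k}"
  obtain \<A>1 where \<A>1: "box_family \<A>1" "\<Union>\<A>1 = \<Union>\<A> \<inter> ?L s" "card \<A>1 \<le> card {A\<in>\<A>. A \<inter> ?L s \<noteq> {}}"
    using box_family_cut[OF \<A> A12(3), of "?L s" s] by blast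
  obtain \<A>2 where \<A>2: "box_family \<A>2" "\<Union>\<A>2 = \<Union>\<A> \<inter> ?G s" "card \<A>2 \<le> card {A\<in>\<A>. A \<inter> ?G s \<noteq> {}}"
    using box_family_cut[OF \<A> A12(3), of "?G s" s] by blast
  have "A2 \<inter> ?L s = {}" "A1 \<inter> ?G s = {}" using A12 by fastforce+
  then have "{A\<in>\<A>. A \<inter> ?L s \<noteq> {}} \<subset> \<A>" "{A\<in>\<A>. A \<inter> ?G s \<noteq> {}} \<subset> \<A>" using A12 by blast+
  \<comment> \<open>Each half misses one of the two separated boxes, so \<open>\<A>\<close> loses a
    member on either side, while the number of boxes of \<open>\<B>\<close> does not grow.\<close>
  then have c1: "card \<A>1 < card \<A>" "card \<A>2 < card \<A>"
    using \<A>1(3) \<A>2(3) psubset_card_mono[OF fin(1)] by (meson le_less_trans)+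
  have ne1: "\<A>1 \<noteq> {}" "\<A>2 \<noteq> {}" using \<A>1(2) \<A>2(2) A12 by (auto simp: subset_iff)
  let ?m = "measure lebesgue"
  have pos1: "0 < ?m (\<Union>\<A>1)" "0 < ?m (\<Union>\<A>2)"
    using ne1 \<A>1(1) \<A>2(1) by (auto intro: measure_box_family_pos)
  have sumA: "?m (\<Union>\<A>) = ?m (\<Union>\<A>1) + ?m (\<Union>\<A>2)"
    unfolding \<A>1 \<A>2 by (rule measure_halfspace_split(1)[OF box_family_Union(3)[OF \<A>] k0])
  have posB: "0 < ?m (\<Union>\<B>)"
    using \<B> by (rule measure_box_family_pos)
  define r where "r = ?m (\<Union>\<A>1) / ?m (\<Union>\<A>)"
  have r: "0 < r" "r < 1" "?m (\<Union>\<A>1) = r * ?m (\<Union>\<A>)" "?m (\<Union>\<A>2) = (1 - r) * ?m (\<Union>\<A>)"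
    using pos1 sumA by (auto simp: r_def field_simps)
  obtain s' where s': "?m (\<Union>\<B> \<inter> ?L s') = r * ?m (\<Union>\<B>)"
    using halfspace_measure_attained[OF box_family_Union(1,2)[OF \<B>(1)] k0, of "r * ?m (\<Union>\<B>)"] r posB by auto
  have s'2: "?m (\<Union>\<B> \<inter> ?G s') = (1 - r) * ?m (\<Union>\<B>)"
    using measure_halfspace_split(1)[OF box_family_Union(3)[OF \<B>(1)] k0, of s'] s' by (simp add: algebra_simps)
  obtain \<B>1 where \<B>1: "box_family \<B>1" "\<Union>\<B>1 = \<Union>\<B> \<inter> ?L s'" "card \<B>1 \<le> card {A\<in>\<B>. A \<inter> ?L s' \<noteq> {}}"
    using box_family_cut[OF \<B>(1) A12(3), of "?L s'" s'] by blast
  obtain \<B>2 where \<B>2: "box_family \<B>2" "\<Union>\<B>2 = \<Union>\<B> \<inter> ?G s'" "card \<B>2 \<le> card {A\<in>\<B>. A \<inter> ?G s' \<noteq> {}}"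
    using box_family_cut[OF \<B>(1) A12(3), of "?G s'" s'] by blast
  have c2: "card \<B>1 \<le> card \<B>" "card \<B>2 \<le> card \<B>"
    using \<B>1(3) \<B>2(3) card_mono[OF fin(2), of "{A\<in>\<B>. A \<inter> ?L s' \<noteq> {}}"] card_mono[OF fin(2), of "{A\<in>\<B>. A \<inter> ?G s' \<noteq> {}}"]
    by auto
  have mB: "?m (\<Union>\<B>1) = r * ?m (\<Union>\<B>)" "?m (\<Union>\<B>2) = (1 - r) * ?m (\<Union>\<B>)"
    using s' s'2 \<B>1(2) \<B>2(2) by auto
  then have ne2: "\<B>1 \<noteq> {}" "\<B>2 \<noteq> {}" using r posB by auto
  let ?c = "(s + s') / 2"
  note split = measure_halfspace_split[OF C k0, of ?c]
  have ab: "0 \<le> ?m (\<Union>\<A>) * ?m (\<Union>\<B>)" by simp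
  \<comment> \<open>The geometric mean of the two volumes. Thanks to the equal ratios the halves
    contribute at least \<open>r * g\<close> and \<open>(1 - r) * g\<close>.\<close>
  define g where "g = sqrt (?m (\<Union>\<A>) * ?m (\<Union>\<B>))"
  have g: "0 \<le> g" "g\<^sup>2 = ?m (\<Union>\<A>) * ?m (\<Union>\<B>)" by (simp_all add: g_def)
  have "midpoint_inequality \<A>1 \<B>1"
    by (rule IH[OF \<A>1(1) \<B>1(1) ne1(1) ne2(1)]) (use c1 c2 in linarith)
  moreover have "midpoint_inequality \<A>2 \<B>2"
    by (rule IH[OF \<A>2(1) \<B>2(1) ne1(2) ne2(2)]) (use c1 c2 in linarith)
  moreover have "\<forall>p\<in>\<Union>\<A>1. \<forall>q\<in>\<Union>\<B>1. (1/2) *\<^sub>R (p + q) \<in> C \<inter> ?L ?c"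
    unfolding \<A>1(2) \<B>1(2) using mid by (auto simp: inner_add_left)
  moreover have "\<forall>p\<in>\<Union>\<A>2. \<forall>q\<in>\<Union>\<B>2. (1/2) *\<^sub>R (p + q) \<in> C \<inter> ?G ?c"
    unfolding \<A>2(2) \<B>2(2) using mid by (auto simp: inner_add_left)
  ultimately have "?m (\<Union>\<A>1) * ?m (\<Union>\<B>1) \<le> (?m (C \<inter> ?L ?c))\<^sup>2" "?m (\<Union>\<A>2) * ?m (\<Union>\<B>2) \<le> (?m (C \<inter> ?G ?c))\<^sup>2"
    unfolding midpoint_inequality_def using split(2,3) by blast+
  then have "(r * g)\<^sup>2 \<le> (?m (C \<inter> ?L ?c))\<^sup>2" "((1 - r) * g)\<^sup>2 \<le> (?m (C \<inter> ?G ?c))\<^sup>2"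
    unfolding r(3,4) mB power_mult_distrib g(2) by (simp_all add: power2_eq_square algebra_simps)
  then have "r * g \<le> ?m (C \<inter> ?L ?c)" "(1 - r) * g \<le> ?m (C \<inter> ?G ?c)"
    by (auto intro: power2_le_imp_le)
  then have "g \<le> ?m C" using split(1) by (simp add: algebra_simps)
  then show "?m (\<Union>\<A>) * ?m (\<Union>\<B>) \<le> (?m C)\<^sup>2"
    unfolding g(2)[symmetric] using g(1) by (rule power_mono)
qed

lemma midpoint_inequality_box_families:
  fixes \<A> \<B> :: "'a::euclidean_space set set"
  assumes "box_family \<A>" "box_family \<B>" "\<A> \<noteq> {}" "\<B> \<noteq> {}"
  shows "midpoint_inequality \<A> \<B>"
  using assms
proof (induction "card \<A> + card \<B>" arbitrary: \<A> \<B> rule: less_induct)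
  case less
  have fin: "finite \<A>" "finite \<B>" using less.prems by (auto simp: box_family_def)
  consider "2 \<le> card \<A>" | "2 \<le> card \<B>" | "card \<A> = 1" "card \<B> = 1"
    using less.prems(3,4) fin by (metis One_nat_def Suc_1 card_0_eq less_2_cases not_less)
  then show ?case
  proof cases
    case 1
    show ?thesis
      by (rule midpoint_inequality_cut[OF less.prems(1,2,4) 1]) (rule less.hyps)
  next
    case 2
    have "midpoint_inequality \<B> \<A>"
      by (rule midpoint_inequality_cut[OF less.prems(2,1,3) 2]) (rule less.hyps, simp_all)
    then show ?thesis by (rule midpoint_inequality_commute)
  next
    case 3
    then obtain A B where AB: "\<A> = {A}" "\<B> = {B}" by (auto simp: card_1_singleton_iff)
    have mem: "A \<in> \<A>" "B \<in> \<B>" using AB by simp_all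
    obtain a b where a: "A = box a b" using box_familyD(3)[OF less.prems(1) mem(1)] by blast
    obtain a' b' where b: "B = box a' b'" using box_familyD(3)[OF less.prems(2) mem(2)] by blast
    have "A \<noteq> {}" "B \<noteq> {}"
      using box_familyD(2)[OF less.prems(1) mem(1)] box_familyD(2)[OF less.prems(2) mem(2)] by auto
    then show ?thesis
      unfolding midpoint_inequality_def AB a b using midpoint_measure_box[of a b a' b'] by simp
  qed
qed

text \<open>A bounded open set is covered by countably many nonoverlapping closed boxes inside it.
  Their boundaries are null sets, so the interiors of finitely many of them exhaust the measure up
  to any prescribed error.\<close>

lemma open_set_approximated_by_boxes:
  fixes S :: "'a::euclidean_space set"
  assumes S: "open S" "bounded S" and e: "e < measure lebesgue S"
  obtains \<A> where "box_family \<A>" "\<Union>\<A> \<subseteq> S" "e < measure lebesgue (\<Union>\<A>)"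
proof (cases "S = {}")
  case True
  then show thesis using e by (intro that[of "{}"]) (auto simp: box_family_def)
next
  case False
  obtain a b where ab: "S \<subseteq> cbox a b" "S \<subseteq> box a b"
    using bounded_subset_box_symmetric[OF S(2)] box_subset_cbox by (metis subset_trans)
  \<comment> \<open>Each box of the covering is subordinate to one of its points in
    \<open>S\<close>, so this gauge confines it to \<open>S\<close>; the value outside
    \<open>S\<close> does not matter.\<close>
  define g where "g x = (if x \<in> S then S else UNIV)" for x
  have "gauge g" using S by (auto simp: gauge_def g_def)
  obtain \<D> where \<D>: "countable \<D>" "\<And>K. K \<in> \<D> \<Longrightarrow> interior K \<noteq> {} \<and> (\<exists>c d. K = cbox c d)"
    "pairwise (\<lambda>A B. interior A \<inter> interior B = {}) \<D>" "\<And>K. K \<in> \<D> \<Longrightarrow> \<exists>x \<in> S \<inter> K. K \<subseteq> g x" "S \<subseteq> \<Union>\<D>"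
    using covering_lemma[OF ab(1) _ \<open>gauge g\<close>] ab(2) False by (metis (no_types, lifting) subset_empty)
  have K: "K \<subseteq> S" if "K \<in> \<D>" for K using \<D>(4)[OF that] by (auto simp: g_def)
  have "\<D> \<noteq> {}" using False \<D>(5) by auto
  define D where "D = from_nat_into \<D>"
  have D: "range D = \<D>" using \<open>\<D> \<noteq> {}\<close> \<D>(1) by (simp add: D_def)
  define F where "F n = (\<lambda>i. interior (D i)) ` {..<n::nat}" for n
  have bf: "box_family (F n)" for n
    unfolding box_family_def
  proof (intro conjI ballI)
    show "finite (F n)" by (simp add: F_def)
    show "A \<noteq> {}" "\<exists>a b. A = box a b" if A: "A \<in> F n" for A
    proof -
      obtain i where i: "A = interior (D i)" using A by (auto simp: F_def)
      have "D i \<in> \<D>" using D by auto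
      then obtain c d where "interior (D i) \<noteq> {}" "D i = cbox c d" using \<D>(2) by blast
      then show "A \<noteq> {}" "\<exists>a b. A = box a b" unfolding i by (blast, metis interior_cbox)
    qed
    show "pairwise disjnt (F n)"
    proof (rule pairwiseI)
      fix A B assume AB: "A \<in> F n" "B \<in> F n" "A \<noteq> B"
      then obtain i j where ij: "A = interior (D i)" "B = interior (D j)" by (auto simp: F_def)
      moreover have "D i \<noteq> D j" using AB(3) ij by auto
      moreover have "D i \<in> \<D>" "D j \<in> \<D>" using D by auto
      ultimately show "disjnt A B" using \<D>(3) by (auto simp: pairwise_def disjnt_def)
    qed
  qed
  have sub: "\<Union>(F n) \<subseteq> S" for n
    using K D interior_subset by (fastforce simp: F_def)
  have lm: "S \<in> lmeasurable" using S by (simp add: lmeasurable_open)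
  have U: "(\<Union>n. \<Union>(F n)) = (\<Union>i. interior (D i))" by (auto simp: F_def)
  have "(\<lambda>n. measure lebesgue (\<Union>(F n))) \<longlonglongrightarrow> measure lebesgue (\<Union>n. \<Union>(F n))"
  proof (rule Lim_measure_incseq)
    show "range (\<lambda>n. \<Union>(F n)) \<subseteq> sets lebesgue" using box_family_Union(3)[OF bf] by (auto simp: fmeasurableD)
    show "incseq (\<lambda>n. \<Union>(F n))"
      by (auto simp: incseq_def F_def) (meson lessThan_iff order_less_le_trans)
    have "(\<Union>n. \<Union>(F n)) \<in> lmeasurable"
      using sub by (intro lmeasurable_open bounded_subset[OF S(2)] open_UN) (auto simp: box_family_Union(1)[OF bf])
    then show "emeasure lebesgue (\<Union>n. \<Union>(F n)) \<noteq> \<infinity>" by (metis fmeasurableD2 infinity_ennreal_def)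
  qed
  also have "measure lebesgue (\<Union>n. \<Union>(F n)) = measure lebesgue S"
  proof (rule measure_negligible_symdiff[OF lm])
    have "negligible (\<Union>i. D i - interior (D i))"
    proof (rule negligible_countable_Union)
      have "negligible (D i - interior (D i))" for i
      proof -
        have "D i \<in> \<D>" using D by auto
        then obtain c d where "D i = cbox c d" using \<D>(2) by blast
        then show ?thesis by (simp add: negligible_frontier_interval)
      qed
      then show "\<And>X. X \<in> range (\<lambda>i. D i - interior (D i)) \<Longrightarrow> negligible X" by auto
    qed simp
    moreover have "S - (\<Union>n. \<Union>(F n)) \<union> ((\<Union>n. \<Union>(F n)) - S) \<subseteq> (\<Union>i. D i - interior (D i))"
    proof -
      have "S \<subseteq> (\<Union>i. D i)" using \<D>(5) D by auto
      then have "S - (\<Union>n. \<Union>(F n)) \<subseteq> (\<Union>i. D i - interior (D i))" unfolding U by blast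
      moreover have "(\<Union>n. \<Union>(F n)) - S = {}" using sub by blast
      ultimately show ?thesis by (simp only: Un_empty_right)
    qed
    ultimately show "negligible (S - (\<Union>n. \<Union>(F n)) \<union> ((\<Union>n. \<Union>(F n)) - S))" by (rule negligible_subset)
  qed
  finally have "\<forall>\<^sub>F n in sequentially. e < measure lebesgue (\<Union>(F n))" using e by (rule order_tendstoD(1))
  then obtain n where "e < measure lebesgue (\<Union>(F n))" by (auto simp: eventually_sequentially)
  then show thesis using that[OF bf sub] by blast
qed

text \<open>A strict failure would persist after shrinking first \<open>S\<close> and then
  \<open>T\<close> slightly, to finite unions of boxes.\<close>

lemma brunn_minkowski_midpoint:
  fixes S T C :: "'a::euclidean_space set"
  assumes S: "open S" "bounded S" and T: "open T" "bounded T" and C: "C \<in> lmeasurable"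
    and mid: "\<And>p q. p \<in> S \<Longrightarrow> q \<in> T \<Longrightarrow> (1/2) *\<^sub>R (p + q) \<in> C"
  shows "measure lebesgue S * measure lebesgue T \<le> (measure lebesgue C)\<^sup>2"
proof (rule ccontr)
  let ?m = "measure lebesgue"
  assume neg: "\<not> ?m S * ?m T \<le> (?m C)\<^sup>2"
  then have posS: "0 < ?m S" and posT: "0 < ?m T"
    by (metis measure_nonneg less_eq_real_def mult_zero_left mult_zero_right zero_le_power2)+
  have "(?m C)\<^sup>2 / ?m T < ?m S" using neg posT by (simp add: field_simps)
  then obtain \<A> where \<A>: "box_family \<A>" "\<Union>\<A> \<subseteq> S" "(?m C)\<^sup>2 / ?m T < ?m (\<Union>\<A>)"
    using open_set_approximated_by_boxes[OF S] by blast
  have pos: "0 < ?m (\<Union>\<A>)"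
    using \<A>(3) by (rule le_less_trans[rotated]) (simp add: posT less_imp_le)
  have "(?m C)\<^sup>2 / ?m (\<Union>\<A>) < ?m T" using \<A>(3) posT pos by (simp add: field_simps)
  then obtain \<B> where \<B>: "box_family \<B>" "\<Union>\<B> \<subseteq> T" "(?m C)\<^sup>2 / ?m (\<Union>\<A>) < ?m (\<Union>\<B>)"
    using open_set_approximated_by_boxes[OF T] by blast
  have pos2: "0 < ?m (\<Union>\<B>)"
    using \<B>(3) by (rule le_less_trans[rotated]) (simp add: pos less_imp_le)
  have "midpoint_inequality \<A> \<B>"
    using \<A>(1) \<B>(1) pos pos2 by (intro midpoint_inequality_box_families) auto
  then have "?m (\<Union>\<A>) * ?m (\<Union>\<B>) \<le> (?m C)\<^sup>2"
    unfolding midpoint_inequality_def using C mid \<A>(2) \<B>(2) by blast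
  then show False using \<B>(3) pos by (simp add: field_simps)
qed

text \<open>Midpoints of points of the two polytopes satisfy the averaged constraints; the bound on
  the product of the volumes is then weakened to a bound on the minimum.\<close>

lemma support_volume_quasiconcave:
  fixes v :: "'n::finite \<Rightarrow> real^'d"
  assumes v: "positively_spanning v"
  shows "min (support_volume v x) (support_volume v y) \<le> support_volume v ((1/2) *\<^sub>R (x + y))"
proof -
  have b: "bounded (support_polytope v z)" for z
    by (rule compact_imp_bounded[OF compact_support_polytope[OF v]])
  have int: "measure lebesgue (interior (support_polytope v z)) = support_volume v z" for z
    unfolding support_volume_def
    by (intro measure_interior b negligible_convex_frontier convex_support_polytope)
  have "measure lebesgue (interior (support_polytope v x)) * measure lebesgue (interior (support_polytope v y))
    \<le> (measure lebesgue (support_polytope v ((1/2) *\<^sub>R (x + y))))\<^sup>2"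
  proof (rule brunn_minkowski_midpoint)
    fix p q assume "p \<in> interior (support_polytope v x)" "q \<in> interior (support_polytope v y)"
    then have "p \<in> support_polytope v x" "q \<in> support_polytope v y" using interior_subset by blast+
    then show "(1/2) *\<^sub>R (p + q) \<in> support_polytope v ((1/2) *\<^sub>R (x + y))"
      by (auto simp: support_polytope_def inner_add_right intro: add_mono)
  qed (rule open_interior bounded_interior b lmeasurable_support_polytope v)+
  then have "support_volume v x * support_volume v y \<le> (support_volume v ((1/2) *\<^sub>R (x + y)))\<^sup>2"
    unfolding int by (simp add: support_volume_def)
  moreover have "(min (support_volume v x) (support_volume v y))\<^sup>2 \<le> support_volume v x * support_volume v y"
    unfolding power2_eq_square by (intro mult_mono) (auto simp: support_volume_nonneg)
  ultimately have "(min (support_volume v x) (support_volume v y))\<^sup>2 \<le> (support_volume v ((1/2) *\<^sub>R (x + y)))\<^sup>2"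
    by linarith
  then show ?thesis by (rule power2_le_imp_le) (rule support_volume_nonneg)
qed

section \<open>The Hessian of the volume and hyperplane cuts\<close>

text \<open>A positive \<open>b\<close> would make \<phi> grow strictly on both sides of 0, against
  the midpoint bound. Stationarity at 0 is what lets a bound on a minimum of two values say
  something about second order.\<close>

lemma second_derivative_nonpos:
  fixes \<phi> \<psi> :: "real \<Rightarrow> real"
  assumes \<phi>: "\<forall>\<^sub>F t in nhds 0. (\<phi> has_real_derivative \<psi> t) (at t)" and "\<psi> 0 = 0"
    and \<psi>: "(\<psi> has_real_derivative b) (at 0)" and qc: "\<And>t. min (\<phi> t) (\<phi> (- t)) \<le> \<phi> 0"
  shows "b \<le> 0"
proof (rule ccontr)
  assume "\<not> b \<le> 0"
  then have "b > 0" by simp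
  obtain d1 where d1: "d1 > 0" "\<And>t. \<bar>t\<bar> < d1 \<Longrightarrow> (\<phi> has_real_derivative \<psi> t) (at t)"
    using \<phi> unfolding eventually_nhds_metric dist_real_def by auto
  obtain d2 where d2: "d2 > 0" "\<And>h. 0 < h \<Longrightarrow> h < d2 \<Longrightarrow> 0 < \<psi> h"
    using DERIV_pos_inc_right[OF \<psi> \<open>b > 0\<close>] \<open>\<psi> 0 = 0\<close> by auto
  obtain d3 where d3: "d3 > 0" "\<And>h. 0 < h \<Longrightarrow> h < d3 \<Longrightarrow> \<psi> (- h) < 0"
    using DERIV_pos_inc_left[OF \<psi> \<open>b > 0\<close>] \<open>\<psi> 0 = 0\<close> by auto
  define t where "t = min d1 (min d2 d3) / 2"
  have t: "0 < t" "t < d1" "t < d2" "t < d3" using d1(1) d2(1) d3(1) by (auto simp: t_def)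
  have "\<exists>z. 0 < z \<and> z < t \<and> \<phi> t - \<phi> 0 = (t - 0) * \<psi> z"
    using t d1(2) by (intro MVT2) auto
  then have "\<phi> t > \<phi> 0" using d2(2) t by (smt (verit) mult_pos_pos)
  moreover have "\<exists>z. - t < z \<and> z < 0 \<and> \<phi> 0 - \<phi> (- t) = (0 - (- t)) * \<psi> z"
    using t d1(2) by (intro MVT2) auto
  then obtain z where z: "- t < z" "z < 0" "\<phi> 0 - \<phi> (- t) = t * \<psi> z" by auto
  then have "\<psi> z < 0" using d3(2)[of "- z"] t by simp
  then have "\<phi> (- t) > \<phi> 0" using z(3) t mult_pos_neg[of t "\<psi> z"] by linarith
  ultimately show False using qc[of t] by simp
qed

definition volume_gradient :: "('n::finite \<Rightarrow> real^'d) \<Rightarrow> real^'n \<Rightarrow> real^'n \<Rightarrow> real" where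
  "volume_gradient v x h = (\<Sum>i\<in>UNIV. h $ i * facet_volume v i x)"

definition volume_hessian :: "('n::finite \<Rightarrow> real^'d) \<Rightarrow> real^'n \<Rightarrow> real^'n \<Rightarrow> real^'n \<Rightarrow> real" where
  "volume_hessian v x g h = (\<Sum>i\<in>UNIV. g $ i * facet_volume_deriv v i x h)"

lemma linear_volume_gradient: "linear (volume_gradient v x)"
  by (intro linearI) (auto simp: volume_gradient_def algebra_simps sum.distrib sum_distrib_left)

lemma volume_hessian_linear:
  fixes v :: "'n::finite \<Rightarrow> real^'d"
  assumes "positively_spanning v" "regular v x"
  shows "linear (volume_hessian v x g)" "linear (\<lambda>g. volume_hessian v x g h)"
proof -
  have "linear (facet_volume_deriv v i x)" for i
    using facet_volume_has_derivative[OF assms] by (rule has_derivative_linear)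
  then show "linear (volume_hessian v x g)"
    by (intro linearI) (auto simp: volume_hessian_def linear_add linear_scale algebra_simps sum.distrib sum_distrib_left)
  show "linear (\<lambda>g. volume_hessian v x g h)"
    by (intro linearI) (auto simp: volume_hessian_def algebra_simps sum.distrib sum_distrib_left)
qed

lemma volume_hessian_symmetric:
  fixes v :: "'n::finite \<Rightarrow> real^'d"
  assumes "positively_spanning v" "regular v x"
  shows "volume_hessian v x g h = volume_hessian v x h g"
proof -
  have *: "volume_hessian v x g h = (\<Sum>i\<in>UNIV. \<Sum>j\<in>UNIV. g $ i * (h $ j * facet_volume_deriv v i x (axis j 1)))" for g h
    unfolding volume_hessian_def by (subst facet_volume_deriv_expand[OF assms]) (simp add: sum_distrib_left)
  show ?thesis
    unfolding * by (subst sum.swap) (simp add: facet_volume_deriv_symmetric[OF assms] mult.left_commute)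
qed

lemma volume_hessian_euler:
  fixes v :: "'n::finite \<Rightarrow> real^'d"
  assumes "positively_spanning v" "regular v x"
  shows "volume_hessian v x h x = real (CARD('d) - 1) * volume_gradient v x h"
  by (simp add: volume_hessian_def volume_gradient_def facet_volume_deriv_euler[OF assms] sum_distrib_left mult.left_commute)

lemma support_volume_line_derivatives:
  fixes v :: "'n::finite \<Rightarrow> real^'d"
  assumes v: "positively_spanning v" and reg: "regular v x"
  shows "\<forall>\<^sub>F t in nhds 0. ((\<lambda>t. support_volume v (x + t *\<^sub>R h)) has_real_derivative volume_gradient v (x + t *\<^sub>R h) h) (at t)"
    and "((\<lambda>t. volume_gradient v (x + t *\<^sub>R h) h) has_real_derivative volume_hessian v x h h) (at 0)"
proof -
  have nd: "nondegenerate v x" using reg by (simp add: regular_def)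
  have "((\<lambda>t. x + t *\<^sub>R h) \<longlongrightarrow> x + 0 *\<^sub>R h) (nhds 0)"
    by (intro tendsto_intros filterlim_ident)
  then have "\<forall>\<^sub>F t in nhds 0. nondegenerate v (x + t *\<^sub>R h)"
    using eventually_nondegenerate[OF nd] by (simp add: filterlim_iff)
  then show "\<forall>\<^sub>F t in nhds 0. ((\<lambda>t. support_volume v (x + t *\<^sub>R h)) has_real_derivative volume_gradient v (x + t *\<^sub>R h) h) (at t)"
  proof (rule eventually_mono)
    fix t assume "nondegenerate v (x + t *\<^sub>R h)"
    from has_derivative_along_line[OF support_volume_has_derivative[OF v this]]
    show "((\<lambda>t. support_volume v (x + t *\<^sub>R h)) has_real_derivative volume_gradient v (x + t *\<^sub>R h) h) (at t)"
      by (simp add: volume_gradient_def)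
  qed
  have "((\<lambda>t. facet_volume v i (x + t *\<^sub>R h)) has_real_derivative facet_volume_deriv v i x h) (at 0)" for i
    using facet_volume_has_derivative[OF v reg] by (intro has_derivative_along_line) simp
  then show "((\<lambda>t. volume_gradient v (x + t *\<^sub>R h) h) has_real_derivative volume_hessian v x h h) (at 0)"
    unfolding volume_gradient_def volume_hessian_def by (intro DERIV_sum DERIV_cmult)
qed

lemma support_volume_line_quasiconcave:
  fixes v :: "'n::finite \<Rightarrow> real^'d"
  assumes "positively_spanning v"
  shows "min (support_volume v (x + t *\<^sub>R h)) (support_volume v (x + (- t) *\<^sub>R h)) \<le> support_volume v x"
proof -
  have "(1/2) *\<^sub>R ((x + t *\<^sub>R h) + (x + (- t) *\<^sub>R h)) = x"
    by (simp add: scaleR_2[symmetric])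
  then show ?thesis using support_volume_quasiconcave[OF assms, of "x + t *\<^sub>R h" "x + (- t) *\<^sub>R h"] by simp
qed

lemma volume_hessian_nonpos:
  fixes v :: "'n::finite \<Rightarrow> real^'d"
  assumes v: "positively_spanning v" and reg: "regular v x" and "volume_gradient v x h = 0"
  shows "volume_hessian v x h h \<le> 0"
  by (rule second_derivative_nonpos[OF support_volume_line_derivatives(1)[OF v reg] _ support_volume_line_derivatives(2)[OF v reg]])
    (use assms support_volume_line_quasiconcave[OF v] in auto)

section \<open>Cutting a support polytope by a hyperplane\<close>

definition cut_normals :: "('n \<Rightarrow> real^'d) \<Rightarrow> real^'d \<Rightarrow> 'n option \<Rightarrow> real^'d" where
  "cut_normals v e K = (case K of None \<Rightarrow> e | Some k \<Rightarrow> v k)"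

definition cut_offsets :: "real^'n::finite \<Rightarrow> real \<Rightarrow> real^('n option)" where
  "cut_offsets x s = (\<chi> K. case K of None \<Rightarrow> s | Some k \<Rightarrow> x $ k)"

lemma cut_normals_simps [simp]: "cut_normals v e None = e" "cut_normals v e (Some k) = v k"
  by (simp_all add: cut_normals_def)

lemma cut_offsets_simps [simp]: "cut_offsets x s $ None = s" "cut_offsets x s $ Some k = x $ k"
  by (simp_all add: cut_offsets_def)

lemma cut_offsets_linear:
  "cut_offsets (x + t *\<^sub>R y) (s + t * \<tau>) = cut_offsets x s + t *\<^sub>R cut_offsets y \<tau>"
  by (simp add: vec_eq_iff cut_offsets_def split: option.split)

lemma sum_option: "(\<Sum>K\<in>UNIV. f K) = f None + (\<Sum>k\<in>(UNIV::'n::finite set). f (Some k))"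
  by (simp add: UNIV_option_conv sum.reindex)

lemma positively_spanning_cut: "positively_spanning v \<Longrightarrow> positively_spanning (cut_normals v e)"
  unfolding positively_spanning_def by (metis cut_normals_simps(2))

lemma support_polytope_cut:
  "support_polytope (cut_normals v e) (cut_offsets x s) = support_polytope v x \<inter> {p. e \<bullet> p \<le> s}"
  unfolding support_polytope_def split_option_all by auto

lemma support_volume_cut_complement:
  fixes v :: "'n::finite \<Rightarrow> real^'d"
  assumes v: "positively_spanning v" and "e \<noteq> 0"
  shows "support_volume v x = support_volume (cut_normals v e) (cut_offsets x s)
    + support_volume (cut_normals v (- e)) (cut_offsets x (- s))"
proof -
  have "support_polytope v x = support_polytope (cut_normals v e) (cut_offsets x s) \<union> support_polytope (cut_normals v (- e)) (cut_offsets x (- s))"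
    unfolding support_polytope_cut by auto
  moreover have "negligible (support_polytope (cut_normals v e) (cut_offsets x s) \<inter> support_polytope (cut_normals v (- e)) (cut_offsets x (- s)))"
    by (rule negligible_subset[OF negligible_hyperplane[of e s]]) (use assms in \<open>auto simp: support_polytope_cut\<close>)
  ultimately show ?thesis
    unfolding support_volume_def
    by (metis measure_Un_negligible_Int lmeasurable_support_polytope positively_spanning_cut v)
qed

text \<open>No third hyperplane contains the intersection of two others.\<close>

definition general_position :: "('n::finite \<Rightarrow> real^'d) \<Rightarrow> real^'n \<Rightarrow> bool" where
  "general_position v x \<longleftrightarrow> nondegenerate v x \<and>
     (\<forall>i j k a b. i \<noteq> j \<longrightarrow> i \<noteq> k \<longrightarrow> j \<noteq> k \<longrightarrow> v i \<noteq> 0 \<longrightarrow> (\<forall>c. v j \<noteq> c *\<^sub>R v i) \<longrightarrow>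
        v k = a *\<^sub>R v i + b *\<^sub>R v j \<longrightarrow> x $ k \<noteq> a * x $ i + b * x $ j)"

lemma general_position_regular:
  fixes v :: "'n::finite \<Rightarrow> real^'d"
  assumes "general_position v x"
  shows "regular v x"
  using assms unfolding general_position_def by (intro regularI) blast+

text \<open>The new hyperplane passes through a point where all old constraints are strict, so it
  differs from every old hyperplane.\<close>

lemma nondegenerate_cut:
  assumes nd: "nondegenerate v x" and e: "e \<noteq> 0" and p: "\<And>k. v k \<bullet> p < x $ k" and s: "e \<bullet> p = s"
  shows "nondegenerate (cut_normals v e) (cut_offsets x s)"
  unfolding nondegenerate_def
proof (intro conjI allI impI)
  show "cut_normals v e K \<noteq> 0 \<or> cut_offsets x s $ K \<noteq> 0" for K
    using nd e by (cases K) (auto simp: nondegenerate_def)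
  fix I K :: "'a option" and c
  assume *: "I \<noteq> K" "cut_normals v e I \<noteq> 0" "cut_normals v e K = c *\<^sub>R cut_normals v e I"
  show "cut_offsets x s $ K \<noteq> c * cut_offsets x s $ I"
  proof (cases I)
    case None
    then obtain k where k: "K = Some k" using *(1) by (cases K) auto
    then have "v k \<bullet> p = c * s" using * None s by simp
    then show ?thesis using p[of k] k None by simp
  next
    case I: (Some i)
    show ?thesis
    proof (cases K)
      case None
      then have ec: "e = c *\<^sub>R v i" using * I by simp
      then have "c \<noteq> 0" "s = c * (v i \<bullet> p)" using e s by auto
      then show ?thesis using p[of i] I None by simp
    next
      case (Some k)
      then show ?thesis using * I nd by (auto simp: nondegenerate_def)
    qed
  qed
qed

lemma finite_if_unique: "(\<And>s t. s \<in> S \<Longrightarrow> t \<in> S \<Longrightarrow> s = t) \<Longrightarrow> finite S"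
  by (metis finite.simps is_singletonI' is_singleton_def)

lemma finite_not_general_position_cut:
  fixes v :: "'n::finite \<Rightarrow> real^'d"
  assumes gp: "general_position v x" and e: "e \<noteq> 0"
  shows "finite {s. \<not> general_position (cut_normals v e) (cut_offsets x s)}"
proof -
  have nd: "nondegenerate v x" using gp by (simp add: general_position_def)
  \<comment> \<open>The exceptional heights. In \<open>B1\<close> the cut coincides with an old
    hyperplane; \<open>B2\<close> is the same with the roles of the two normals exchanged; in
    \<open>B3\<close> the cut contains the intersection of two old hyperplanes. In each case the
    linear relation between the normals determines \<open>s\<close>.\<close>
  define B1 where "B1 i = {s. v i \<noteq> 0 \<and> (\<exists>c. e = c *\<^sub>R v i \<and> s = c * x $ i)}" for i
  define B2 where "B2 k = {s. \<exists>c. c \<noteq> 0 \<and> v k = c *\<^sub>R e \<and> x $ k = c * s}" for k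
  define B3 where "B3 i j = {s. v i \<noteq> 0 \<and> (\<forall>c. v j \<noteq> c *\<^sub>R v i) \<and> (\<exists>a b. e = a *\<^sub>R v i + b *\<^sub>R v j \<and> s = a * x $ i + b * x $ j)}" for i j
  have "finite (B1 i)" for i
    by (rule finite_if_unique) (auto simp: B1_def)
  moreover have "finite (B2 k)" for k
    using e by (intro finite_if_unique) (auto simp: B2_def)
  moreover have "finite (B3 i j)" for i j
  proof (rule finite_if_unique)
    fix s t assume "s \<in> B3 i j" "t \<in> B3 i j"
    then obtain a b a' b' where *: "v i \<noteq> 0" "\<And>c. v j \<noteq> c *\<^sub>R v i"
      "e = a *\<^sub>R v i + b *\<^sub>R v j" "s = a * x $ i + b * x $ j"
      "e = a' *\<^sub>R v i + b' *\<^sub>R v j" "t = a' * x $ i + b' * x $ j"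
      unfolding B3_def by blast
    have eq: "(b - b') *\<^sub>R v j = (a' - a) *\<^sub>R v i"
      using *(3,5) by (simp add: algebra_simps)
    have "b = b'"
    proof (rule ccontr)
      assume "b \<noteq> b'"
      then have "v j = ((a' - a) / (b - b')) *\<^sub>R v i"
        using eq by (metis (no_types, lifting) divide_inverse_commute right_minus_eq scaleR_scaleR left_inverse scaleR_one)
      then show False using *(2) by blast
    qed
    then show "s = t" using eq *(1,4,6) by simp
  qed
  ultimately have fin: "finite ((\<Union>i. B1 i) \<union> (\<Union>k. B2 k) \<union> (\<Union>i. \<Union>j. B3 i j))" by auto
  have gpI: "general_position (cut_normals v e) (cut_offsets x s)"
    if B1: "\<And>i. s \<notin> B1 i" and B2: "\<And>k. s \<notin> B2 k" and B3: "\<And>i j. s \<notin> B3 i j" for s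
    unfolding general_position_def
  proof (intro conjI allI impI)
    show "nondegenerate (cut_normals v e) (cut_offsets x s)"
      unfolding nondegenerate_def
    proof (intro conjI allI impI)
      show "cut_normals v e K \<noteq> 0 \<or> cut_offsets x s $ K \<noteq> 0" for K
        using nd e by (cases K) (auto simp: nondegenerate_def)
      fix I K :: "'n option" and c
      assume *: "I \<noteq> K" "cut_normals v e I \<noteq> 0" "cut_normals v e K = c *\<^sub>R cut_normals v e I"
      show "cut_offsets x s $ K \<noteq> c * cut_offsets x s $ I"
      proof (cases I)
        case None
        then obtain k where k: "K = Some k" using *(1) by (cases K) auto
        then have vk: "v k = c *\<^sub>R e" using * None by simp
        show ?thesis
        proof (cases "c = 0")
          case True
          then have "x $ k \<noteq> 0" using nd vk unfolding nondegenerate_def by (metis scaleR_zero_left)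
          then show ?thesis using True k by simp
        next
          case False
          then show ?thesis using B2[of k] vk None k by (auto simp: B2_def)
        qed
      next
        case I: (Some i)
        show ?thesis
          using * I nd B1[of i] by (cases K) (auto simp: nondegenerate_def B1_def)
      qed
    qed
    fix I J K :: "'n option" and a b
    assume d: "I \<noteq> J" "I \<noteq> K" "J \<noteq> K" and nz: "cut_normals v e I \<noteq> 0"
      and ind: "\<forall>c. cut_normals v e J \<noteq> c *\<^sub>R cut_normals v e I"
      and eq: "cut_normals v e K = a *\<^sub>R cut_normals v e I + b *\<^sub>R cut_normals v e J"
    \<comment> \<open>If an old normal is a combination of \<open>e\<close> and another old normal,
      solving the relation for \<open>e\<close> turns a coincidence into membership of
      \<open>s\<close> in \<open>B3\<close>; when \<open>e\<close> has coefficient 0, nondegeneracy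
      of the uncut polytope decides.\<close>
    have solve: "x $ k \<noteq> a * x $ i + b * s"
      if vi: "v i \<noteq> 0" and ne: "i \<noteq> k" and ind: "\<And>c. e \<noteq> c *\<^sub>R v i" and vk: "v k = a *\<^sub>R v i + b *\<^sub>R e" for i k a b
    proof (cases "b = 0")
      case True
      then show ?thesis using nd vi ne vk by (auto simp: nondegenerate_def)
    next
      case False
      have eb: "e = (- a / b) *\<^sub>R v i + (1 / b) *\<^sub>R v k"
        unfolding vk using False by (simp add: scaleR_add_right)
      moreover have "v k \<noteq> c *\<^sub>R v i" for c
      proof
        assume "v k = c *\<^sub>R v i"
        with eb have "e = (- a / b + c / b) *\<^sub>R v i" by (simp add: scaleR_add_left scaleR_diff_left)
        then show False using ind by blast
      qed
      ultimately have "s \<noteq> (- a / b) * x $ i + (1 / b) * x $ k"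
        using B3[of i k] vi unfolding B3_def by blast
      then show ?thesis using False by (auto simp: field_simps)
    qed
    show "cut_offsets x s $ K \<noteq> a * cut_offsets x s $ I + b * cut_offsets x s $ J"
    proof (cases K)
      case None
      then obtain i j where ij: "I = Some i" "J = Some j" using d by (cases I; cases J) auto
      show ?thesis using B3[of i j] nz ind eq None ij by (auto simp: B3_def)
    next
      case K: (Some k)
      show ?thesis
      proof (cases I)
        case None
        then obtain j where j: "J = Some j" using d by (cases J) auto
        have indj: "e \<noteq> c *\<^sub>R v j" for c
        proof
          assume "e = c *\<^sub>R v j"
          moreover from this e have "c \<noteq> 0" by auto
          ultimately have "v j = (1 / c) *\<^sub>R e" by simp
          then show False using ind None j by auto
        qed
        have "v j \<noteq> 0" using ind[rule_format, of 0] None j by auto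
        from solve[OF this, of k b a] show ?thesis
          using indj eq None j K d by (auto simp: add.commute)
      next
        case I: (Some i)
        show ?thesis
        proof (cases J)
          case None
          from solve[of i k a b] show ?thesis using nz ind eq None I K d by auto
        next
          case (Some j)
          then show ?thesis using gp d nz ind eq I K by (auto simp: general_position_def)
        qed
      qed
    qed
  qed
  have "{s. \<not> general_position (cut_normals v e) (cut_offsets x s)} \<subseteq> (\<Union>i. B1 i) \<union> (\<Union>k. B2 k) \<union> (\<Union>i. \<Union>j. B3 i j)"
  proof (intro subsetI, rule ccontr)
    fix s assume s: "s \<in> {s. \<not> general_position (cut_normals v e) (cut_offsets x s)}"
      and "s \<notin> (\<Union>i. B1 i) \<union> (\<Union>k. B2 k) \<union> (\<Union>i. \<Union>j. B3 i j)"
    then have "general_position (cut_normals v e) (cut_offsets x s)" by (intro gpI) simp_all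
    then show False using s by simp
  qed
  then show ?thesis using fin by (rule finite_subset)
qed


text \<open>At \<open>t = a / (\<bar>c\<bar> + 1)\<close> the linear term dominates the quadratic
  one.\<close>

lemma linear_term_zero:
  fixes a c :: real
  assumes "\<And>t. 2 * t * a + t\<^sup>2 * c \<le> 0"
  shows "a = 0"
proof (rule ccontr)
  assume "a \<noteq> 0"
  define u where "u = a / (\<bar>c\<bar> + 1)"
  have a: "a = u * (\<bar>c\<bar> + 1)" by (simp add: u_def)
  have "u\<^sup>2 * (2 * (\<bar>c\<bar> + 1) + c) \<le> 0"
    using assms[of u] unfolding a by (simp add: algebra_simps power2_eq_square)
  moreover have "0 < u\<^sup>2 * (2 * (\<bar>c\<bar> + 1) + c)"
    using \<open>a \<noteq> 0\<close> a by (intro mult_pos_pos) auto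
  ultimately show False by simp
qed

lemma volume_gradient_self:
  fixes v :: "'n::finite \<Rightarrow> real^'d"
  assumes "positively_spanning v" "nondegenerate v x"
  shows "volume_gradient v x x = CARD('d) * support_volume v x"
  using support_volume_euler[OF assms] by (simp add: volume_gradient_def)

text \<open>The Hessian is negative semidefinite on the hyperplane of zero gradient, so a vector of
  value 0 in it is orthogonal to all of that hyperplane. Positive volume makes \<open>x\<close>
  transversal to the hyperplane, and Euler's identity settles the direction of
  \<open>x\<close>.\<close>

lemma volume_hessian_null_vector:
  fixes v :: "'n::finite \<Rightarrow> real^'d"
  assumes v: "positively_spanning v" and reg: "regular v x" and pos: "0 < support_volume v x"
    and g: "volume_gradient v x y = 0" and h: "volume_hessian v x y y = 0"
  shows "volume_hessian v x y z = 0"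
proof -
  have nd: "nondegenerate v x" using reg by (simp add: regular_def)
  note lin = volume_hessian_linear[OF v reg]
  have zero: "volume_hessian v x y z = 0" if "volume_gradient v x z = 0" for z
  proof (rule linear_term_zero)
    fix t
    have "volume_gradient v x (y + t *\<^sub>R z) = 0"
      by (simp add: linear_add[OF linear_volume_gradient] linear_scale[OF linear_volume_gradient] g that)
    then have "volume_hessian v x (y + t *\<^sub>R z) (y + t *\<^sub>R z) \<le> 0"
      by (rule volume_hessian_nonpos[OF v reg])
    also have "volume_hessian v x (y + t *\<^sub>R z) (y + t *\<^sub>R z)
      = volume_hessian v x y y + t * volume_hessian v x y z + t * volume_hessian v x z y + t\<^sup>2 * volume_hessian v x z z"
      by (simp add: linear_add[OF lin(1)] linear_scale[OF lin(1)] linear_add[OF lin(2)] linear_scale[OF lin(2)]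
        algebra_simps power2_eq_square)
    finally show "2 * t * volume_hessian v x y z + t\<^sup>2 * volume_hessian v x z z \<le> 0"
      using h volume_hessian_symmetric[OF v reg, of z y] by simp
  qed
  define \<kappa> where "\<kappa> = volume_gradient v x z / volume_gradient v x x"
  have "volume_gradient v x x \<noteq> 0" using pos by (simp add: volume_gradient_self[OF v nd])
  then have "volume_gradient v x (z - \<kappa> *\<^sub>R x) = 0"
    by (simp add: linear_diff[OF linear_volume_gradient] linear_scale[OF linear_volume_gradient] \<kappa>_def)
  then have "volume_hessian v x y (z - \<kappa> *\<^sub>R x) = 0" by (rule zero)
  moreover have "volume_hessian v x y x = 0" using g by (simp add: volume_hessian_euler[OF v reg])
  ultimately show ?thesis by (simp add: linear_diff[OF lin(1)] linear_scale[OF lin(1)])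
qed

text \<open>Both parts of the cut polytope obey the Brunn-Minkowski inequality to second order, while
  their volumes sum to the volume of the whole polytope; hence both inequalities are equalities.\<close>

lemma cut_null_vector:
  fixes v :: "'n::finite \<Rightarrow> real^'d"
  assumes v: "positively_spanning v" and reg: "regular v x" and e: "e \<noteq> 0"
    and reg': "regular (cut_normals v e) (cut_offsets x s)"
    and pos: "0 < support_volume (cut_normals v e) (cut_offsets x s)"
    and g: "volume_gradient v x y = 0" and h: "volume_hessian v x y y = 0"
    and g': "volume_gradient (cut_normals v e) (cut_offsets x s) (cut_offsets y \<tau>) = 0"
  shows "volume_hessian (cut_normals v e) (cut_offsets x s) (cut_offsets y \<tau>) z = 0"
proof (rule volume_hessian_null_vector[OF positively_spanning_cut[OF v] reg' pos g'], rule antisym)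
  let ?w = "cut_normals v e" and ?X = "cut_offsets x s" and ?Y = "cut_offsets y \<tau>"
  note w = positively_spanning_cut[OF v, of e] and w' = positively_spanning_cut[OF v, of "- e"]
  show "volume_hessian ?w ?X ?Y ?Y \<le> 0" by (rule volume_hessian_nonpos[OF w reg' g'])
  \<comment> \<open>The volume of the other piece. Written as a difference it can be differentiated
    twice using only the regularity at hand for the two minuends; the form as a complementary cut
    serves for the midpoint bound alone.\<close>
  define \<phi> where "\<phi> t = support_volume v (x + t *\<^sub>R y) - support_volume ?w (?X + t *\<^sub>R ?Y)" for t
  have \<phi>: "\<phi> t = support_volume (cut_normals v (- e)) (cut_offsets x (- s) + t *\<^sub>R cut_offsets y (- \<tau>))" for t
    using support_volume_cut_complement[OF v e, of "x + t *\<^sub>R y" "s + t * \<tau>"]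
    unfolding \<phi>_def cut_offsets_linear[symmetric] by (simp add: algebra_simps)
  have "0 - volume_hessian ?w ?X ?Y ?Y \<le> 0"
  proof (rule second_derivative_nonpos)
    let ?\<psi> = "\<lambda>t. volume_gradient v (x + t *\<^sub>R y) y - volume_gradient ?w (?X + t *\<^sub>R ?Y) ?Y"
    show "\<forall>\<^sub>F t in nhds 0. (\<phi> has_real_derivative ?\<psi> t) (at t)"
      using support_volume_line_derivatives(1)[OF v reg, of y] support_volume_line_derivatives(1)[OF w reg', of ?Y]
      unfolding \<phi>_def by eventually_elim (rule DERIV_diff)
    show "(?\<psi> has_real_derivative 0 - volume_hessian ?w ?X ?Y ?Y) (at 0)"
      using DERIV_diff[OF support_volume_line_derivatives(2)[OF v reg, of y] support_volume_line_derivatives(2)[OF w reg', of ?Y]]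
      unfolding h .
    show "min (\<phi> t) (\<phi> (- t)) \<le> \<phi> 0" for t
      unfolding \<phi> using support_volume_line_quasiconcave[OF w'] by simp
  qed (simp add: g g')
  then show "0 \<le> volume_hessian ?w ?X ?Y ?Y" by simp
qed

lemma cut_offsets_along: "cut_offsets x s = cut_offsets x 0 + s *\<^sub>R axis None 1"
  by (simp add: vec_eq_iff cut_offsets_def axis_def split: option.split)

lemma tendsto_cut_offsets:
  assumes "(f \<longlongrightarrow> s) F"
  shows "((\<lambda>r. cut_offsets x (f r)) \<longlongrightarrow> cut_offsets x s) F"
proof (rule vec_tendstoI)
  show "((\<lambda>r. cut_offsets x (f r) $ K) \<longlongrightarrow> cut_offsets x s $ K) F" for K
    using assms by (cases K) auto
qed

lemma cut_has_interior:
  fixes v :: "'n::finite \<Rightarrow> real^'d"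
  assumes p: "\<And>k. v k \<bullet> p < x $ k" and "e \<noteq> 0"
  shows "\<exists>q. (\<forall>k. v k \<bullet> q < x $ k) \<and> e \<bullet> q < e \<bullet> p"
proof -
  obtain r where r: "r > 0" "ball p r \<subseteq> {q. \<forall>k. v k \<bullet> q < x $ k}"
    using open_strict_polytope[of v x] p unfolding open_contains_ball by blast
  define q where "q = p - (r / (2 * norm e)) *\<^sub>R e"
  have "q \<in> ball p r" using r(1) \<open>e \<noteq> 0\<close> by (simp add: q_def dist_norm)
  moreover have "e \<bullet> q < e \<bullet> p" using r(1) \<open>e \<noteq> 0\<close> by (simp add: q_def inner_diff_right)
  ultimately show ?thesis using r(2) by blast
qed

lemma support_volume_cut_pos:
  fixes v :: "'n::finite \<Rightarrow> real^'d"
  assumes v: "positively_spanning v" and nd: "nondegenerate (cut_normals v e) (cut_offsets x (e \<bullet> p))"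
    and p: "\<And>k. v k \<bullet> p < x $ k" and "e \<noteq> 0"
  shows "0 < support_volume (cut_normals v e) (cut_offsets x (e \<bullet> p))"
proof -
  obtain q where q: "\<forall>k. v k \<bullet> q < x $ k" "e \<bullet> q < e \<bullet> p" using cut_has_interior[OF p \<open>e \<noteq> 0\<close>] by blast
  have "\<forall>K. cut_normals v e K \<bullet> q < cut_offsets x (e \<bullet> p) $ K"
    unfolding split_option_all using q by simp
  then show ?thesis
    using nd by (subst support_volume_pos_iff[OF positively_spanning_cut[OF v]]) (auto simp: nondegenerate_def)
qed

text \<open>By \<open>cut_volume_derivative\<close> below, this is the rate at which the volume
  below height \<open>s\<close> changes when the support parameters move along \<open>y\<close> and
  the cutting hyperplane stays fixed.\<close>

definition slice_variation :: "('n::finite \<Rightarrow> real^'d) \<Rightarrow> real^'n \<Rightarrow> real^'n \<Rightarrow> real^'d \<Rightarrow> real \<Rightarrow> real" where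
  "slice_variation v x y e s = (\<Sum>k\<in>UNIV. y $ k * facet_volume (cut_normals v e) (Some k) (cut_offsets x s))"

lemma volume_gradient_cut:
  "volume_gradient (cut_normals v e) (cut_offsets x s) (cut_offsets y \<tau>)
    = \<tau> * facet_volume (cut_normals v e) None (cut_offsets x s) + slice_variation v x y e s"
  by (simp add: volume_gradient_def slice_variation_def sum_option)

text \<open>Let \<open>f\<close> be the variation and \<open>G\<close> the section volume. Moving
  the cut at speed \<open>q s = - f s / G s\<close> makes the gradient of the cut polytope vanish,
  so \<open>y\<close> extended by \<open>q s\<close> is a null vector. Pairing it with the direction
  that moves only the cut shows that the derivative of \<open>f\<close> is \<open>- q s\<close>
  times that of \<open>G\<close>; hence the quotient \<open>q\<close> has derivative 0.\<close>

lemma slice_variation_proportional: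
  fixes v :: "'n::finite \<Rightarrow> real^'d"
  assumes v: "positively_spanning v" and gp: "general_position v x" and e: "e \<noteq> 0"
    and g: "volume_gradient v x y = 0" and h: "volume_hessian v x y y = 0"
  shows "\<exists>\<tau>. \<forall>p. (\<forall>k. v k \<bullet> p < x $ k) \<longrightarrow>
    slice_variation v x y e (e \<bullet> p) = - \<tau> * facet_volume (cut_normals v e) None (cut_offsets x (e \<bullet> p))"
proof -
  let ?w = "cut_normals v e" and ?X = "cut_offsets x"
  note w = positively_spanning_cut[OF v, of e]
  have nd: "nondegenerate v x" and reg: "regular v x"
    using gp general_position_regular by (auto simp: general_position_def)
  define I where "I = (\<lambda>p. e \<bullet> p) ` {p. \<forall>k. v k \<bullet> p < x $ k}"
  have "{p. \<forall>k. v k \<bullet> p < x $ k} = (\<Inter>k. {p. v k \<bullet> p < x $ k})" by auto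
  then have "convex {p. \<forall>k. v k \<bullet> p < x $ k}" by (simp add: convex_INT convex_halfspace_lt)
  then have "convex I"
    unfolding I_def by (intro convex_linear_image) (auto intro!: linearI simp: inner_add_right)
  have ndI: "nondegenerate ?w (?X s)" if s: "s \<in> I" for s
    using s nondegenerate_cut[OF nd e] by (auto simp: I_def)
  have posV: "0 < support_volume ?w (?X s)" if s: "s \<in> I" for s
    using support_volume_cut_pos[OF v] ndI[OF s] s e by (auto simp: I_def)
  define f where "f = slice_variation v x y e"
  define G where "G s = facet_volume ?w None (?X s)" for s
  have G: "0 < G s" if s: "s \<in> I" for s
  proof -
    obtain p where p: "\<forall>k. v k \<bullet> p < x $ k" "e \<bullet> p = s" using s by (auto simp: I_def)
    have "?w None \<bullet> p = ?X s $ None \<and> (\<forall>K. K \<noteq> None \<longrightarrow> ?w K \<bullet> p < ?X s $ K)"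
      unfolding split_option_all using p by simp
    then show ?thesis unfolding G_def facet_volume_pos_iff[OF w ndI[OF s]] by blast
  qed
  have cont: "isCont (\<lambda>s. facet_volume ?w K (?X s)) s" if s: "s \<in> I" for s K
  proof -
    have "(?X \<longlongrightarrow> ?X s) (at s)"
      by (intro tendsto_cut_offsets tendsto_intros)
    from isCont_tendsto_compose[OF isCont_facet_volume[OF w ndI[OF s]] this] show ?thesis by (simp add: isCont_def)
  qed
  have contf: "isCont f s" if s: "s \<in> I" for s
    unfolding f_def slice_variation_def[abs_def] by (intro continuous_intros cont[OF s])
  define q where "q s = - f s / G s" for s
  have contq: "continuous_on S q" if S: "S \<subseteq> I" for S
  proof (rule continuous_at_imp_continuous_on, intro ballI)
    fix s assume "s \<in> S"
    then have s: "s \<in> I" using S by blast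
    show "isCont q s"
      unfolding q_def using G[OF s] cont[OF s, of None] contf[OF s]
      by (intro continuous_intros) (auto simp: G_def)
  qed
  \<comment> \<open>At these finitely many heights no second derivatives are available; the
    continuity of \<open>q\<close> bridges them.\<close>
  define B where "B = {s. \<not> general_position ?w (?X s)}"
  have "finite B" unfolding B_def by (rule finite_not_general_position_cut[OF gp e])
  have der: "(q has_real_derivative 0) (at s)" if s: "s \<in> I" "s \<notin> B" for s
  proof -
    have regw: "regular ?w (?X s)" using s(2) general_position_regular by (auto simp: B_def)
    let ?D = "\<lambda>K. facet_volume_deriv ?w K (?X s) (axis None 1)"
    have d: "((\<lambda>s. facet_volume ?w K (?X s)) has_real_derivative ?D K) (at s)" for K
    proof -
      have "(facet_volume ?w K has_derivative facet_volume_deriv ?w K (?X s)) (at (?X 0 + s *\<^sub>R axis None 1))"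
        unfolding cut_offsets_along[of x s, symmetric] by (rule facet_volume_has_derivative[OF w regw])
      from has_derivative_along_line[OF this] show ?thesis
        unfolding cut_offsets_along[of x, symmetric] .
    qed
    let ?f' = "\<Sum>k\<in>UNIV. y $ k * ?D (Some k)"
    have df: "(f has_real_derivative ?f') (at s)"
      unfolding f_def slice_variation_def[abs_def] by (intro DERIV_sum DERIV_cmult d)
    have dG: "(G has_real_derivative ?D None) (at s)" unfolding G_def by (rule d)
    have eqf: "f s = - q s * G s" using G[OF s(1)] by (simp add: q_def)
    have "volume_gradient ?w (?X s) (cut_offsets y (q s)) = 0"
      unfolding volume_gradient_cut using eqf by (simp add: f_def G_def)
    \<comment> \<open>The test vector \<open>axis None 1\<close> moves the cut and nothing
      else.\<close>
    from cut_null_vector[OF v reg e regw posV[OF s(1)] g h this, of "axis None 1"]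
    have eqf': "?f' = - q s * ?D None"
      by (simp add: volume_hessian_def sum_option)
    have "(q has_real_derivative (- ?f' * G s - - f s * ?D None) / (G s * G s)) (at s)"
      unfolding q_def using G[OF s(1)] by (intro DERIV_divide DERIV_minus df dG) simp
    then show ?thesis unfolding eqf' eqf by simp
  qed
  have const: "q s = q t" if "s \<in> I" "t \<in> I" "s \<le> t" for s t
  proof -
    have sub: "{s..t} \<subseteq> I"
    proof
      fix r assume "r \<in> {s..t}"
      moreover have "is_interval I" using \<open>convex I\<close> by (simp add: is_interval_convex_1)
      ultimately show "r \<in> I" using that unfolding is_interval_1 by (meson atLeastAtMost_iff)
    qed
    have "q t = q s"
    proof (rule has_derivative_zero_unique_strong_interval[of B s t q "q s"])
      show "(q has_derivative (\<lambda>h. 0)) (at r within {s..t})" if "r \<in> {s..t} - B" for r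
      proof -
        have "(q has_real_derivative 0) (at r)" using der that sub by auto
        then have "(q has_derivative (\<lambda>h. 0)) (at r)" by (simp add: has_field_derivative_def lambda_zero)
        then show ?thesis by (rule has_derivative_at_withinI)
      qed
    qed (use \<open>finite B\<close> contq[OF sub] that in auto)
    then show ?thesis by simp
  qed
  show ?thesis
  proof (cases "I = {}")
    case True
    then have "\<not> (\<forall>k. v k \<bullet> p < x $ k)" for p by (auto simp: I_def)
    then show ?thesis by blast
  next
    case False
    then obtain s0 where s0: "s0 \<in> I" by blast
    have "q s = q s0" if "s \<in> I" for s using const[OF that s0] const[OF s0 that] by linarith
    moreover have "f s = - q s * G s" if "s \<in> I" for s
      using G[OF that] by (simp add: q_def)
    ultimately have "f s = - q s0 * G s" if "s \<in> I" for s using that by simp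
    then show ?thesis by (intro exI[of _ "q s0"]) (auto simp: I_def f_def G_def)
  qed
qed

section \<open>First moments and the kernel of the Hessian\<close>

definition first_moment :: "('n::finite \<Rightarrow> real^'d) \<Rightarrow> real^'n \<Rightarrow> real^'d" where
  "first_moment v x = integral\<^sup>L lborel (\<lambda>p. indicator (support_polytope v x) p *\<^sub>R p)"

lemma support_volume_lborel:
  "support_volume v x = measure lborel (support_polytope v x)"
  unfolding support_volume_def
  by (intro measure_completion) (simp add: borel_closed closed_support_polytope)

text \<open>Fubini for the region above the polytope between the graph of
  \<open>e \<bullet> p\<close> and the constant \<open>R\<close>: integrating over heights first
  gives \<open>R - e \<bullet> p\<close>, integrating over points first gives the volumes of the
  cuts. Moments are thereby reduced to volumes, whose derivatives are known.\<close>

lemma first_moment_layer_cake: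
  fixes v :: "'n::finite \<Rightarrow> real^'d"
  assumes v: "positively_spanning v" and R: "\<And>p. p \<in> support_polytope v x \<Longrightarrow> \<bar>e \<bullet> p\<bar> \<le> R"
  shows "((\<lambda>s. support_volume (cut_normals v e) (cut_offsets x s)) has_integral
    R * support_volume v x - e \<bullet> first_moment v x) {- R..R}"
proof -
  let ?P = "support_polytope v x" and ?W = "\<lambda>s. support_volume (cut_normals v e) (cut_offsets x s)"
  define Q where "Q = {z. fst z \<in> ?P \<and> e \<bullet> fst z \<le> snd z \<and> snd z \<le> R}"
  have cP: "compact ?P" by (rule compact_support_polytope[OF v])
  have clQ: "closed Q"
    unfolding Q_def support_polytope_def mem_Collect_eq
    by (intro closed_Collect_conj closed_Collect_all closed_Collect_le continuous_intros)
  have "Q \<subseteq> ?P \<times> {- R..R}" using R by (force simp: Q_def)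
  then have cQ: "compact Q"
    using clQ cP by (metis closed_Int_compact compact_Icc compact_Times inf.absorb1)
  define F where "F p s = (indicator Q (p, s) :: real)" for p s
  have "integrable lborel (indicator Q :: _ \<Rightarrow> real)"
    using borel_integrable_compact[OF cQ, of "\<lambda>_. 1 :: real"] by simp
  then have int: "integrable (lborel \<Otimes>\<^sub>M lborel) (case_prod F)"
    unfolding lborel_prod F_def by (simp add: case_prod_unfold)
  have inner_s: "(\<integral>s. F p s \<partial>lborel) = R * indicator ?P p - e \<bullet> (indicator ?P p *\<^sub>R p)" for p
  proof (cases "p \<in> ?P")
    case True
    then have "F p = indicator {e \<bullet> p..R}" by (auto simp: F_def Q_def indicator_def fun_eq_iff)
    moreover have "e \<bullet> p \<le> R" using R[OF True] by simp
    ultimately show ?thesis using True by simp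
  next
    case False
    then have "F p = (\<lambda>_. 0)" by (auto simp: F_def Q_def indicator_def fun_eq_iff)
    then show ?thesis using False by simp
  qed
  have inner_p: "(\<integral>p. F p s \<partial>lborel) = (if s \<in> {- R..R} then ?W s else 0)" for s
  proof (cases "s \<in> {- R..R}")
    case True
    then have "(\<lambda>p. F p s) = indicator (?P \<inter> {p. e \<bullet> p \<le> s})"
      by (auto simp: F_def Q_def indicator_def fun_eq_iff)
    then show ?thesis using True
      by (simp add: support_volume_lborel support_polytope_cut)
  next
    case False
    then have "(\<lambda>p. F p s) = (\<lambda>_. 0)" using R by (force simp: F_def Q_def indicator_def fun_eq_iff)
    then have "(\<integral>p. F p s \<partial>lborel) = 0" by simp
    then show ?thesis unfolding if_not_P[OF False] .
  qed
  have "integrable lborel (\<lambda>s. \<integral>p. F p s \<partial>lborel)"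
    by (rule lborel_pair.integrable_snd[OF int])
  from has_integral_integral_lborel[OF this]
  have "(?W has_integral (\<integral>s. \<integral>p. F p s \<partial>lborel \<partial>lborel)) {- R..R}"
    unfolding inner_p has_integral_restrict_UNIV .
  also have "(\<integral>s. \<integral>p. F p s \<partial>lborel \<partial>lborel) = (\<integral>p. \<integral>s. F p s \<partial>lborel \<partial>lborel)"
    by (rule lborel_pair.Fubini_integral[OF int])
  also have "\<dots> = (\<integral>p. R * indicator ?P p - e \<bullet> (indicator ?P p *\<^sub>R p) \<partial>lborel)"
    unfolding inner_s ..
  also have "\<dots> = (\<integral>p. R * indicator ?P p \<partial>lborel) - (\<integral>p. e \<bullet> (indicator ?P p *\<^sub>R p) \<partial>lborel)"
    using borel_integrable_compact[OF cP, of "\<lambda>_. 1 :: real"] borel_integrable_compact[OF cP, of "\<lambda>p. p"]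
    by (intro Bochner_Integration.integral_diff integrable_mult_right integrable_inner_right) auto
  also have "\<dots> = R * support_volume v x - e \<bullet> first_moment v x"
    unfolding first_moment_def using borel_integrable_compact[OF cP, of "\<lambda>p. p"]
    by (subst integral_inner_right) (auto simp: support_volume_lborel)
  finally show ?thesis .
qed

lemma slice_range:
  fixes v :: "'n::finite \<Rightarrow> real^'d"
  assumes v: "positively_spanning v" and p0: "\<And>k. v k \<bullet> p0 < x $ k" and e: "e \<noteq> 0"
  shows "\<exists>a b. a < b \<and> (\<forall>s. a < s \<longrightarrow> s < b \<longrightarrow> (\<exists>p. (\<forall>k. v k \<bullet> p < x $ k) \<and> e \<bullet> p = s)) \<and>
    (\<forall>p\<in>support_polytope v x. a \<le> e \<bullet> p \<and> e \<bullet> p \<le> b) \<and>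
    (\<exists>p\<in>support_polytope v x. e \<bullet> p = a) \<and> (\<exists>p\<in>support_polytope v x. e \<bullet> p = b)"
proof -
  let ?P = "support_polytope v x"
  have p0P: "p0 \<in> ?P" using p0 by (simp add: support_polytope_def less_imp_le)
  have cP: "compact ?P" "?P \<noteq> {}" using compact_support_polytope[OF v] p0P by auto
  have cont: "continuous_on ?P (\<lambda>p. e \<bullet> p)" by (intro continuous_intros)
  obtain pa where pa: "pa \<in> ?P" "\<And>p. p \<in> ?P \<Longrightarrow> e \<bullet> pa \<le> e \<bullet> p"
    using continuous_attains_inf[OF cP cont] by blast
  obtain pb where pb: "pb \<in> ?P" "\<And>p. p \<in> ?P \<Longrightarrow> e \<bullet> p \<le> e \<bullet> pb"
    using continuous_attains_sup[OF cP cont] by blast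
  have strict: "e \<bullet> pa < e \<bullet> p \<and> e \<bullet> p < e \<bullet> pb" if p: "\<And>k. v k \<bullet> p < x $ k" for p
  proof
    obtain q where "\<forall>k. v k \<bullet> q < x $ k" "e \<bullet> q < e \<bullet> p" using cut_has_interior[OF p e] by blast
    then show "e \<bullet> pa < e \<bullet> p" using pa(2)[of q] by (force simp: support_polytope_def less_imp_le)
    obtain q where "\<forall>k. v k \<bullet> q < x $ k" "(- e) \<bullet> q < (- e) \<bullet> p" using cut_has_interior[OF p, of "- e"] e by auto
    then show "e \<bullet> p < e \<bullet> pb" using pb(2)[of q] by (force simp: support_polytope_def less_imp_le)
  qed
  have conv: "v k \<bullet> (p0 + t *\<^sub>R (q - p0)) < x $ k" if q: "q \<in> ?P" and t: "0 \<le> t" "t < 1" for q t k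
  proof -
    have "v k \<bullet> (p0 + t *\<^sub>R (q - p0)) = (1 - t) * (v k \<bullet> p0) + t * (v k \<bullet> q)"
      by (simp add: inner_add_right inner_diff_right algebra_simps)
    also have "\<dots> < (1 - t) * x $ k + t * x $ k"
      using t q p0[of k] by (intro add_less_le_mono mult_strict_left_mono mult_left_mono) (auto simp: support_polytope_def)
    finally show ?thesis by (simp add: algebra_simps)
  qed
  have attain: "\<exists>p. (\<forall>k. v k \<bullet> p < x $ k) \<and> e \<bullet> p = s" if s: "e \<bullet> pa < s" "s < e \<bullet> pb" for s
  proof -
    have hit: "\<exists>p. (\<forall>k. v k \<bullet> p < x $ k) \<and> e \<bullet> p = s"
      if q: "q \<in> ?P" and t: "0 \<le> (s - e \<bullet> p0) / (e \<bullet> q - e \<bullet> p0)" "(s - e \<bullet> p0) / (e \<bullet> q - e \<bullet> p0) < 1" "e \<bullet> q \<noteq> e \<bullet> p0" for q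
    proof (intro exI conjI allI)
      let ?t = "(s - e \<bullet> p0) / (e \<bullet> q - e \<bullet> p0)"
      show "v k \<bullet> (p0 + ?t *\<^sub>R (q - p0)) < x $ k" for k by (rule conv[OF q t(1,2)])
      show "e \<bullet> (p0 + ?t *\<^sub>R (q - p0)) = s"
        using t(3) by (simp add: inner_add_right inner_diff_right)
    qed
    have st: "e \<bullet> pa < e \<bullet> p0" "e \<bullet> p0 < e \<bullet> pb" using strict[OF p0] by auto
    show ?thesis
    proof (cases "e \<bullet> p0 \<le> s")
      case True
      then show ?thesis using st s by (intro hit[OF pb(1)]) (auto simp: field_simps)
    next
      case False
      then show ?thesis using st s by (intro hit[OF pa(1)]) (auto simp: field_simps)
    qed
  qed
  show ?thesis
  proof (rule exI[of _ "e \<bullet> pa"], rule exI[of _ "e \<bullet> pb"], intro conjI)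
    show "e \<bullet> pa < e \<bullet> pb" using strict[OF p0] by linarith
    show "\<forall>s. e \<bullet> pa < s \<longrightarrow> s < e \<bullet> pb \<longrightarrow> (\<exists>p. (\<forall>k. v k \<bullet> p < x $ k) \<and> e \<bullet> p = s)"
      using attain by blast
  qed (use pa pb in blast)+
qed

text \<open>A point of the cut polytope at which only an old constraint is tight would belong to the
  polytope and lie strictly below \<open>s\<close>, so no old constraint contributes a
  facet.\<close>

lemma slice_variation_below:
  fixes v :: "'n::finite \<Rightarrow> real^'d"
  assumes v: "positively_spanning v" and nd: "nondegenerate (cut_normals v e) (cut_offsets x s)"
    and below: "\<And>p. p \<in> support_polytope v x \<Longrightarrow> s \<le> e \<bullet> p"
  shows "slice_variation v x y e s = 0"
proof -
  have "\<not> 0 < facet_volume (cut_normals v e) (Some k) (cut_offsets x s)" for k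
    unfolding facet_volume_pos_iff[OF positively_spanning_cut[OF v] nd]
  proof
    assume "\<exists>p. cut_normals v e (Some k) \<bullet> p = cut_offsets x s $ Some k \<and>
       (\<forall>K. K \<noteq> Some k \<longrightarrow> cut_normals v e K \<bullet> p < cut_offsets x s $ K)"
    then obtain p where p: "v k \<bullet> p = x $ k" "\<And>K. K \<noteq> Some k \<Longrightarrow> cut_normals v e K \<bullet> p < cut_offsets x s $ K"
      by auto
    have "v l \<bullet> p \<le> x $ l" for l using p(1) p(2)[of "Some l"] by (cases "l = k") auto
    moreover have "e \<bullet> p < s" using p(2)[of None] by simp
    ultimately show False using below[of p] by (simp add: support_polytope_def)
  qed
  then have "facet_volume (cut_normals v e) (Some k) (cut_offsets x s) = 0" for k
    using facet_volume_nonneg by (metis less_eq_real_def)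
  then show ?thesis by (simp add: slice_variation_def)
qed

lemma support_volume_directional_derivative:
  fixes v :: "'n::finite \<Rightarrow> real^'d"
  assumes v: "positively_spanning v" and nd: "nondegenerate v x"
  shows "((\<lambda>t. support_volume v (x + t *\<^sub>R h)) has_real_derivative volume_gradient v x h) (at 0)"
  unfolding volume_gradient_def
  by (rule has_derivative_along_line) (use support_volume_has_derivative[OF v nd] in simp)

lemma cut_volume_derivative:
  fixes v :: "'n::finite \<Rightarrow> real^'d"
  assumes v: "positively_spanning v" and nd: "nondegenerate (cut_normals v e) (cut_offsets x s)"
  shows "((\<lambda>t. support_volume (cut_normals v e) (cut_offsets (x + t *\<^sub>R y) s)) has_real_derivative slice_variation v x y e s) (at 0)"
proof -
  have "((\<lambda>t. support_volume (cut_normals v e) (cut_offsets x s + t *\<^sub>R cut_offsets y 0)) has_real_derivative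
    volume_gradient (cut_normals v e) (cut_offsets x s) (cut_offsets y 0)) (at 0)"
    by (rule support_volume_directional_derivative[OF positively_spanning_cut[OF v] nd])
  then show ?thesis
    using cut_offsets_linear[of x _ y s 0] by (simp add: volume_gradient_cut)
qed

text \<open>Transfers the vanishing below the polytope to heights above it when the total gradient
  along \<open>y\<close> is 0.\<close>

lemma slice_variation_complement:
  fixes v :: "'n::finite \<Rightarrow> real^'d"
  assumes v: "positively_spanning v" and nd0: "nondegenerate v x" and e: "e \<noteq> 0"
    and nd: "nondegenerate (cut_normals v e) (cut_offsets x s)"
    and nd': "nondegenerate (cut_normals v (- e)) (cut_offsets x (- s))"
  shows "slice_variation v x y e s + slice_variation v x y (- e) (- s) = volume_gradient v x y"
proof (rule DERIV_unique)
  show "((\<lambda>t. support_volume v (x + t *\<^sub>R y)) has_real_derivative slice_variation v x y e s + slice_variation v x y (- e) (- s)) (at 0)"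
    unfolding support_volume_cut_complement[OF v e, of _ s]
    by (intro DERIV_add cut_volume_derivative v nd nd')
  show "((\<lambda>t. support_volume v (x + t *\<^sub>R y)) has_real_derivative volume_gradient v x y) (at 0)"
    by (rule support_volume_directional_derivative[OF v nd0])
qed

text \<open>Both polytopes lie between those with offsets \<open>x - t *\<^sub>R z\<close> and
  \<open>x + t *\<^sub>R z\<close>, and cutting cannot enlarge the gap between these. The bound does
  not involve \<open>s\<close>, so after division by \<open>t\<close> it dominates the difference
  quotients uniformly in the height.\<close>

lemma cut_volume_increment_bound:
  fixes v :: "'n::finite \<Rightarrow> real^'d" and y :: "real^'n"
  assumes v: "positively_spanning v" and t: "0 \<le> t"
  defines "z \<equiv> (\<chi> k. \<bar>y $ k\<bar>)"
  shows "\<bar>support_volume (cut_normals v e) (cut_offsets (x + t *\<^sub>R y) s) - support_volume (cut_normals v e) (cut_offsets x s)\<bar>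
    \<le> support_volume v (x + t *\<^sub>R z) - support_volume v (x - t *\<^sub>R z)"
proof -
  let ?H = "{p. e \<bullet> p \<le> s}" and ?P = "support_polytope v" and ?m = "measure lebesgue"
  have H: "?H \<in> sets lebesgue" by (simp add: borel_closed closed_halfspace_le)
  note lm = lmeasurable_support_polytope[OF v]
  have lmH: "?P x' \<inter> ?H \<in> lmeasurable" for x' using lm H by (rule fmeasurable_Int_fmeasurable)
  have c: "t * y $ k \<le> t * \<bar>y $ k\<bar>" "- (t * \<bar>y $ k\<bar>) \<le> t * y $ k" "0 \<le> t * \<bar>y $ k\<bar>" for k
    using t mult_left_mono[OF _ t, of "y $ k" "\<bar>y $ k\<bar>"] mult_left_mono[OF _ t, of "- \<bar>y $ k\<bar>" "y $ k"] by auto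
  have sub: "?P (x - t *\<^sub>R z) \<subseteq> ?P x'" "?P x' \<subseteq> ?P (x + t *\<^sub>R z)" if "x' = x \<or> x' = x + t *\<^sub>R y" for x'
    using that c unfolding support_polytope_def z_def by (fastforce intro: order_trans)+
  have gap: "?m (?P x2 \<inter> ?H) - ?m (?P x1 \<inter> ?H) \<le> support_volume v (x + t *\<^sub>R z) - support_volume v (x - t *\<^sub>R z)"
    if x12: "x1 = x \<or> x1 = x + t *\<^sub>R y" "x2 = x \<or> x2 = x + t *\<^sub>R y" for x1 x2
  proof -
    have "?m (?P x2 \<inter> ?H) \<le> ?m (?P (x + t *\<^sub>R z) \<inter> ?H)"
      using sub[OF x12(2)] lmH by (intro measure_mono_fmeasurable) (auto simp: fmeasurableD)
    moreover have "?m (?P (x - t *\<^sub>R z) \<inter> ?H) \<le> ?m (?P x1 \<inter> ?H)"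
      using sub[OF x12(1)] lmH by (intro measure_mono_fmeasurable) (auto simp: fmeasurableD)
    moreover have "?m (?P (x + t *\<^sub>R z) \<inter> ?H) - ?m (?P (x - t *\<^sub>R z) \<inter> ?H) \<le> ?m (?P (x + t *\<^sub>R z)) - ?m (?P (x - t *\<^sub>R z))"
    proof -
      have s: "?P (x - t *\<^sub>R z) \<subseteq> ?P (x + t *\<^sub>R z)" using sub[of x] by auto
      have "?m (?P (x + t *\<^sub>R z) \<inter> ?H) - ?m (?P (x - t *\<^sub>R z) \<inter> ?H) = ?m (?P (x + t *\<^sub>R z) \<inter> ?H - ?P (x - t *\<^sub>R z) \<inter> ?H)"
        using s lmH by (intro measurable_measure_Diff[symmetric]) (auto simp: fmeasurableD)
      also have "\<dots> \<le> ?m (?P (x + t *\<^sub>R z) - ?P (x - t *\<^sub>R z))"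
        using lm lmH by (intro measure_mono_fmeasurable fmeasurable.Diff) (auto simp: fmeasurableD)
      also have "\<dots> = ?m (?P (x + t *\<^sub>R z)) - ?m (?P (x - t *\<^sub>R z))"
        using s lm by (intro measurable_measure_Diff) (auto simp: fmeasurableD)
      finally show ?thesis .
    qed
    ultimately show ?thesis by (simp add: support_volume_def)
  qed
  show ?thesis
    using gap[of x "x + t *\<^sub>R y"] gap[of "x + t *\<^sub>R y" x]
    unfolding support_volume_def support_polytope_cut by (auto simp: abs_le_iff)
qed


text \<open>The layer-cake formula is differentiated along \<open>y\<close>. The volume term drops
  out to first order by \<open>g\<close>; under the integral there appears \<open>- \<tau>\<close>
  times the section volume, which integrates over all heights to the volume of the polytope.\<close>

lemma moment_derivative:
  fixes v :: "'n::finite \<Rightarrow> real^'d"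
  assumes v: "positively_spanning v" and gp: "general_position v x" and e: "e \<noteq> 0"
    and p0: "\<And>k. v k \<bullet> p0 < x $ k" and g: "volume_gradient v x y = 0"
    and pr: "\<And>p. (\<And>k. v k \<bullet> p < x $ k) \<Longrightarrow>
      slice_variation v x y e (e \<bullet> p) = - \<tau> * facet_volume (cut_normals v e) None (cut_offsets x (e \<bullet> p))"
  defines "t \<equiv> \<lambda>n::nat. inverse (real (Suc n))"
  shows "(\<lambda>n. (e \<bullet> first_moment v (x + t n *\<^sub>R y) - e \<bullet> first_moment v x) / t n) \<longlonglongrightarrow> \<tau> * support_volume v x"
proof -
  let ?P = "support_polytope v"
  let ?W = "\<lambda>x s. support_volume (cut_normals v e) (cut_offsets x s)"
  have nd: "nondegenerate v x" using gp by (simp add: general_position_def)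
  have t: "0 < t n" "t n \<le> 1" for n by (simp_all add: t_def field_simps)
  have t0: "t \<longlonglongrightarrow> 0" unfolding t_def by (rule LIMSEQ_inverse_real_of_nat)
  then have "filterlim t (at 0) sequentially"
    using t(1) by (simp add: filterlim_at less_imp_neq[symmetric])
  then have seq: "(\<lambda>n. (F (t n) - F 0) / t n) \<longlonglongrightarrow> D" if "(F has_real_derivative D) (at 0)" for F :: "real \<Rightarrow> real" and D
    using that filterlim_compose[of "\<lambda>h. (F (0 + h) - F 0) / h"] unfolding has_field_derivative_iff by fastforce
  obtain C where C: "C > 0" "\<And>y. ?P y \<subseteq> cball 0 (C * norm y)"
    using support_polytope_subset_cball[OF v] by blast
  \<comment> \<open>Bounds \<open>e \<bullet> p\<close> on all polytopes
    \<open>x + r *\<^sub>R y\<close> with \<open>\<bar>r\<bar> \<le> 1\<close>, so that the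
    layer-cake formula holds for all of them on the same interval.\<close>
  define R where "R = norm e * (C * (norm x + norm y))"
  have Rb: "\<bar>e \<bullet> p\<bar> \<le> R" if "p \<in> ?P (x + r *\<^sub>R y)" "\<bar>r\<bar> \<le> 1" for p r
  proof -
    have "\<bar>e \<bullet> p\<bar> \<le> norm e * norm p" by (rule Cauchy_Schwarz_ineq2)
    also have "norm p \<le> C * norm (x + r *\<^sub>R y)" using C(2)[of "x + r *\<^sub>R y"] that(1) by auto
    also have "norm (x + r *\<^sub>R y) \<le> norm x + norm y"
      using norm_triangle_ineq[of x "r *\<^sub>R y"] mult_right_mono[OF that(2), of "norm y"] by simp
    finally show ?thesis using C(1) by (simp add: R_def mult_left_mono)
  qed
  have Rx: "\<bar>e \<bullet> p\<bar> \<le> R" if "p \<in> ?P x" for p using Rb[of p 0] that by simp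
  obtain a b where "a < b \<and> (\<forall>s. a < s \<longrightarrow> s < b \<longrightarrow> (\<exists>p. (\<forall>k. v k \<bullet> p < x $ k) \<and> e \<bullet> p = s)) \<and>
    (\<forall>p\<in>?P x. a \<le> e \<bullet> p \<and> e \<bullet> p \<le> b) \<and> (\<exists>p\<in>?P x. e \<bullet> p = a) \<and> (\<exists>p\<in>?P x. e \<bullet> p = b)"
    using slice_range[OF v p0 e] by (elim exE)
  then have ab: "a < b" "\<And>s. a < s \<Longrightarrow> s < b \<Longrightarrow> \<exists>p. (\<forall>k. v k \<bullet> p < x $ k) \<and> e \<bullet> p = s"
    "\<And>p. p \<in> ?P x \<Longrightarrow> a \<le> e \<bullet> p \<and> e \<bullet> p \<le> b" "\<exists>p\<in>?P x. e \<bullet> p = a" "\<exists>p\<in>?P x. e \<bullet> p = b"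
    by simp_all
  have abR: "{a..b} \<subseteq> {- R..R}" using ab(4,5) Rx by fastforce
  define G where "G s = facet_volume (cut_normals v e) None (cut_offsets x s)" for s
  \<comment> \<open>As the cut rises from \<open>a\<close> to \<open>b\<close>, the volume below it
    grows from 0 to that of the whole polytope at rate \<open>G\<close>.\<close>
  have intG: "(G has_integral support_volume v x) {a..b}"
  proof -
    have nz: "cut_normals v e K \<noteq> 0 \<or> cut_offsets x s $ K \<noteq> 0" for K s
      using nd e by (cases K) (auto simp: nondegenerate_def)
    have "continuous_on {a..b} (?W x)"
    proof (rule continuous_at_imp_continuous_on, intro ballI)
      fix s
      have "(cut_offsets x \<longlongrightarrow> cut_offsets x s) (at s)" by (intro tendsto_cut_offsets tendsto_intros)
      from isCont_tendsto_compose[OF isCont_support_volume[OF positively_spanning_cut[OF v] nz] this]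
      show "isCont (?W x) s" by (simp add: isCont_def)
    qed
    moreover have "(?W x has_vector_derivative G s) (at s)" if s: "s \<in> {a<..<b}" for s
    proof -
      obtain p where p: "\<And>k. v k \<bullet> p < x $ k" "e \<bullet> p = s" using ab(2)[of s] s by auto
      have "((\<lambda>r. support_volume (cut_normals v e) (cut_offsets x s + r *\<^sub>R axis None 1)) has_real_derivative G s) (at 0)"
        unfolding G_def by (intro support_volume_has_partial_derivative positively_spanning_cut v nondegenerate_cut[OF nd e p])
      moreover have "cut_offsets x s + r *\<^sub>R axis None 1 = cut_offsets x (r + s)" for r
        by (simp add: vec_eq_iff cut_offsets_def axis_def split: option.split)
      ultimately have "((\<lambda>r. ?W x (r + s)) has_real_derivative G s) (at 0)" by simp
      then have "(?W x has_real_derivative G s) (at s)" using DERIV_shift[of "?W x" "G s" 0 s] by simp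
      then show ?thesis by (simp add: has_real_derivative_iff_has_vector_derivative)
    qed
    ultimately have "(G has_integral ?W x b - ?W x a) {a..b}"
      using ab(1) by (intro fundamental_theorem_of_calculus_interior) auto
    moreover have "?W x b = support_volume v x"
      using ab(3) by (auto simp: support_volume_def support_polytope_cut intro!: arg_cong[where f="measure lebesgue"])
    moreover have "?W x a = 0"
    proof -
      have "support_polytope (cut_normals v e) (cut_offsets x a) \<subseteq> {p. e \<bullet> p = a}"
        using ab(3) by (fastforce simp: support_polytope_cut)
      then have "negligible (support_polytope (cut_normals v e) (cut_offsets x a))"
        using negligible_hyperplane[of e a] e negligible_subset by blast
      then show ?thesis by (simp add: support_volume_def negligible_imp_measure0)
    qed
    ultimately show ?thesis by simp
  qed
  \<comment> \<open>The two end heights and the heights where the cut or its complement is not in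
    general position.\<close>
  define N where "N = {a, b} \<union> {s. \<not> general_position (cut_normals v e) (cut_offsets x s)}
     \<union> uminus ` {s. \<not> general_position (cut_normals v (- e)) (cut_offsets x s)}"
  have "finite N"
    unfolding N_def using e by (auto intro!: finite_imageI finite_not_general_position_cut[OF gp])
  have ndN: "nondegenerate (cut_normals v e) (cut_offsets x s)" "nondegenerate (cut_normals v (- e)) (cut_offsets x (- s))"
    if "s \<notin> N" for s
  proof -
    show "nondegenerate (cut_normals v e) (cut_offsets x s)" using that by (auto simp: N_def general_position_def)
    have "- s \<notin> {s. \<not> general_position (cut_normals v (- e)) (cut_offsets x s)}"
      (is "_ \<notin> ?S")
    proof
      assume "- s \<in> ?S"
      then have "s \<in> uminus ` ?S" by (intro image_eqI[of _ _ "- s"]) simp_all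
      then show False using that by (simp add: N_def)
    qed
    then show "nondegenerate (cut_normals v (- e)) (cut_offsets x (- s))" by (simp add: general_position_def)
  qed
  have var: "slice_variation v x y e s = (if s \<in> {a..b} then - \<tau> * G s else 0)" if s: "s \<notin> N" for s
  proof -
    consider "s < a" | "b < s" | "a < s" "s < b" using s by (auto simp: N_def) linarith
    then show ?thesis
    proof cases
      case 1
      then have "slice_variation v x y e s = 0"
        using ab(3) by (intro slice_variation_below v ndN s) force
      then show ?thesis using 1 by simp
    next
      case 2
      then have "slice_variation v x y (- e) (- s) = 0"
        using ab(3) by (intro slice_variation_below v ndN s) force
      then have "slice_variation v x y e s = 0"
        using slice_variation_complement[OF v nd e ndN[OF s], of y] g by simp
      then show ?thesis using 2 by simp
    next
      case 3
      then obtain p where "\<And>k. v k \<bullet> p < x $ k" "e \<bullet> p = s" using ab(2)[of s] by auto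
      then show ?thesis using pr[of p] 3 by (simp add: G_def)
    qed
  qed
  define D where "D n s = (?W (x + t n *\<^sub>R y) s - ?W x s) / t n" for n s
  define I where "I n = ((R * support_volume v (x + t n *\<^sub>R y) - e \<bullet> first_moment v (x + t n *\<^sub>R y))
     - (R * support_volume v x - e \<bullet> first_moment v x)) / t n" for n
  have intD: "(D n has_integral I n) {- R..R}" for n
    unfolding D_def I_def
    by (intro has_integral_divide has_integral_diff first_moment_layer_cake v)
      (use Rb[of _ "t n"] t[of n] Rx in auto)
  \<comment> \<open>Setting the quotients to 0 on the finite set \<open>N\<close> gives convergence
    at every height and leaves the integrals unchanged.\<close>
  define D' where "D' n s = (if s \<in> N then 0 else D n s)" for n s
  define L where "L s = (if s \<in> N then 0 else if s \<in> {a..b} then - \<tau> * G s else 0)" for s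
  have intD': "(D' n has_integral I n) {- R..R}" for n
    by (rule has_integral_spike_finite[OF \<open>finite N\<close> _ intD]) (simp add: D'_def)
  have "((\<lambda>s. if s \<in> {a..b} then - \<tau> * G s else 0) has_integral - \<tau> * support_volume v x) {- R..R}"
    using has_integral_mult_right[OF intG, of "- \<tau>"] unfolding has_integral_restrict[OF abR] .
  then have intL: "(L has_integral - \<tau> * support_volume v x) {- R..R}"
    by (rule has_integral_spike_finite[OF \<open>finite N\<close>, rotated]) (simp add: L_def)
  define z :: "real^'n" where "z = (\<chi> k. \<bar>y $ k\<bar>)"
  have "((\<lambda>r. support_volume v (x + r *\<^sub>R z)) has_real_derivative volume_gradient v x z) (at 0)"
    "((\<lambda>r. support_volume v (x + r *\<^sub>R (- z))) has_real_derivative volume_gradient v x (- z)) (at 0)"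
    by (rule support_volume_directional_derivative[OF v nd])+
  from seq[OF DERIV_diff[OF this]]
  have "Bseq (\<lambda>n. (support_volume v (x + t n *\<^sub>R z) - support_volume v (x - t n *\<^sub>R z)) / t n)"
    by (intro convergent_imp_Bseq) (auto simp: convergent_def)
  then obtain K where K: "\<And>n. norm ((support_volume v (x + t n *\<^sub>R z) - support_volume v (x - t n *\<^sub>R z)) / t n) \<le> K"
    by (auto simp: Bseq_def)
  have bound: "norm (D' n s) \<le> K" for n s
  proof -
    have "0 \<le> K" using K[of 0] by (meson norm_ge_zero order_trans)
    moreover have "norm (D n s) \<le> K"
    proof -
      have "norm (D n s) \<le> (support_volume v (x + t n *\<^sub>R z) - support_volume v (x - t n *\<^sub>R z)) / t n"
        using cut_volume_increment_bound[OF v less_imp_le[OF t(1)[of n]], of e x y s] t(1)[of n]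
        unfolding D_def z_def by (simp add: divide_right_mono)
      also have "\<dots> \<le> K" using K[of n] unfolding real_norm_def by linarith
      finally show ?thesis .
    qed
    ultimately show ?thesis by (simp add: D'_def)
  qed
  have lim: "(\<lambda>n. D' n s) \<longlonglongrightarrow> L s" for s
  proof (cases "s \<in> N")
    case False
    from seq[OF cut_volume_derivative[OF v ndN(1)[OF False], of y]] show ?thesis
      using var[OF False] False by (simp add: D'_def D_def L_def)
  qed (simp add: D'_def L_def)
  have "(\<lambda>n. integral {- R..R} (D' n)) \<longlonglongrightarrow> integral {- R..R} L"
    by (rule dominated_convergence(2)[where h="\<lambda>_. K"]) (use intD' bound lim in \<open>auto simp: has_integral_integrable\<close>)
  then have I: "I \<longlonglongrightarrow> - \<tau> * support_volume v x"
    using integral_unique[OF intD'] integral_unique[OF intL] by simp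
  have "((\<lambda>r. support_volume v (x + r *\<^sub>R y)) has_real_derivative volume_gradient v x y) (at 0)"
    by (rule support_volume_directional_derivative[OF v nd])
  from seq[OF this] have "(\<lambda>n. R * ((support_volume v (x + t n *\<^sub>R y) - support_volume v x) / t n)) \<longlonglongrightarrow> R * 0"
    unfolding g by (intro tendsto_mult_left) simp
  from tendsto_diff[OF this I]
  have "(\<lambda>n. R * ((support_volume v (x + t n *\<^sub>R y) - support_volume v x) / t n) - I n) \<longlonglongrightarrow> \<tau> * support_volume v x"
    by simp
  moreover have "R * ((support_volume v (x + t n *\<^sub>R y) - support_volume v x) / t n) - I n
      = (e \<bullet> first_moment v (x + t n *\<^sub>R y) - e \<bullet> first_moment v x) / t n" for n
    using t(1)[of n] by (simp add: I_def field_simps)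
  ultimately show ?thesis by simp
qed

text \<open>A cut just below facet \<open>i\<close> takes over the role of that facet, so the cut
  polytope is the one with offsets \<open>x + r *\<^sub>R axis i 1\<close> for some
  \<open>r < 0\<close>. The gradient along \<open>?h\<close> vanishes there and, by continuity, also
  at \<open>x\<close>; comparison with \<open>g\<close> leaves
  \<open>(\<tau> - y $ i) * facet_volume v i x = 0\<close>.\<close>

lemma tilt_at_facet:
  fixes v :: "'n::finite \<Rightarrow> real^'d"
  assumes v: "positively_spanning v" and nd: "nondegenerate v x" and p0: "\<And>k. v k \<bullet> p0 < x $ k"
    and pos: "0 < facet_volume v i x" and g: "volume_gradient v x y = 0"
    and pr: "\<And>p. (\<And>k. v k \<bullet> p < x $ k) \<Longrightarrow>
      slice_variation v x y (v i) (v i \<bullet> p) = - \<tau> * facet_volume (cut_normals v (v i)) None (cut_offsets x (v i \<bullet> p))"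
  shows "y $ i = \<tau>"
proof -
  \<comment> \<open>\<open>?h\<close> is \<open>y\<close> with entry \<open>i\<close> replaced by
    \<tau>, the speed of the cut.\<close>
  let ?h = "y + (\<tau> - y $ i) *\<^sub>R axis i 1" and ?x = "\<lambda>r. x + r *\<^sub>R axis i 1"
  have e: "v i \<noteq> 0" using pos by (auto simp: facet_volume_def)
  obtain a b where "a < b \<and> (\<forall>s. a < s \<longrightarrow> s < b \<longrightarrow> (\<exists>p. (\<forall>k. v k \<bullet> p < x $ k) \<and> v i \<bullet> p = s)) \<and>
    (\<forall>p\<in>support_polytope v x. a \<le> v i \<bullet> p \<and> v i \<bullet> p \<le> b) \<and>
    (\<exists>p\<in>support_polytope v x. v i \<bullet> p = a) \<and> (\<exists>p\<in>support_polytope v x. v i \<bullet> p = b)"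
    using slice_range[OF v p0 e] by (elim exE)
  then have ab: "a < b" "\<And>s. a < s \<Longrightarrow> s < b \<Longrightarrow> \<exists>p. (\<forall>k. v k \<bullet> p < x $ k) \<and> v i \<bullet> p = s"
    "\<And>p. p \<in> support_polytope v x \<Longrightarrow> a \<le> v i \<bullet> p \<and> v i \<bullet> p \<le> b" "\<exists>p\<in>support_polytope v x. v i \<bullet> p = b"
    by simp_all
  have "b = x $ i"
  proof (rule antisym)
    show "b \<le> x $ i" using ab(4) by (auto simp: support_polytope_def)
    obtain q where q: "v i \<bullet> q = x $ i" "\<And>k. k \<noteq> i \<Longrightarrow> v k \<bullet> q < x $ k"
      using pos unfolding facet_volume_pos_iff[OF v nd] by blast
    have "v k \<bullet> q \<le> x $ k" for k using q by (cases "k = i") (auto simp: less_imp_le)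
    then show "x $ i \<le> b" using ab(3)[of q] q(1) by (simp add: support_polytope_def)
  qed
  have x0: "(?x \<longlongrightarrow> x) (at_left 0)" by (auto intro!: tendsto_eq_intros)
  have "\<forall>\<^sub>F r in at_left 0. nondegenerate v (?x r)"
    using x0 eventually_nondegenerate[OF nd] by (simp add: filterlim_iff)
  moreover have "\<forall>\<^sub>F r in at_left 0. r \<in> {a - b<..<0}"
    using ab(1) by (intro eventually_at_leftI[of "a - b"]) auto
  ultimately have "\<forall>\<^sub>F r in at_left 0. volume_gradient v (?x r) ?h = 0"
  proof eventually_elim
    case (elim r)
    let ?s = "x $ i + r"
    obtain p where p: "\<And>k. v k \<bullet> p < x $ k" "v i \<bullet> p = ?s"
      using ab(2)[of ?s] elim(2) \<open>b = x $ i\<close> by auto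
    have ndc: "nondegenerate (cut_normals v (v i)) (cut_offsets x ?s)" by (rule nondegenerate_cut[OF nd e p])
    have "volume_gradient (cut_normals v (v i)) (cut_offsets x ?s) (cut_offsets y \<tau>) = 0"
      unfolding volume_gradient_cut using pr[OF p(1)] p(2) by simp
    then have d1: "((\<lambda>t. support_volume (cut_normals v (v i)) (cut_offsets x ?s + t *\<^sub>R cut_offsets y \<tau>)) has_real_derivative 0) (at 0)"
      using support_volume_directional_derivative[OF positively_spanning_cut[OF v] ndc, of "cut_offsets y \<tau>"] by simp
    have d2: "((\<lambda>t. support_volume v (?x r + t *\<^sub>R ?h)) has_real_derivative volume_gradient v (?x r) ?h) (at 0)"
      by (rule support_volume_directional_derivative[OF v elim(1)])
    \<comment> \<open>Negativity of this quantity means that the moving cut is stricter than the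
      moving constraint \<open>i\<close>, which it then implies.\<close>
    have "((\<lambda>t. r + t * (\<tau> - y $ i)) \<longlongrightarrow> r + 0 * (\<tau> - y $ i)) (nhds 0)"
      by (intro tendsto_intros filterlim_ident)
    then have "\<forall>\<^sub>F t in nhds 0. r + t * (\<tau> - y $ i) < 0"
      by (rule order_tendstoD(2)) (use elim(2) in simp)
    then have ev: "\<forall>\<^sub>F t in nhds 0. support_volume (cut_normals v (v i)) (cut_offsets x ?s + t *\<^sub>R cut_offsets y \<tau>)
      = support_volume v (?x r + t *\<^sub>R ?h)"
    proof (rule eventually_mono)
      fix t assume lt: "r + t * (\<tau> - y $ i) < 0"
      have "support_polytope (cut_normals v (v i)) (cut_offsets (x + t *\<^sub>R y) (?s + t * \<tau>)) = support_polytope v (?x r + t *\<^sub>R ?h)"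
      proof -
        have comp: "(?x r + t *\<^sub>R ?h) $ k = (x + t *\<^sub>R y) $ k + (if k = i then r + t * (\<tau> - y $ i) else 0)" for k
          by (simp add: axis_def algebra_simps)
        have "(\<forall>k. v k \<bullet> p \<le> (x + t *\<^sub>R y) $ k) \<and> v i \<bullet> p \<le> ?s + t * \<tau> \<longleftrightarrow> (\<forall>k. v k \<bullet> p \<le> (?x r + t *\<^sub>R ?h) $ k)" for p
        proof
          assume L: "(\<forall>k. v k \<bullet> p \<le> (x + t *\<^sub>R y) $ k) \<and> v i \<bullet> p \<le> ?s + t * \<tau>"
          show "\<forall>k. v k \<bullet> p \<le> (?x r + t *\<^sub>R ?h) $ k"
          proof
            fix k
            show "v k \<bullet> p \<le> (?x r + t *\<^sub>R ?h) $ k"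
              unfolding comp using L by (cases "k = i") (auto simp: algebra_simps)
          qed
        next
          assume Q: "\<forall>k. v k \<bullet> p \<le> (?x r + t *\<^sub>R ?h) $ k"
          have "v k \<bullet> p \<le> (x + t *\<^sub>R y) $ k" for k
            using Q[rule_format, of k] lt unfolding comp by (cases "k = i") auto
          moreover have "v i \<bullet> p \<le> ?s + t * \<tau>"
            using Q[rule_format, of i] unfolding comp by (simp add: algebra_simps)
          ultimately show "(\<forall>k. v k \<bullet> p \<le> (x + t *\<^sub>R y) $ k) \<and> v i \<bullet> p \<le> ?s + t * \<tau>" by blast
        qed
        then show ?thesis unfolding support_polytope_cut unfolding support_polytope_def by blast
      qed
      then show "support_volume (cut_normals v (v i)) (cut_offsets x ?s + t *\<^sub>R cut_offsets y \<tau>)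
        = support_volume v (?x r + t *\<^sub>R ?h)"
        by (simp add: support_volume_def cut_offsets_linear[symmetric])
    qed
    show "volume_gradient v (?x r) ?h = 0"
      using d2 d1 unfolding DERIV_cong_ev[OF refl ev refl] by (rule DERIV_unique)
  qed
  then have "((\<lambda>r. volume_gradient v (?x r) ?h) \<longlongrightarrow> 0) (at_left 0)" by (rule tendsto_eventually)
  moreover have "((\<lambda>r. volume_gradient v (?x r) ?h) \<longlongrightarrow> volume_gradient v x ?h) (at_left 0)"
    unfolding volume_gradient_def
    by (intro tendsto_sum tendsto_mult_left isCont_tendsto_compose[OF isCont_facet_volume[OF v nd] x0])
  ultimately have "volume_gradient v x ?h = 0"
    using tendsto_unique trivial_limit_at_left_real by blast
  then have "(\<tau> - y $ i) * volume_gradient v x (axis i 1) = 0"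
    using g by (simp add: linear_add[OF linear_volume_gradient] linear_scale[OF linear_volume_gradient])
  moreover have "volume_gradient v x (axis i 1) = facet_volume v i x"
    by (simp add: volume_gradient_def axis_def if_distrib[of "\<lambda>c. c * _"] cong: if_cong)
  ultimately show ?thesis using pos by simp
qed

theorem volume_hessian_kernel:
  fixes v :: "'n::finite \<Rightarrow> real^'d"
  assumes v: "positively_spanning v" and gp: "general_position v x" and d: "2 \<le> CARD('d)"
    and p0: "\<And>k. v k \<bullet> p0 < x $ k" and pos: "\<And>i. 0 < facet_volume v i x"
    and ker: "\<And>i. facet_volume_deriv v i x y = 0"
  shows "\<exists>a. y = translation_offsets v a"
proof -
  have nd: "nondegenerate v x" and reg: "regular v x"
    using gp general_position_regular by (auto simp: general_position_def)
  have h: "volume_hessian v x z y = 0" for z by (simp add: volume_hessian_def ker)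
  have "real (CARD('d) - 1) * volume_gradient v x y = 0"
    using volume_hessian_euler[OF v reg, of y] h[of x] volume_hessian_symmetric[OF v reg, of x y] by simp
  \<comment> \<open>Dimension at least 2 makes the factor from Euler's identity nonzero.\<close>
  then have g: "volume_gradient v x y = 0" using d by simp
  have "\<exists>\<tau>. \<forall>p. (\<forall>k. v k \<bullet> p < x $ k) \<longrightarrow>
    slice_variation v x y e (e \<bullet> p) = - \<tau> * facet_volume (cut_normals v e) None (cut_offsets x (e \<bullet> p))" if "e \<noteq> 0" for e
    by (rule slice_variation_proportional[OF v gp that g h])
  then obtain \<tau> where \<tau>: "\<And>e p. e \<noteq> 0 \<Longrightarrow> (\<And>k. v k \<bullet> p < x $ k) \<Longrightarrow>
    slice_variation v x y e (e \<bullet> p) = - \<tau> e * facet_volume (cut_normals v e) None (cut_offsets x (e \<bullet> p))"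
    by metis
  \<comment> \<open>\<tau> was chosen separately for each \<open>e\<close>, so its linearity is not
    evident. The difference quotients \<open>L\<close> of the first moment supply it: their limits
    in the coordinate directions form a vector \<open>l\<close>, so the limit in any direction
    \<open>e\<close> is \<open>e \<bullet> l\<close>.\<close>
  define L where "L n = (first_moment v (x + inverse (real (Suc n)) *\<^sub>R y) - first_moment v x) /\<^sub>R inverse (real (Suc n))" for n
  have lim: "(\<lambda>n. e \<bullet> L n) \<longlonglongrightarrow> \<tau> e * support_volume v x" if "e \<noteq> 0" for e
  proof -
    have "e \<bullet> L n = (e \<bullet> first_moment v (x + inverse (real (Suc n)) *\<^sub>R y) - e \<bullet> first_moment v x) / inverse (real (Suc n))" for n
      by (simp add: L_def inner_diff_right divide_inverse mult.commute del: of_nat_Suc)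
    then show ?thesis using moment_derivative[OF v gp that p0 g \<tau>[OF that]] by simp
  qed
  define l :: "real^'d" where "l = (\<chi> j. \<tau> (axis j 1) * support_volume v x)"
  have "L \<longlonglongrightarrow> l"
  proof (rule vec_tendstoI)
    fix j
    have "(\<lambda>n. axis j 1 \<bullet> L n) \<longlonglongrightarrow> \<tau> (axis j 1) * support_volume v x" by (rule lim) (simp add: axis_eq_0_iff)
    then show "(\<lambda>n. L n $ j) \<longlonglongrightarrow> l $ j" by (simp add: l_def inner_axis')
  qed
  have V: "0 < support_volume v x"
    using p0 nd by (subst support_volume_pos_iff[OF v]) (auto simp: nondegenerate_def)
  have "y $ i = v i \<bullet> (l /\<^sub>R support_volume v x)" for i
  proof -
    have vi: "v i \<noteq> 0" using pos[of i] by (auto simp: facet_volume_def)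
    have "(\<lambda>n. v i \<bullet> L n) \<longlonglongrightarrow> v i \<bullet> l" using \<open>L \<longlonglongrightarrow> l\<close> by (intro tendsto_intros)
    then have "\<tau> (v i) * support_volume v x = v i \<bullet> l" using lim[OF vi] LIMSEQ_unique by blast
    moreover have "y $ i = \<tau> (v i)" by (rule tilt_at_facet[OF v nd p0 pos g \<tau>[OF vi]])
    ultimately show ?thesis using V by (simp add: field_simps)
  qed
  then show ?thesis by (intro exI[of _ "l /\<^sub>R support_volume v x"]) (simp add: translation_offsets_def vec_eq_iff)
qed

section \<open>Symmetric matrices with one negative eigenvalue\<close>

definition shifted_matrix :: "real^'n^'n \<Rightarrow> real \<Rightarrow> real^'n^'n" where
  "shifted_matrix M t = (\<chi> i j. (if i = j then t else 0) - M $ i $ j)"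

lemma shifted_matrix_mult:
  fixes M :: "real^'n^'n"
  shows "shifted_matrix M t *v q = t *\<^sub>R q - M *v q"
proof (subst vec_eq_iff, rule allI)
  fix i
  have "(shifted_matrix M t *v q) $ i = (\<Sum>j\<in>UNIV. (if i = j then t * q $ j else 0) - M $ i $ j * q $ j)"
    unfolding shifted_matrix_def matrix_vector_mult_def
    by (auto intro!: sum.cong simp: left_diff_distrib)
  also have "\<dots> = t * q $ i - (M *v q) $ i"
    by (simp add: sum_subtractf matrix_vector_mult_def)
  finally show "(shifted_matrix M t *v q) $ i = (t *\<^sub>R q - M *v q) $ i" by simp
qed

lemma poly_characteristic_poly:
  fixes M :: "real^'n^'n"
  shows "poly (characteristic_poly M) t = det (shifted_matrix M t)"
  unfolding characteristic_poly_def det_def shifted_matrix_def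
  by (simp add: poly_sum poly_prod of_int_poly if_distrib[of "\<lambda>p. poly p t"] cong: if_cong)

definition rank_one_shift :: "real^'n^'n \<Rightarrow> real^'n \<Rightarrow> real^'n^'n" where
  "rank_one_shift M u = (\<chi> i j. M $ i $ j + u $ i * u $ j)"

lemma rank_one_shift_mult:
  fixes M :: "real^'n^'n"
  shows "rank_one_shift M u *v q = M *v q + (u \<bullet> q) *\<^sub>R u"
  by (simp add: vec_eq_iff matrix_vector_mult_def rank_one_shift_def inner_vec_def algebra_simps sum.distrib sum_distrib_left)

text \<open>The matrix determinant lemma: the shift moves one eigenvalue from \<open>c\<close> to \<open>c + 1\<close> and leaves the
  others in place.\<close>

lemma characteristic_poly_rank_one_shift:
  fixes M :: "real^'n^'n"
  assumes u: "norm u = 1" and eig: "M *v u = c *\<^sub>R u"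
  shows "[:- (c + 1), 1:] * characteristic_poly M = [:- c, 1:] * characteristic_poly (rank_one_shift M u)"
proof -
  let ?N = "rank_one_shift M u"
  have uu: "u \<bullet> u = 1" using u by (simp add: dot_square_norm)
  have "poly ([:- (c + 1), 1:] * characteristic_poly M) t = poly ([:- c, 1:] * characteristic_poly ?N) t"
    if t: "t \<noteq> c + 1" for t
  proof -
    \<comment> \<open>The shifted matrix has eigenvalue \<open>c + 1\<close> at \<open>u\<close>,
      and this \<kappa> makes \<open>t I - M\<close> equal to \<open>t I - ?N\<close> times the
      identity plus \<kappa> times the projection to \<open>u\<close>. The excluded value
      \<open>t = c + 1\<close> is harmless, since a polynomial with infinitely many zeros is
      0.\<close>
    define \<kappa> where "\<kappa> = 1 / (t - c - 1)"
    let ?K = "\<lambda>q. q + (\<kappa> * (u \<bullet> q)) *\<^sub>R u"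
    have linK: "linear ?K" by (intro linearI) (auto simp: inner_add_right algebra_simps)
    have k: "\<kappa> * (t - c - 1) = 1" using t by (simp add: \<kappa>_def)
    have "shifted_matrix M t *v q = (shifted_matrix ?N t ** matrix ?K) *v q" for q
    proof -
      have "(shifted_matrix ?N t ** matrix ?K) *v q = shifted_matrix ?N t *v (?K q)"
        by (simp add: matrix_vector_mul_assoc[symmetric] fun_cong[OF matrix_vector_mul(2)[OF linK]])
      also have "\<dots> = t *\<^sub>R q - M *v q + (\<kappa> * (t - c - 1) * (u \<bullet> q) - (u \<bullet> q)) *\<^sub>R u"
        unfolding shifted_matrix_mult rank_one_shift_mult
        by (simp add: matrix_vector_right_distrib matrix_vector_mult_scaleR eig inner_add_right uu algebra_simps)
      also have "\<dots> = shifted_matrix M t *v q" unfolding k by (simp add: shifted_matrix_mult)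
      finally show ?thesis by simp
    qed
    then have "shifted_matrix M t = shifted_matrix ?N t ** matrix ?K" by (simp add: matrix_eq)
    then have dA: "det (shifted_matrix M t) = det (shifted_matrix ?N t) * (1 + \<kappa>)"
      by (simp add: det_mul det_rank_one_update[OF u])
    have k2: "(t - c - 1) * (1 + \<kappa>) = t - c" using k by (simp add: algebra_simps)
    have "(t - c - 1) * det (shifted_matrix M t) = ((t - c - 1) * (1 + \<kappa>)) * det (shifted_matrix ?N t)"
      unfolding dA by (simp only: mult_ac)
    then have dets: "(t - c - 1) * det (shifted_matrix M t) = (t - c) * det (shifted_matrix ?N t)"
      unfolding k2 .
    have p: "poly [:- (c + 1), 1:] t = t - c - 1" "poly [:- c, 1:] t = t - c" by simp_all
    show ?thesis unfolding poly_mult poly_characteristic_poly p by (rule dets)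
  qed
  then have "- {c + 1} \<subseteq> {t. poly ([:- (c + 1), 1:] * characteristic_poly M - [:- c, 1:] * characteristic_poly ?N) t = 0}"
    by auto
  moreover have "infinite (- {c + 1})" by (simp add: infinite_UNIV_char_0 Compl_eq_Diff_UNIV)
  ultimately have "infinite {t. poly ([:- (c + 1), 1:] * characteristic_poly M - [:- c, 1:] * characteristic_poly ?N) t = 0}"
    using finite_subset by blast
  then have "[:- (c + 1), 1:] * characteristic_poly M - [:- c, 1:] * characteristic_poly ?N = 0"
    using poly_roots_finite by blast
  then show ?thesis by simp
qed

text \<open>The hypothesis \<open>only\<close> concerns eigenvectors, the conclusion algebraic
  multiplicity. By symmetry, an eigenvector of the shifted matrix for \<open>c\<close> would be
  orthogonal to \<open>u\<close> and hence 0, so the shifted characteristic polynomial does not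
  vanish at \<open>c\<close>. The polynomial identity then leaves exactly one factor at
  \<open>c\<close>.\<close>

lemma simple_eigenvalueI:
  fixes M :: "real^'n^'n"
  assumes sym: "transpose M = M" and u: "norm u = 1" and eig: "M *v u = c *\<^sub>R u"
    and only: "\<And>x. M *v x = c *\<^sub>R x \<Longrightarrow> u \<bullet> x = 0 \<Longrightarrow> x = 0"
  shows "simple_eigenvalue M c"
proof -
  let ?N = "rank_one_shift M u"
  have uu: "u \<bullet> u = 1" using u by (simp add: dot_square_norm)
  have "x = 0" if "shifted_matrix ?N c *v x = 0" for x
  proof -
    have eq: "M *v x + (u \<bullet> x) *\<^sub>R u = c *\<^sub>R x"
      using that unfolding shifted_matrix_mult rank_one_shift_mult by simp
    then have "u \<bullet> (M *v x) + u \<bullet> x = c * (u \<bullet> x)"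
      by (metis inner_add_right inner_scaleR_right mult.right_neutral uu)
    moreover have "u \<bullet> (M *v x) = c * (u \<bullet> x)"
      by (metis dot_lmul_matrix eig inner_scaleR_left sym transpose_matrix_vector)
    ultimately have "u \<bullet> x = 0" by simp
    then show "x = 0" using eq only by simp
  qed
  then have "invertible (shifted_matrix ?N c)"
    unfolding invertible_left_inverse matrix_left_invertible_ker by blast
  then have q: "poly (characteristic_poly ?N) c \<noteq> 0"
    by (simp add: poly_characteristic_poly invertible_det_nz)
  then have "characteristic_poly ?N \<noteq> 0" by auto
  then have nz: "[:- c, 1:] * characteristic_poly ?N \<noteq> 0" by (simp only: mult_eq_0_iff) simp
  note id = characteristic_poly_rank_one_shift[OF u eig]
  have "order c ([:- (c + 1), 1:] * characteristic_poly M) = order c [:- (c + 1), 1:] + order c (characteristic_poly M)"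
    using nz unfolding id[symmetric] by (rule order_mult)
  moreover have "order c ([:- c, 1:] * characteristic_poly ?N) = order c [:- c, 1:] + order c (characteristic_poly ?N)"
    using nz by (rule order_mult)
  moreover have "order c [:- (c + 1), 1:] = 0" by (rule order_0I) simp
  moreover have "order c (characteristic_poly ?N) = 0" using q by (rule order_0I)
  moreover have "order c [:- c, 1:] = 1" using order_power_n_n[of c 1] by simp
  ultimately have "order c (characteristic_poly M) = 1" using id by simp
  moreover have "matrix_eigenvalue M c"
    unfolding matrix_eigenvalue_def using eig u by (intro exI[of _ u]) auto
  ultimately show ?thesis by (simp add: simple_eigenvalue_def)
qed

text \<open>The minimum of the quadratic form on the unit sphere is an eigenvalue, negative because
  of \<open>w\<close>. Two orthogonal eigenvectors with negative eigenvalues would span a plane on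
  which the form is negative definite; that plane contains a nonzero vector orthogonal to
  \<open>M *v w\<close>, against \<open>semi\<close>.\<close>

lemma one_negative_eigenvalue:
  fixes M :: "real^'n^'n"
  assumes sym: "transpose M = M" and neg: "w \<bullet> (M *v w) < 0"
    and semi: "\<And>h. (M *v w) \<bullet> h = 0 \<Longrightarrow> 0 \<le> h \<bullet> (M *v h)"
  shows "\<exists>c. {l. l < 0 \<and> matrix_eigenvalue M l} = {c} \<and> simple_eigenvalue M c"
proof -
  have self: "x \<bullet> (M *v y) = (M *v x) \<bullet> y" for x y
    using dot_lmul_matrix[of x M y] transpose_matrix_vector[of M x] sym by simp
  have "w \<noteq> 0" using neg by auto
  have "continuous_on (sphere 0 1) (\<lambda>h. h \<bullet> (M *v h))"
    by (intro continuous_intros matrix_vector_mult_linear_continuous_on)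
  moreover have "sphere (0::real^'n) 1 \<noteq> {}" by simp
  ultimately obtain u where u: "u \<in> sphere 0 1" "\<And>h. h \<in> sphere 0 1 \<Longrightarrow> u \<bullet> (M *v u) \<le> h \<bullet> (M *v h)"
    using continuous_attains_inf[of "sphere (0::real^'n) 1"] compact_sphere by blast
  have nu: "norm u = 1" using u(1) by simp
  define c where "c = u \<bullet> (M *v u)"
  have low: "c * (h \<bullet> h) \<le> h \<bullet> (M *v h)" for h
  proof (cases "h = 0")
    case False
    have "c \<le> (h /\<^sub>R norm h) \<bullet> (M *v (h /\<^sub>R norm h))"
      unfolding c_def using False by (intro u(2)) simp
    also have "\<dots> = (h \<bullet> (M *v h)) / (norm h)\<^sup>2"
      by (simp add: matrix_vector_mult_scaleR power2_eq_square field_simps)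
    finally show ?thesis using False by (simp add: dot_square_norm field_simps)
  qed simp
  have "c * (w \<bullet> w) < 0" using low[of w] neg by linarith
  moreover have "0 < w \<bullet> w" using \<open>w \<noteq> 0\<close> by simp
  ultimately have "c < 0" by (simp add: mult_less_0_iff)
  have eig: "M *v u = c *\<^sub>R u"
  proof -
    have "(M *v u - c *\<^sub>R u) \<bullet> h = 0" for h
    proof -
      have "- ((M *v u - c *\<^sub>R u) \<bullet> h) = 0"
      proof (rule linear_term_zero)
        fix t
        have "0 \<le> (u + t *\<^sub>R h) \<bullet> (M *v (u + t *\<^sub>R h)) - c * ((u + t *\<^sub>R h) \<bullet> (u + t *\<^sub>R h))"
          using low[of "u + t *\<^sub>R h"] by simp
        also have "\<dots> = 2 * t * ((M *v u - c *\<^sub>R u) \<bullet> h) + t\<^sup>2 * (h \<bullet> (M *v h) - c * (h \<bullet> h)) + (u \<bullet> (M *v u) - c * (u \<bullet> u))"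
          using self[of u h] self[of h u]
          by (simp add: matrix_vector_right_distrib matrix_vector_mult_scaleR inner_add_left inner_add_right
              inner_diff_left inner_commute algebra_simps power2_eq_square)
        also have "u \<bullet> (M *v u) - c * (u \<bullet> u) = 0" using nu by (simp add: c_def dot_square_norm)
        finally show "2 * t * - ((M *v u - c *\<^sub>R u) \<bullet> h) + t\<^sup>2 * - (h \<bullet> (M *v h) - c * (h \<bullet> h)) \<le> 0"
          unfolding mult_minus_right by linarith
      qed
      then show ?thesis by simp
    qed
    from this[of "M *v u - c *\<^sub>R u"] show ?thesis by simp
  qed
  have no_two: False
    if "u1 \<noteq> 0" "u2 \<noteq> 0" "u1 \<bullet> u2 = 0" "M *v u1 = l1 *\<^sub>R u1" "M *v u2 = l2 *\<^sub>R u2" "l1 < 0" "l2 < 0" for u1 u2 l1 l2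
  proof -
    \<comment> \<open>With these coefficients \<open>a *\<^sub>R u1 + b *\<^sub>R u2\<close> is
      orthogonal to \<open>M *v w\<close>; if both are 0, then \<open>u1\<close> itself is.\<close>
    define a where "a = (M *v w) \<bullet> u2"
    define b where "b = - ((M *v w) \<bullet> u1)"
    have q: "(\<alpha> *\<^sub>R u1 + \<beta> *\<^sub>R u2) \<bullet> (M *v (\<alpha> *\<^sub>R u1 + \<beta> *\<^sub>R u2)) = l1 * (\<alpha>\<^sup>2 * (u1 \<bullet> u1)) + l2 * (\<beta>\<^sup>2 * (u2 \<bullet> u2))" for \<alpha> \<beta>
      using that(3) by (simp add: matrix_vector_right_distrib matrix_vector_mult_scaleR that(4,5) inner_add_left inner_add_right
          inner_commute[of u2 u1] power2_eq_square algebra_simps)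
    have pos: "0 < u1 \<bullet> u1" "0 < u2 \<bullet> u2" using that(1,2) by auto
    show False
    proof (cases "a = 0 \<and> b = 0")
      case True
      then have "0 \<le> u1 \<bullet> (M *v u1)" by (intro semi) (simp add: b_def)
      then show False using that(4,6) pos by (simp add: zero_le_mult_iff)
    next
      case False
      have "(M *v w) \<bullet> (a *\<^sub>R u1 + b *\<^sub>R u2) = 0"
        by (simp add: a_def b_def inner_add_right inner_diff_right mult.commute)
      from semi[OF this] have ge: "0 \<le> l1 * (a\<^sup>2 * (u1 \<bullet> u1)) + l2 * (b\<^sup>2 * (u2 \<bullet> u2))" unfolding q .
      have "l1 * (a\<^sup>2 * (u1 \<bullet> u1)) \<le> 0" "l2 * (b\<^sup>2 * (u2 \<bullet> u2)) \<le> 0"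
        using that(6,7) by (simp_all add: mult_nonpos_nonneg)
      moreover have "l1 * (a\<^sup>2 * (u1 \<bullet> u1)) < 0 \<or> l2 * (b\<^sup>2 * (u2 \<bullet> u2)) < 0"
        using False that(6,7) pos by (auto simp: mult_less_0_iff)
      ultimately show False using ge by linarith
    qed
  qed
  have unz: "u \<noteq> 0" using nu by auto
  have only: "x = 0" if "M *v x = c *\<^sub>R x" "u \<bullet> x = 0" for x
    using no_two[OF unz _ that(2) eig that(1)] \<open>c < 0\<close> by blast
  have uniq: "l = c" if l: "l < 0" "matrix_eigenvalue M l" for l
  proof (rule ccontr)
    assume "l \<noteq> c"
    obtain x where x: "x \<noteq> 0" "M *v x = l *\<^sub>R x" using l(2) by (auto simp: matrix_eigenvalue_def)
    have "l * (u \<bullet> x) = c * (u \<bullet> x)" using self[of u x] x(2) eig by simp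
    then have "u \<bullet> x = 0" using \<open>l \<noteq> c\<close> by simp
    then show False using no_two[OF unz x(1) _ eig x(2)] \<open>c < 0\<close> l(1) by blast
  qed
  have "matrix_eigenvalue M c" unfolding matrix_eigenvalue_def using eig unz by blast
  then have "{l. l < 0 \<and> matrix_eigenvalue M l} = {c}" using uniq \<open>c < 0\<close> by blast
  moreover have "simple_eigenvalue M c" by (rule simple_eigenvalueI[OF sym nu eig only])
  ultimately show ?thesis by blast
qed

section \<open>Dual skeletons and Colin de Verdiere matrices\<close>

lemma partial_deriv_support_volume:
  fixes v :: "'n::finite \<Rightarrow> real^'d"
  assumes "positively_spanning v" "nondegenerate v x"
  shows "partial_deriv i (support_volume v) x = facet_volume v i x"
  unfolding partial_deriv_def
  by (rule DERIV_imp_deriv[OF support_volume_has_partial_derivative[OF assms]])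

lemma second_partial_deriv_support_volume:
  fixes v :: "'n::finite \<Rightarrow> real^'d"
  assumes v: "positively_spanning v" and reg: "regular v x"
  shows "partial_deriv i (partial_deriv j (support_volume v)) x = facet_volume_deriv v j x (axis i 1)"
proof -
  have nd: "nondegenerate v x" using reg by (simp add: regular_def)
  have "((\<lambda>t. x + t *\<^sub>R axis i 1) \<longlongrightarrow> x + 0 *\<^sub>R axis i 1) (nhds 0)"
    by (intro tendsto_intros filterlim_ident)
  then have "\<forall>\<^sub>F t in nhds 0. nondegenerate v (x + t *\<^sub>R axis i 1)"
    using eventually_nondegenerate[OF nd] by (simp add: filterlim_iff)
  then have ev: "\<forall>\<^sub>F t in nhds 0. partial_deriv j (support_volume v) (x + t *\<^sub>R axis i 1) = facet_volume v j (x + t *\<^sub>R axis i 1)"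
    by (rule eventually_mono) (rule partial_deriv_support_volume[OF v])
  have "((\<lambda>t. facet_volume v j (x + t *\<^sub>R axis i 1)) has_real_derivative facet_volume_deriv v j x (axis i 1)) (at 0)"
    using facet_volume_has_derivative[OF v reg] by (intro has_derivative_along_line) simp
  then have "((\<lambda>t. partial_deriv j (support_volume v) (x + t *\<^sub>R axis i 1)) has_real_derivative facet_volume_deriv v j x (axis i 1)) (at 0)"
    unfolding DERIV_cong_ev[OF refl ev refl] .
  then show ?thesis unfolding partial_deriv_def[of i] by (rule DERIV_imp_deriv)
qed

text \<open>Inside the prism over facet \<open>j\<close>, a ray in direction \<open>a\<close> runs
  parallel to the ends and must leave through a side. That side comes from a neighbour
  \<open>k\<close> of \<open>j\<close> with \<open>0 < v k \<bullet> a\<close>, against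
  orthogonality.\<close>

lemma adjacent_normals_span:
  fixes v :: "'n::finite \<Rightarrow> real^'d"
  assumes v: "positively_spanning v" and reg: "regular v x" and pos: "0 < facet_volume v j x"
    and orth: "v j \<bullet> a = 0" "\<And>k. k \<noteq> j \<Longrightarrow> 0 < facet_volume_deriv v j x (axis k 1) \<Longrightarrow> v k \<bullet> a = 0"
  shows "a = 0"
proof (rule ccontr)
  assume "a \<noteq> 0"
  have vj: "v j \<noteq> 0" using pos by (auto simp: facet_volume_def)
  let ?w = "facet_normals 0 v j" and ?y = "facet_offsets v j x"
  have w: "positively_spanning ?w" by (rule positively_spanning_facet_normals[OF v vj])
  have nd: "nondegenerate ?w ?y" using reg vj by (simp add: regular_def)
  have "0 < support_volume ?w ?y" using pos vj by (simp add: facet_volume_def)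
  then obtain q where "\<forall>K. ?w K \<bullet> q < ?y $ K"
    using nd by (subst (asm) support_volume_pos_iff[OF w]) (auto simp: nondegenerate_def)
  from ray_hits_facet[OF w nd this \<open>a \<noteq> 0\<close>]
  obtain K where K: "0 < ?w K \<bullet> a" "0 < facet_volume ?w K ?y" by blast
  have "K = None \<Longrightarrow> False" "K = Some j \<Longrightarrow> False"
    using K(1) orth(1) by (simp_all add: facet_normals_simps)
  then obtain k where k: "K = Some k" "k \<noteq> j" by (cases K) auto
  have "?w K \<bullet> a = v k \<bullet> a"
    using k orth(1) by (simp add: facet_normals_simps inner_diff_left)
  moreover have "v k \<bullet> a = 0"
    using orth(2)[OF k(2)] K(2) k vj by (simp add: facet_volume_deriv_axis)
  ultimately show False using K(1) by simp
qed

lemma translation_offsets_linear: "linear (translation_offsets v)"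
  by (intro linearI) (auto simp: translation_offsets_def vec_eq_iff inner_add_right)

theorem hessian_colin_de_verdiere:
  fixes v :: "'n::finite \<Rightarrow> real^'d" and M :: "real^'n^'n"
  assumes v: "positively_spanning v" and gp: "general_position v x" and d: "2 \<le> CARD('d)"
    and p0: "\<And>k. v k \<bullet> p0 < x $ k" and pos: "\<And>i. 0 < facet_volume v i x"
    and M: "\<And>i j. M $ i $ j = - facet_volume_deriv v i x (axis j 1)"
    and G: "\<And>i j. G i j \<longleftrightarrow> i \<noteq> j \<and>
      (\<exists>p. v i \<bullet> p = x $ i \<and> v j \<bullet> p = x $ j \<and> (\<forall>k. k \<noteq> i \<longrightarrow> k \<noteq> j \<longrightarrow> v k \<bullet> p < x $ k))"
  shows "colin_de_verdiere_matrix G M" "corank M = CARD('d)"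
proof -
  have nd: "nondegenerate v x" and reg: "regular v x"
    using gp general_position_regular by (auto simp: general_position_def)
  have Mv: "(M *v h) $ i = - facet_volume_deriv v i x h" for h i
    unfolding facet_volume_deriv_expand[OF v reg, of i h]
    by (simp add: matrix_vector_mult_def M sum_negf mult.commute)
  have form: "g \<bullet> (M *v h) = - volume_hessian v x g h" for g h
    by (simp add: inner_vec_def Mv volume_hessian_def sum_negf)
  have adj: "G i j \<longleftrightarrow> i \<noteq> j \<and> 0 < facet_volume_deriv v i x (axis j 1)" for i j
    using G[of i j] facet_volume_deriv_pos_iff[OF v reg, of j i] by blast
  have sym: "transpose M = M"
    by (simp add: transpose_def vec_eq_iff M facet_volume_deriv_symmetric[OF v reg])
  have kernel: "{y. M *v y = 0} = range (translation_offsets v)"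
  proof (intro equalityI subsetI)
    fix y assume "y \<in> {y. M *v y = 0}"
    then have "facet_volume_deriv v i x y = 0" for i using Mv[of y i] by simp
    then show "y \<in> range (translation_offsets v)"
      using volume_hessian_kernel[OF v gp d p0 pos] by blast
  next
    fix y assume "y \<in> range (translation_offsets v)"
    then show "y \<in> {y. M *v y = 0}"
      by (auto simp: vec_eq_iff Mv facet_volume_deriv_translation[OF v reg])
  qed
  have inj: "inj (translation_offsets v)"
  proof (subst linear_injective_0[OF translation_offsets_linear], intro allI impI)
    fix a assume "translation_offsets v a = 0"
    then have "\<forall>i. v i \<bullet> a \<le> 0" by (simp add: translation_offsets_def vec_eq_iff)
    then show "a = 0" using v by (simp add: positively_spanning_def)
  qed
  show "corank M = CARD('d)"
    unfolding corank_def kernel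
    using dim_image_eq[OF translation_offsets_linear inj_on_subset[OF inj subset_UNIV], of UNIV] by (simp add: dim_UNIV)
  have V: "0 < support_volume v x"
    using p0 nd by (subst support_volume_pos_iff[OF v]) (auto simp: nondegenerate_def)
  \<comment> \<open>Euler's identity makes \<open>M *v x\<close> a negative multiple of the
    gradient. Hence \<open>x\<close> can serve as \<open>w\<close> in the spectral lemma, and the
    vectors orthogonal to \<open>M *v x\<close> are those of zero gradient.\<close>
  have grad: "(M *v x) \<bullet> h = - (real (CARD('d) - 1) * volume_gradient v x h)" for h
    using form[of h x] volume_hessian_euler[OF v reg, of h] by (simp add: inner_commute)
  have "x \<bullet> (M *v x) < 0"
    using grad[of x] V d by (simp add: volume_gradient_self[OF v nd] inner_commute)
  moreover have "0 \<le> h \<bullet> (M *v h)" if "(M *v x) \<bullet> h = 0" for h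
  proof -
    have "volume_gradient v x h = 0" using grad[of h] that d by simp
    then show ?thesis using volume_hessian_nonpos[OF v reg] by (simp add: form)
  qed
  ultimately have spec: "\<exists>c. {l. l < 0 \<and> matrix_eigenvalue M l} = {c} \<and> simple_eigenvalue M c"
    by (rule one_negative_eigenvalue[OF sym])
  have transversal: "X = 0"
    if X: "M ** X = 0" "\<And>i j. i = j \<or> G i j \<Longrightarrow> X $ i $ j = 0" and symX: "transpose X = X" for X :: "real^'n^'n"
  proof -
    have "column j X = 0" for j
    proof -
      have "M *v column j X = 0"
        using X(1) by (simp add: vec_eq_iff matrix_matrix_mult_def matrix_vector_mult_def column_def)
      then obtain a where a: "column j X = translation_offsets v a" using kernel by blast
      have Xa: "X $ i $ j = v i \<bullet> a" for i
        using a by (simp add: vec_eq_iff column_def translation_offsets_def)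
      \<comment> \<open>So the translation vector \<open>a\<close> of column \<open>j\<close> is
        orthogonal to the normals of facet \<open>j\<close> and of all its neighbours.\<close>
      have "X $ k $ j = 0" if "k \<noteq> j" "0 < facet_volume_deriv v j x (axis k 1)" for k
        using that X(2)[of k j] adj[of k j] facet_volume_deriv_symmetric[OF v reg, of j k] by simp
      then have "a = 0"
        using X(2)[of j j] by (intro adjacent_normals_span[OF v reg pos[of j]]) (simp_all add: Xa[symmetric])
      then show ?thesis unfolding a by (simp add: linear_0[OF translation_offsets_linear])
    qed
    then show ?thesis by (simp add: vec_eq_iff column_def)
  qed
  show "colin_de_verdiere_matrix G M"
    unfolding colin_de_verdiere_matrix_def
  proof (intro conjI allI impI sym spec)
    show "M $ i $ j < 0" if "G i j" for i j using that adj by (simp add: M)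
    show "M $ i $ j = 0" if "i \<noteq> j \<and> \<not> G i j" for i j
    proof -
      have "0 \<le> facet_volume_deriv v i x (axis j 1)" "\<not> 0 < facet_volume_deriv v i x (axis j 1)"
        using that adj[of i j] facet_volume_deriv_axis_nonneg[of j i v x] by auto
      then show ?thesis unfolding M by linarith
    qed
    show "X = 0" if "transpose X = X \<and> M ** X = 0 \<and> (\<forall>i j. i = j \<or> G i j \<longrightarrow> X $ i $ j = 0)" for X
      using that transversal by blast
  qed
qed

section \<open>Dimensions of faces, general position and adjacency\<close>

lemma aff_dim_support_face_le:
  fixes v :: "'n::finite \<Rightarrow> real^'d"
  assumes "E \<noteq> {}" and E: "\<And>p j. p \<in> E \<Longrightarrow> j \<in> J \<Longrightarrow> v j \<bullet> p = x $ j"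
  shows "aff_dim E \<le> int CARD('d) - int (dim (v ` J))"
proof -
  obtain p where p: "p \<in> E" using assms(1) by blast
  let ?L = "{u \<in> UNIV. \<forall>a\<in>span (v ` J). orthogonal a u}"
  have "aff_dim E = int (dim ((+) (- p) ` E))" using p by (intro aff_dim_eq_dim hull_inc)
  also have "(+) (- p) ` E \<subseteq> ?L"
  proof (safe)
    fix q a assume q: "q \<in> E" and a: "a \<in> span (v ` J)"
    have "span (v ` J) \<subseteq> {a. orthogonal (- p + q) a}"
      using E[OF p] E[OF q]
      by (intro span_minimal subspace_orthogonal_to_vector) (auto simp: orthogonal_def inner_diff_left inner_commute[of p] inner_commute[of q])
    then show "orthogonal a (- p + q)" using a by (auto simp: orthogonal_commute)
  qed simp
  then have "dim ((+) (- p) ` E) \<le> dim ?L" by (rule dim_subset)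
  also have "dim ?L + dim (span (v ` J)) = dim (UNIV :: (real^'d) set)"
    by (intro dim_subspace_orthogonal_to_vectors) auto
  then have "int (dim ?L) = int CARD('d) - int (dim (v ` J))" by (simp add: dim_UNIV)
  finally show ?thesis by simp
qed

text \<open>Near a point where exactly the constraints in \<open>J\<close> are tight, the face
  contains a small ball of the orthogonal complement of their normals.\<close>

lemma aff_dim_support_face:
  fixes v :: "'n::finite \<Rightarrow> real^'d"
  assumes p: "\<And>j. j \<in> J \<Longrightarrow> v j \<bullet> p = x $ j" "\<And>k. k \<notin> J \<Longrightarrow> v k \<bullet> p < x $ k"
  shows "aff_dim {q \<in> support_polytope v x. \<forall>j\<in>J. v j \<bullet> q = x $ j} = int CARD('d) - int (dim (v ` J))"
proof (rule antisym)
  let ?E = "{q \<in> support_polytope v x. \<forall>j\<in>J. v j \<bullet> q = x $ j}"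
  have "v k \<bullet> p \<le> x $ k" for k using p by (cases "k \<in> J") (auto simp: less_imp_le)
  then have pE: "p \<in> ?E" using p(1) by (simp add: support_polytope_def)
  then show "aff_dim ?E \<le> int CARD('d) - int (dim (v ` J))"
    by (intro aff_dim_support_face_le[of _ _ v x]) auto
  let ?L = "{u \<in> UNIV. \<forall>a\<in>span (v ` J). orthogonal a u}"
  have "open (\<Inter>k\<in>- J. {q. v k \<bullet> q < x $ k})" by (auto intro!: open_INT open_Collect_less continuous_intros)
  moreover have "p \<in> (\<Inter>k\<in>- J. {q. v k \<bullet> q < x $ k})" using p by simp
  ultimately obtain r where r: "r > 0" "ball p r \<subseteq> (\<Inter>k\<in>- J. {q. v k \<bullet> q < x $ k})"
    unfolding open_contains_ball by blast
  have "?L \<subseteq> span ((+) (- p) ` ?E)"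
  proof
    fix u assume u: "u \<in> ?L"
    define c where "c = r / (2 * (norm u + 1))"
    have nu: "0 < norm u + 1" using norm_ge_zero[of u] by linarith
    have c: "c > 0" using r(1) nu by (simp add: c_def)
    have "c * norm u < r"
    proof -
      have "c * norm u \<le> c * (norm u + 1)" using c by simp
      also have "\<dots> = r / 2" using nu by (simp add: c_def field_simps)
      finally show ?thesis using r(1) by simp
    qed
    then have near: "p + c *\<^sub>R u \<in> ball p r" using c by (simp add: dist_norm)
    have on: "v j \<bullet> (p + c *\<^sub>R u) = x $ j" if "j \<in> J" for j
      using u p(1)[OF that] that by (auto simp: inner_add_right orthogonal_def span_base)
    have "v k \<bullet> (p + c *\<^sub>R u) \<le> x $ k" for k
      using on[of k] near r(2) by (cases "k \<in> J") (auto simp: less_imp_le subset_iff)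
    then have "p + c *\<^sub>R u \<in> ?E" using on by (simp add: support_polytope_def)
    then have "c *\<^sub>R u \<in> (+) (- p) ` ?E" by (intro image_eqI[of _ _ "p + c *\<^sub>R u"]) simp_all
    then have "(1 / c) *\<^sub>R (c *\<^sub>R u) \<in> span ((+) (- p) ` ?E)" by (intro span_scale span_base)
    then show "u \<in> span ((+) (- p) ` ?E)" using c by simp
  qed
  then have "dim ?L \<le> dim (span ((+) (- p) ` ?E))" by (rule dim_subset)
  moreover have "aff_dim ?E = int (dim ((+) (- p) ` ?E))" using pE by (intro aff_dim_eq_dim hull_inc)
  moreover have "dim ?L + dim (span (v ` J)) = dim (UNIV :: (real^'d) set)"
    by (intro dim_subspace_orthogonal_to_vectors) auto
  ultimately show "int CARD('d) - int (dim (v ` J)) \<le> aff_dim ?E" by (simp add: dim_UNIV)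
qed

lemma has_outer_facet_normals_strict_point:
  fixes v :: "'n::finite \<Rightarrow> real^'d"
  assumes H: "has_outer_facet_normals v x"
  obtains p where "\<And>k. v k \<bullet> p < x $ k" "\<And>k. v k \<noteq> 0"
proof -
  let ?P = "support_polytope v x"
  have facet: "support_facet v x i facet_of ?P" for i using H by (simp add: has_outer_facet_normals_def)
  have nz: "v i \<noteq> 0" for i
  proof
    assume "v i = 0"
    then have "support_facet v x i = {} \<or> support_facet v x i = ?P" by (auto simp: support_facet_def)
    then show False using facet[of i] by (auto simp: facet_of_def)
  qed
  have "aff_dim ?P = int DIM(real^'d)" using H by (simp add: has_outer_facet_normals_def)
  then have "interior ?P = rel_interior ?P" by (metis interior_rel_interior_gen)
  moreover have "?P \<noteq> {}" using facet facet_of_imp_subset by (fastforce simp: facet_of_def)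
  ultimately have "interior ?P \<noteq> {}" using rel_interior_eq_empty convex_support_polytope by metis
  then obtain p where p: "p \<in> interior ?P" by blast
  have "v k \<bullet> p < x $ k" for k
  proof -
    have "?P \<subseteq> {p. v k \<bullet> p \<le> x $ k}" by (auto simp: support_polytope_def)
    then have "p \<in> interior {p. v k \<bullet> p \<le> x $ k}" using p interior_mono by blast
    then show ?thesis using interior_halfspace_le[OF nz] by blast
  qed
  then show thesis using nz that by blast
qed

text \<open>A nonzero \<open>u\<close> with all \<open>v i \<bullet> u \<le> 0\<close> would span a
  ray inside the bounded polytope.\<close>

lemma bounded_positively_spanning:
  fixes v :: "'n::finite \<Rightarrow> real^'d"
  assumes "bounded (support_polytope v x)" and p: "p \<in> support_polytope v x"
  shows "positively_spanning v"
  unfolding positively_spanning_def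
proof (intro allI impI)
  fix u assume u: "\<forall>i. v i \<bullet> u \<le> 0"
  obtain B where B: "\<And>q. q \<in> support_polytope v x \<Longrightarrow> norm q \<le> B"
    using assms(1) by (auto simp: bounded_iff)
  have ray: "norm (p + t *\<^sub>R u) \<le> B" if "0 \<le> t" for t
  proof (rule B)
    have "v k \<bullet> (p + t *\<^sub>R u) \<le> x $ k" for k
    proof -
      have "v k \<bullet> p \<le> x $ k" using p by (simp add: support_polytope_def)
      moreover have "t * (v k \<bullet> u) \<le> 0" using that u by (simp add: mult_nonneg_nonpos)
      ultimately show ?thesis by (simp add: inner_add_right)
    qed
    then show "p + t *\<^sub>R u \<in> support_polytope v x" by (simp add: support_polytope_def)
  qed
  show "u = 0"
  proof (rule ccontr)
    assume "u \<noteq> 0"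
    define t where "t = (B + norm p + 1) / norm u"
    have "0 \<le> B" using B[OF p] norm_ge_zero order_trans by blast
    then have "0 \<le> t" by (simp add: t_def)
    have "B + norm p + 1 = norm (t *\<^sub>R u)" using \<open>u \<noteq> 0\<close> \<open>0 \<le> t\<close> by (simp only: norm_scaleR abs_of_nonneg) (simp add: t_def)
    also have "\<dots> \<le> norm (p + t *\<^sub>R u) + norm p"
      using norm_triangle_ineq4[of "p + t *\<^sub>R u" p] by simp
    finally show False using ray[OF \<open>0 \<le> t\<close>] by linarith
  qed
qed

text \<open>A facet contained in another one is a face of it of the same dimension, hence equal to
  it, and distinct indices have distinct facets.\<close>

lemma support_facet_subset_eq:
  assumes H: "has_outer_facet_normals v x" and sub: "support_facet v x i \<subseteq> support_facet v x k"
  shows "i = k"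
proof -
  let ?P = "support_polytope v x"
  have f: "support_facet v x j face_of ?P" "aff_dim (support_facet v x j) = aff_dim ?P - 1" for j
    using H unfolding has_outer_facet_normals_def facet_of_def by blast+
  have "support_facet v x k \<subseteq> ?P" unfolding support_facet_def by blast
  with f(1) sub have "support_facet v x i face_of support_facet v x k"
    by (rule face_of_subset)
  then have "support_facet v x i = support_facet v x k"
    using face_of_aff_dim_lt[OF face_of_imp_convex[OF f(1)[of k]]] f(2)[of i] f(2)[of k]
    by (metis less_irrefl)
  moreover have "inj (support_facet v x)" using H by (simp add: has_outer_facet_normals_def)
  ultimately show ?thesis by (simp add: inj_def)
qed

text \<open>In terms of the slacks \<open>s q k\<close>, a forbidden coincidence is a linear
  relation that holds at every point \<open>q\<close>. Depending on the signs of its coefficients,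
  it forces one facet into another or a nonpositive slack at an interior point.\<close>

lemma has_outer_facet_normals_general_position:
  fixes v :: "'n::finite \<Rightarrow> real^'d"
  assumes H: "has_outer_facet_normals v x"
  shows "general_position v x"
proof -
  obtain p where p: "\<And>k. v k \<bullet> p < x $ k" and nz: "\<And>k. v k \<noteq> 0"
    using has_outer_facet_normals_strict_point[OF H] by blast
  note sub = support_facet_subset_eq[OF H]
  define s where "s q k = x $ k - v k \<bullet> q" for q k
  have facet: "q \<in> support_facet v x k \<longleftrightarrow> (\<forall>l. 0 \<le> s q l) \<and> s q k = 0" for q k
    by (auto simp: support_facet_def support_polytope_def s_def)
  have sp: "0 < s p k" for k using p by (simp add: s_def)
  show ?thesis
    unfolding general_position_def nondegenerate_def
  proof (intro conjI allI impI)
    show "v k \<noteq> 0 \<or> x $ k \<noteq> 0" for k using nz by simp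
    fix i k c assume ik: "i \<noteq> k" and vk: "v k = c *\<^sub>R v i"
    show "x $ k \<noteq> c * x $ i"
    proof
      assume "x $ k = c * x $ i"
      then have sk: "s q k = c * s q i" for q using vk by (simp add: s_def algebra_simps)
      have "0 < c" using sk[of p] sp[of k] sp[of i] by (simp add: zero_less_mult_iff)
      then have "support_facet v x i \<subseteq> support_facet v x k" by (auto simp: facet sk)
      then show False using sub ik by blast
    qed
  next
    fix i j k a b
    assume ne: "i \<noteq> j" "i \<noteq> k" "j \<noteq> k" and vk: "v k = a *\<^sub>R v i + b *\<^sub>R v j"
    show "x $ k \<noteq> a * x $ i + b * x $ j"
    proof
      assume "x $ k = a * x $ i + b * x $ j"
      then have sk: "s q k = a * s q i + b * s q j" for q
        using vk by (simp add: s_def algebra_simps inner_add_left)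
      have zero: "l = m" if "\<And>q. (\<forall>r. 0 \<le> s q r) \<Longrightarrow> s q l = 0 \<Longrightarrow> s q m = 0" for l m
        by (rule sub) (auto simp: facet that)
      \<comment> \<open>If one coefficient is positive and the other nonnegative, facet
        \<open>k\<close> lies in the facet of the positive one. If the signs are opposite, the facet
        with the positive coefficient lies in facet \<open>k\<close>.\<close>
      consider "0 < a" "0 \<le> b" | "0 < b" "0 \<le> a" | "0 < a" "b < 0" | "0 < b" "a < 0" | "a \<le> 0" "b \<le> 0"
        by linarith
      then show False
      proof cases
        case 1
        have "k = i"
        proof (rule zero)
          fix q assume "\<forall>r. 0 \<le> s q r" "s q k = 0"
          then have "a * s q i + b * s q j = 0" "0 \<le> a * s q i" "0 \<le> b * s q j" using sk[of q] 1 by auto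
          then have "a * s q i = 0" by linarith
          then show "s q i = 0" using 1 by simp
        qed
        then show False using ne by simp
      next
        case 2
        have "k = j"
        proof (rule zero)
          fix q assume "\<forall>r. 0 \<le> s q r" "s q k = 0"
          then have "a * s q i + b * s q j = 0" "0 \<le> a * s q i" "0 \<le> b * s q j" using sk[of q] 2 by auto
          then have "b * s q j = 0" by linarith
          then show "s q j = 0" using 2 by simp
        qed
        then show False using ne by simp
      next
        case 3
        have "i = k"
        proof (rule zero)
          fix q assume q: "\<forall>r. 0 \<le> s q r" "s q i = 0"
          then have "b * s q j \<le> 0" using 3 by (simp add: mult_nonpos_nonneg)
          moreover have "s q k = b * s q j" using sk[of q] q(2) by simp
          moreover have "0 \<le> s q k" using q(1) by blast
          ultimately show "s q k = 0" by linarith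
        qed
        then show False using ne by simp
      next
        case 4
        have "j = k"
        proof (rule zero)
          fix q assume q: "\<forall>r. 0 \<le> s q r" "s q j = 0"
          then have "a * s q i \<le> 0" using 4 by (simp add: mult_nonpos_nonneg)
          moreover have "s q k = a * s q i" using sk[of q] q(2) by simp
          moreover have "0 \<le> s q k" using q(1) by blast
          ultimately show "s q k = 0" by linarith
        qed
        then show False using ne by simp
      next
        case 5
        then have "a * s p i \<le> 0" "b * s p j \<le> 0"
          using sp[of i] sp[of j] by (simp_all add: mult_nonpos_nonneg less_imp_le)
        then show False using sk[of p] sp[of k] by linarith
      qed
    qed
  qed
qed

text \<open>The average of one witness per constraint is strict wherever a single witness is,
  because the other witnesses satisfy the weak inequality.\<close>

lemma average_strict_point:
  fixes v :: "'n::finite \<Rightarrow> real^'d"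
  assumes E: "E \<subseteq> support_polytope v x" and on: "\<And>q j. q \<in> E \<Longrightarrow> j \<in> J \<Longrightarrow> v j \<bullet> q = x $ j"
    and strict: "\<And>k. \<exists>q\<in>E. k \<notin> J \<longrightarrow> v k \<bullet> q < x $ k"
  shows "\<exists>p. (\<forall>j\<in>J. v j \<bullet> p = x $ j) \<and> (\<forall>k. k \<notin> J \<longrightarrow> v k \<bullet> p < x $ k)"
proof -
  obtain q where q: "\<And>k. q k \<in> E" "\<And>k. k \<notin> J \<Longrightarrow> v k \<bullet> q k < x $ k" using strict by metis
  have le: "v l \<bullet> q k \<le> x $ l" for k l using q(1)[of k] E by (auto simp: support_polytope_def)
  define p where "p = (1 / real CARD('n)) *\<^sub>R (\<Sum>k\<in>UNIV. q k)"
  have vp: "v l \<bullet> p = (\<Sum>k\<in>UNIV. v l \<bullet> q k) / real CARD('n)" for l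
    by (simp add: p_def inner_sum_right)
  have "v j \<bullet> p = x $ j" if "j \<in> J" for j using on[OF q(1) that] by (simp add: vp)
  moreover have "v l \<bullet> p < x $ l" if "l \<notin> J" for l
  proof -
    have "(\<Sum>k\<in>UNIV. v l \<bullet> q k) < (\<Sum>k\<in>(UNIV::'n set). x $ l)"
      by (rule sum_strict_mono_ex1) (use le q(2)[OF that] in auto)
    then show ?thesis unfolding vp by (simp add: divide_less_eq mult.commute)
  qed
  ultimately show ?thesis by blast
qed

lemma has_outer_facet_normals_facet_point:
  fixes v :: "'n::finite \<Rightarrow> real^'d"
  assumes H: "has_outer_facet_normals v x"
  shows "\<exists>p. v i \<bullet> p = x $ i \<and> (\<forall>k. k \<noteq> i \<longrightarrow> v k \<bullet> p < x $ k)"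
proof -
  have "\<exists>q\<in>support_facet v x i. k \<notin> {i} \<longrightarrow> v k \<bullet> q < x $ k" for k
  proof (cases "k = i")
    case True
    have "support_facet v x i \<noteq> {}" using H unfolding has_outer_facet_normals_def facet_of_def by blast
    then show ?thesis using True by blast
  next
    case False
    then have "\<not> support_facet v x i \<subseteq> support_facet v x k" using support_facet_subset_eq[OF H] by blast
    then obtain q where q: "q \<in> support_facet v x i" "q \<notin> support_facet v x k" by blast
    then have "v k \<bullet> q \<le> x $ k" "v k \<bullet> q \<noteq> x $ k"
      unfolding support_facet_def support_polytope_def by blast+
    then have "v k \<bullet> q < x $ k" by simp
    then show ?thesis using q(1) by blast
  qed
  moreover have "support_facet v x i \<subseteq> support_polytope v x" unfolding support_facet_def by blast
  moreover have "v j \<bullet> q = x $ j" if "q \<in> support_facet v x i" "j \<in> {i}" for q j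
    using that by (simp add: support_facet_def)
  ultimately show ?thesis using average_strict_point[of "support_facet v x i" v x "{i}"] by simp
qed

lemma dim_two_vectors:
  fixes a b :: "'a::euclidean_space"
  assumes "a \<noteq> 0" "\<And>c. b \<noteq> c *\<^sub>R a"
  shows "dim {a, b} = 2"
proof -
  have "b \<notin> span {a}" using assms(2) by (auto simp: span_singleton)
  then have "dim (insert b {a}) = dim {a} + 1" by (simp add: dim_insert)
  moreover have "dim {a} = 1" using assms(1) by (simp add: dim_insert)
  ultimately show ?thesis by (simp add: insert_commute)
qed

text \<open>If a third constraint were tight on the whole intersection, general position would make
  the three normals independent and the dimension at most \<open>d - 3\<close>. So dimension
  \<open>d - 2\<close> leaves witnesses to average; conversely, a point with just \<open>i\<close>
  and \<open>j\<close> tight fixes the dimension.\<close>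

lemma dual_skeleton_iff:
  fixes v :: "'n::finite \<Rightarrow> real^'d"
  assumes gp: "general_position v x" and nz: "\<And>k. v k \<noteq> 0"
    and face: "\<And>i. support_facet v x i face_of support_polytope v x" and d: "2 \<le> CARD('d)"
  shows "dual_skeleton v x i j \<longleftrightarrow> i \<noteq> j \<and>
    (\<exists>p. v i \<bullet> p = x $ i \<and> v j \<bullet> p = x $ j \<and> (\<forall>k. k \<noteq> i \<longrightarrow> k \<noteq> j \<longrightarrow> v k \<bullet> p < x $ k))"
proof (cases "i = j")
  case False
  let ?E = "support_facet v x i \<inter> support_facet v x j"
  have nd: "\<And>k l c. k \<noteq> l \<Longrightarrow> v l = c *\<^sub>R v k \<Longrightarrow> x $ l \<noteq> c * x $ k"
    using gp nz unfolding general_position_def nondegenerate_def by blast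
  \<comment> \<open>Distinct parallel hyperplanes do not meet, so a common point makes the two
    normals independent.\<close>
  have indep: "v j \<noteq> c *\<^sub>R v i" if "v i \<bullet> p = x $ i" "v j \<bullet> p = x $ j" for c p
    using nd[OF False, of c] that by auto
  have E: "?E = {q \<in> support_polytope v x. \<forall>l\<in>{i, j}. v l \<bullet> q = x $ l}" by (auto simp: support_facet_def)
  have "aff_dim ?E = int CARD('d) - 2 \<longleftrightarrow>
    (\<exists>p. v i \<bullet> p = x $ i \<and> v j \<bullet> p = x $ j \<and> (\<forall>k. k \<noteq> i \<longrightarrow> k \<noteq> j \<longrightarrow> v k \<bullet> p < x $ k))"
  proof
    assume dim: "aff_dim ?E = int CARD('d) - 2"
    then have ne: "?E \<noteq> {}" using d by auto
    then obtain p0 where p0: "p0 \<in> ?E" by blast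
    then have ind: "v j \<noteq> c *\<^sub>R v i" for c using indep[of p0] by (auto simp: support_facet_def)
    have "\<exists>q\<in>?E. k \<notin> {i, j} \<longrightarrow> v k \<bullet> q < x $ k" for k
    proof (rule ccontr)
      assume neg: "\<not> (\<exists>q\<in>?E. k \<notin> {i, j} \<longrightarrow> v k \<bullet> q < x $ k)"
      then have k: "k \<noteq> i" "k \<noteq> j" using p0 by auto
      have on: "v k \<bullet> q = x $ k" if "q \<in> ?E" for q
      proof -
        have "v k \<bullet> q \<le> x $ k" using that by (auto simp: support_facet_def support_polytope_def)
        moreover have "\<not> v k \<bullet> q < x $ k" using neg that k by simp
        ultimately show ?thesis by simp
      qed
      have "v k \<notin> span {v i, v j}"
      proof
        assume "v k \<in> span {v i, v j}"
        then obtain a where "v k - a *\<^sub>R v i \<in> span {v j}" unfolding span_insert by blast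
        then obtain b where "v k - a *\<^sub>R v i = b *\<^sub>R v j" unfolding span_singleton by blast
        then have ab: "v k = a *\<^sub>R v i + b *\<^sub>R v j" by (simp add: algebra_simps)
        have "x $ k = a * x $ i + b * x $ j"
          using on[OF p0] p0 unfolding ab by (auto simp: support_facet_def inner_add_left)
        then show False using gp False k nz[of i] ind ab unfolding general_position_def by metis
      qed
      then have "dim (insert (v k) {v i, v j}) = 3"
        using dim_two_vectors[OF nz ind] by (simp add: dim_insert)
      moreover have "v ` {k, i, j} = insert (v k) {v i, v j}" by auto
      ultimately have "dim (v ` {k, i, j}) = 3" by simp
      moreover have "aff_dim ?E \<le> int CARD('d) - int (dim (v ` {k, i, j}))"
        by (rule aff_dim_support_face_le[OF ne, of _ _ x]) (use on in \<open>auto simp: support_facet_def\<close>)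
      ultimately show False using dim by simp
    qed
    moreover have sub: "?E \<subseteq> support_polytope v x" unfolding support_facet_def by blast
    moreover have on: "v l \<bullet> q = x $ l" if "q \<in> ?E" "l \<in> {i, j}" for q l
      using that by (auto simp: support_facet_def)
    ultimately obtain p where p: "\<forall>l\<in>{i, j}. v l \<bullet> p = x $ l" "\<forall>k. k \<notin> {i, j} \<longrightarrow> v k \<bullet> p < x $ k"
      using average_strict_point[of ?E v x "{i, j}"] by metis
    show "\<exists>p. v i \<bullet> p = x $ i \<and> v j \<bullet> p = x $ j \<and> (\<forall>k. k \<noteq> i \<longrightarrow> k \<noteq> j \<longrightarrow> v k \<bullet> p < x $ k)"
      by (rule exI[of _ p]) (use p in simp)
  next
    assume "\<exists>p. v i \<bullet> p = x $ i \<and> v j \<bullet> p = x $ j \<and> (\<forall>k. k \<noteq> i \<longrightarrow> k \<noteq> j \<longrightarrow> v k \<bullet> p < x $ k)"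
    then obtain p where p: "v i \<bullet> p = x $ i" "v j \<bullet> p = x $ j" "\<And>k. k \<noteq> i \<Longrightarrow> k \<noteq> j \<Longrightarrow> v k \<bullet> p < x $ k" by blast
    have "aff_dim ?E = int CARD('d) - int (dim (v ` {i, j}))"
      unfolding E by (rule aff_dim_support_face) (use p in auto)
    moreover have "dim (v ` {i, j}) = 2" using dim_two_vectors[OF nz indep[OF p(1,2)]] by simp
    ultimately show "aff_dim ?E = int CARD('d) - 2" by simp
  qed
  moreover have "?E face_of support_polytope v x" by (intro face_of_Int face)
  ultimately show ?thesis using False by (simp add: dual_skeleton_def)
qed (simp add: dual_skeleton_def)

theorem volume_hessian_colin_de_verdiere:
  fixes v :: "'n::finite \<Rightarrow> real^'d" and M :: "real^'n^'n"
  assumes d: "2 \<le> CARD('d)" and H: "has_outer_facet_normals v x"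
    and M: "\<And>i j. M $ i $ j = - partial_deriv i (partial_deriv j (support_volume v)) x"
  shows "colin_de_verdiere_matrix (dual_skeleton v x) M \<and> corank M = CARD('d)"
proof -
  obtain p where p: "\<And>k. v k \<bullet> p < x $ k" and nz: "\<And>k. v k \<noteq> 0"
    using has_outer_facet_normals_strict_point[OF H] by blast
  have "bounded (support_polytope v x)"
    using H by (simp add: has_outer_facet_normals_def polytope_imp_bounded)
  then have v: "positively_spanning v"
    by (rule bounded_positively_spanning[of _ _ p]) (simp add: support_polytope_def p less_imp_le)
  note gp = has_outer_facet_normals_general_position[OF H]
  have nd: "nondegenerate v x" and reg: "regular v x"
    using gp general_position_regular by (auto simp: general_position_def)
  have pos: "0 < facet_volume v i x" for i
    unfolding facet_volume_pos_iff[OF v nd] by (rule has_outer_facet_normals_facet_point[OF H])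
  have face: "support_facet v x i face_of support_polytope v x" for i
    using H by (simp add: has_outer_facet_normals_def facet_of_imp_face_of)
  \<comment> \<open>The iterated derivative yields the indices in the opposite order, which symmetry
    of the Hessian corrects.\<close>
  have M': "M $ i $ j = - facet_volume_deriv v i x (axis j 1)" for i j
    unfolding M second_partial_deriv_support_volume[OF v reg]
    by (simp add: facet_volume_deriv_symmetric[OF v reg, of j i])
  show ?thesis
    using hessian_colin_de_verdiere[OF v gp d p pos M' dual_skeleton_iff[OF gp nz face d]] by blast
qed

section \<open>The polar dual of a polytope\<close>

text \<open>Faces of polytopes are exposed. Taking \<open>c\<close> as origin and scaling the
  exposing functional to the value 1 on the face turns it into a point of the polar
  polytope.\<close>

lemma proper_face_dual_point:
  fixes Q :: "(real^'d) set"
  assumes Q: "polytope Q" and c: "c \<in> interior Q" and T: "T face_of Q" "T \<noteq> Q"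
  obtains p where "\<And>q. q \<in> Q \<Longrightarrow> (q - c) \<bullet> p \<le> 1" "\<And>q. q \<in> Q \<Longrightarrow> (q - c) \<bullet> p = 1 \<longleftrightarrow> q \<in> T"
proof -
  have "T exposed_face_of Q"
    using T(1) exposed_face_of_polyhedron[OF polytope_imp_polyhedron[OF Q]] by blast
  then obtain a b where ab: "Q \<subseteq> {x. a \<bullet> x \<le> b}" "T = Q \<inter> {x. a \<bullet> x = b}"
    unfolding exposed_face_of_def by blast
  have cQ: "c \<in> Q" using c interior_subset by blast
  have "c \<notin> T" using face_of_disjoint_interior[OF T] c by blast
  then have pos: "0 < b - a \<bullet> c" using ab cQ by (auto simp: less_le)
  show thesis
  proof
    fix q assume q: "q \<in> Q"
    have eq: "(q - c) \<bullet> ((1 / (b - a \<bullet> c)) *\<^sub>R a) = (a \<bullet> q - a \<bullet> c) / (b - a \<bullet> c)"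
      by (simp add: inner_diff_left inner_commute[of q a] inner_commute[of c a])
    have "a \<bullet> q \<le> b" using ab(1) q by blast
    then show "(q - c) \<bullet> ((1 / (b - a \<bullet> c)) *\<^sub>R a) \<le> 1" unfolding eq using pos by simp
    show "(q - c) \<bullet> ((1 / (b - a \<bullet> c)) *\<^sub>R a) = 1 \<longleftrightarrow> q \<in> T"
      unfolding eq ab(2) using pos q by auto
  qed
qed

lemma extreme_point_in_segment:
  assumes "x extreme_point_of S" "a \<in> S" "b \<in> S" "x \<in> closed_segment a b"
  shows "x = a \<or> x = b"
  using assms unfolding extreme_point_of_def open_segment_def by blast

text \<open>An edge is exposed and contains no third vertex, which gives the point \<open>p\<close>.
  Conversely, the face of \<open>Q\<close> on which the functional \<open>p\<close> attains its
  bound has only \<open>f i\<close> and \<open>f j\<close> as extreme points, so it is the segment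
  between them.\<close>

lemma polar_dual_edges:
  fixes Q :: "(real^'d) set" and f :: "'m::finite \<Rightarrow> real^'d"
  assumes d: "2 \<le> CARD('d)" and Q: "polytope Q" "aff_dim Q = int CARD('d)" and c: "c \<in> interior Q"
    and f: "bij_betw f UNIV {p. p extreme_point_of Q}" and ij: "i \<noteq> j"
  shows "closed_segment (f i) (f j) edge_of Q \<longleftrightarrow>
    (\<exists>p. (f i - c) \<bullet> p = 1 \<and> (f j - c) \<bullet> p = 1 \<and> (\<forall>k. k \<noteq> i \<longrightarrow> k \<noteq> j \<longrightarrow> (f k - c) \<bullet> p < 1))"
proof
  have inj: "f k = f l \<longleftrightarrow> k = l" for k l using f by (auto simp: bij_betw_def inj_on_def)
  have ext: "f k extreme_point_of Q" for k using f by (auto simp: bij_betw_def)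
  have fQ: "f k \<in> Q" for k using ext by (auto simp: extreme_point_of_def)
  {
    assume e: "closed_segment (f i) (f j) edge_of Q"
    then have "aff_dim (closed_segment (f i) (f j)) = 1" by (simp add: edge_of_def)
    then have "closed_segment (f i) (f j) \<noteq> Q" using Q(2) d by auto
    then obtain p where p: "\<And>q. q \<in> Q \<Longrightarrow> (q - c) \<bullet> p \<le> 1"
      "\<And>q. q \<in> Q \<Longrightarrow> (q - c) \<bullet> p = 1 \<longleftrightarrow> q \<in> closed_segment (f i) (f j)"
      using proper_face_dual_point[OF Q(1) c, of "closed_segment (f i) (f j)"] e unfolding edge_of_def by metis
    have "(f i - c) \<bullet> p = 1" "(f j - c) \<bullet> p = 1" using p(2)[OF fQ] by simp_all
    moreover have "(f k - c) \<bullet> p < 1" if "k \<noteq> i" "k \<noteq> j" for k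
    proof -
      have "f k \<notin> closed_segment (f i) (f j)"
        using extreme_point_in_segment[OF ext fQ fQ, of k i j] that inj by blast
      then show ?thesis using p(1)[OF fQ[of k]] p(2)[OF fQ[of k]] by linarith
    qed
    ultimately show "\<exists>p. (f i - c) \<bullet> p = 1 \<and> (f j - c) \<bullet> p = 1 \<and> (\<forall>k. k \<noteq> i \<longrightarrow> k \<noteq> j \<longrightarrow> (f k - c) \<bullet> p < 1)"
      by blast
  }
  assume "\<exists>p. (f i - c) \<bullet> p = 1 \<and> (f j - c) \<bullet> p = 1 \<and> (\<forall>k. k \<noteq> i \<longrightarrow> k \<noteq> j \<longrightarrow> (f k - c) \<bullet> p < 1)"
  then obtain p where p: "(f i - c) \<bullet> p = 1" "(f j - c) \<bullet> p = 1" "\<And>k. k \<noteq> i \<Longrightarrow> k \<noteq> j \<Longrightarrow> (f k - c) \<bullet> p < 1"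
    by blast
  have comp: "compact Q" "convex Q" using Q(1) by (simp_all add: polytope_imp_compact polytope_imp_convex)
  have le: "(f k - c) \<bullet> p \<le> 1" for k using p(1,2) p(3)[of k] by (cases "k = i"; cases "k = j") auto
  have hull: "Q = convex hull (range f)"
    using Krein_Milman_Minkowski[OF comp] f by (simp add: bij_betw_def)
  have "Q \<subseteq> {q. p \<bullet> q \<le> 1 + p \<bullet> c}"
    unfolding hull using le
    by (intro hull_minimal convex_halfspace_le) (auto simp: inner_diff_left inner_commute[of p] algebra_simps)
  define T where "T = Q \<inter> {q. p \<bullet> q = 1 + p \<bullet> c}"
  have T: "T face_of Q"
    unfolding T_def using \<open>Q \<subseteq> _\<close> by (intro face_of_Int_supporting_hyperplane_le comp(2)) auto
  have inT: "f k \<in> T \<longleftrightarrow> (f k - c) \<bullet> p = 1" for k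
    using fQ by (auto simp: T_def inner_diff_left inner_commute[of p])
  have "{x. x extreme_point_of T} = {f i, f j}"
  proof -
    have "{x. x extreme_point_of T} = range f \<inter> T"
      unfolding extreme_point_of_face[OF T] using f by (auto simp: bij_betw_def)
    also have "\<dots> = f ` {k. (f k - c) \<bullet> p = 1}" using inT by auto
    also have "{k. (f k - c) \<bullet> p = 1} = {i, j}" using p by (auto dest: less_imp_neq)
    finally show ?thesis by simp
  qed
  moreover have "compact T" "convex T"
    using face_of_imp_compact[OF comp(2,1) T] face_of_imp_convex[OF T] by auto
  ultimately have "T = closed_segment (f i) (f j)"
    using Krein_Milman_Minkowski[of T] by (simp add: segment_convex_hull)
  then show "closed_segment (f i) (f j) edge_of Q"
    using T ij inj by (simp add: edge_of_def segment_convex_hull aff_dim_convex_hull)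
qed

text \<open>These constraints describe the polar of \<open>Q\<close> about \<open>c\<close>. The
  dual point of the vertex \<open>f i\<close> is tight for constraint \<open>i\<close> only, which
  gives both the dimension of facet \<open>i\<close> and its distinctness from the others.\<close>

lemma polar_dual_has_outer_facet_normals:
  fixes Q :: "(real^'d) set" and f :: "'m::finite \<Rightarrow> real^'d"
  assumes d: "2 \<le> CARD('d)" and Q: "polytope Q" "aff_dim Q = int CARD('d)" and c: "c \<in> interior Q"
    and f: "bij_betw f UNIV {p. p extreme_point_of Q}"
  shows "has_outer_facet_normals (\<lambda>i. f i - c) (\<chi> i. 1)"
proof -
  let ?v = "\<lambda>i. f i - c" and ?x = "(\<chi> i. 1) :: real^'m"
  let ?P = "support_polytope ?v ?x"
  have inj: "f k = f l \<longleftrightarrow> k = l" for k l using f by (auto simp: bij_betw_def inj_on_def)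
  have ext: "f k extreme_point_of Q" for k using f by (auto simp: bij_betw_def)
  have fQ: "f k \<in> Q" for k using ext by (auto simp: extreme_point_of_def)
  have comp: "compact Q" "convex Q" using Q(1) by (simp_all add: polytope_imp_compact polytope_imp_convex)
  have hull: "Q = convex hull (range f)"
    using Krein_Milman_Minkowski[OF comp] f by (simp add: bij_betw_def)
  have v: "positively_spanning ?v"
    unfolding positively_spanning_def
  proof (intro allI impI)
    fix u assume u: "\<forall>i. ?v i \<bullet> u \<le> 0"
    \<comment> \<open>Otherwise a nonzero linear functional would attain its maximum over
      \<open>Q\<close> at the interior point \<open>c\<close>.\<close>
    have "Q \<subseteq> {q. u \<bullet> q \<le> u \<bullet> c}"
      unfolding hull using u
      by (intro hull_minimal convex_halfspace_le) (auto simp: inner_diff_left inner_commute[of u])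
    moreover obtain r where r: "r > 0" "ball c r \<subseteq> Q" using c by (auto simp: mem_interior)
    moreover have nu: "0 < norm u + 1" using norm_ge_zero[of u] by linarith
    have "c + (r / (2 * (norm u + 1))) *\<^sub>R u \<in> ball c r"
    proof -
      have "r * norm u < r * (2 * (norm u + 1))" using r(1) nu by (intro mult_strict_left_mono) simp_all
      then show ?thesis using r(1) nu by (simp add: dist_norm divide_less_eq)
    qed
    ultimately have "u \<bullet> (c + (r / (2 * (norm u + 1))) *\<^sub>R u) \<le> u \<bullet> c" by blast
    then have le: "(r / (2 * (norm u + 1))) * (u \<bullet> u) \<le> 0" by (simp add: inner_add_right)
    have "0 < r / (2 * (norm u + 1))" using r(1) nu by simp
    then have "u \<bullet> u \<le> 0" using le by (metis mult_le_cancel_left_pos mult_zero_right)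
    then show "u = 0" by (metis antisym inner_eq_zero_iff inner_ge_zero)
  qed
  have "polyhedron ?P"
  proof -
    have "?P = (\<Inter>i. {p. ?v i \<bullet> p \<le> 1})" by (auto simp: support_polytope_def)
    then show ?thesis by (auto intro!: polyhedron_Inter polyhedron_halfspace_le)
  qed
  then have poly: "polytope ?P"
    using compact_support_polytope[OF v] polytope_eq_bounded_polyhedron compact_imp_bounded by blast
  have "0 \<in> {p. \<forall>k. ?v k \<bullet> p < ?x $ k}" by simp
  moreover have "{p. \<forall>k. ?v k \<bullet> p < ?x $ k} \<subseteq> interior ?P"
    by (intro interior_maximal open_strict_polytope) (auto simp: support_polytope_def less_imp_le)
  ultimately have "interior ?P \<noteq> {}" by blast
  then have dimP: "aff_dim ?P = int CARD('d)" using aff_dim_nonempty_interior[of ?P] by simp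
  have point: "\<exists>p. ?v i \<bullet> p = 1 \<and> (\<forall>k. k \<noteq> i \<longrightarrow> ?v k \<bullet> p < 1)" for i
  proof -
    have face: "{f i} face_of Q" using ext by (simp add: face_of_singleton)
    have "{f i} \<noteq> Q" using Q(2) d by auto
    then obtain p where p: "\<And>q. q \<in> Q \<Longrightarrow> (q - c) \<bullet> p \<le> 1" "\<And>q. q \<in> Q \<Longrightarrow> (q - c) \<bullet> p = 1 \<longleftrightarrow> q \<in> {f i}"
      using proper_face_dual_point[OF Q(1) c face] by metis
    have "?v k \<bullet> p < 1" if "k \<noteq> i" for k
      using p(1)[OF fQ[of k]] p(2)[OF fQ[of k]] that inj by (simp add: less_le)
    then show ?thesis using p(2)[OF fQ[of i]] by blast
  qed
  have in_facet: "p \<in> support_facet ?v ?x i" if "?v i \<bullet> p = 1" "\<forall>k. k \<noteq> i \<longrightarrow> ?v k \<bullet> p < 1" for p i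
  proof -
    have "?v k \<bullet> p \<le> 1" for k using that by (cases "k = i") (auto simp: less_imp_le)
    then show ?thesis using that(1) by (simp add: support_facet_def support_polytope_def)
  qed
  have facet: "support_facet ?v ?x i facet_of ?P" for i
  proof -
    obtain p where p: "?v i \<bullet> p = 1" "\<forall>k. k \<noteq> i \<longrightarrow> ?v k \<bullet> p < 1" using point by blast
    have eq: "support_facet ?v ?x i = ?P \<inter> {q. ?v i \<bullet> q = 1}" by (auto simp: support_facet_def)
    have "support_facet ?v ?x i face_of ?P"
      unfolding eq by (rule face_of_Int_supporting_hyperplane_le[OF convex_support_polytope]) (auto simp: support_polytope_def)
    moreover have "support_facet ?v ?x i \<noteq> {}" using in_facet[OF p] by blast
    moreover have "aff_dim (support_facet ?v ?x i) = aff_dim ?P - 1"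
    proof -
      have "support_facet ?v ?x i = {q \<in> ?P. \<forall>j\<in>{i}. ?v j \<bullet> q = ?x $ j}" by (auto simp: support_facet_def)
      also have "aff_dim \<dots> = int CARD('d) - int (dim (?v ` {i}))"
        by (rule aff_dim_support_face[of "{i}" ?v p ?x]) (use p in auto)
      also have "?v i \<noteq> 0" using p(1) by auto
      then have "dim (?v ` {i}) = 1" by (simp add: dim_insert)
      finally show ?thesis by (simp add: dimP)
    qed
    ultimately show ?thesis by (simp add: facet_of_def)
  qed
  have "inj (support_facet ?v ?x)"
  proof (rule injI)
    fix i k assume eq: "support_facet ?v ?x i = support_facet ?v ?x k"
    obtain p where p: "?v i \<bullet> p = 1" "\<forall>k. k \<noteq> i \<longrightarrow> ?v k \<bullet> p < 1" using point by blast
    then have "p \<in> support_facet ?v ?x k" using in_facet eq by blast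
    then have "?v k \<bullet> p = 1" by (simp add: support_facet_def)
    then show "i = k" using p(2) by force
  qed
  then show ?thesis
    using poly dimP facet by (simp add: has_outer_facet_normals_def)
qed

lemma colin_de_verdiere_number_ge:
  fixes M :: "real^'n^'n"
  assumes "colin_de_verdiere_matrix G M"
  shows "corank M \<le> colin_de_verdiere_number G"
  unfolding colin_de_verdiere_number_def
proof (rule Max_ge)
  have "corank N \<le> CARD('n)" for N :: "real^'n^'n"
    unfolding corank_def using dim_subset_UNIV[of "{x. N *v x = 0}"] by simp
  then have "{corank M |M. colin_de_verdiere_matrix G M} \<subseteq> {..CARD('n)}" by auto
  then show "finite {corank M |M. colin_de_verdiere_matrix G M}" using finite_subset by blast
qed (use assms in blast)

lemma skeleton_colin_de_verdiere_number:
  fixes Q :: "(real^'d) set" and G :: "'m::finite \<Rightarrow> 'm \<Rightarrow> bool"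
  assumes d: "2 \<le> CARD('d)" and Q: "polytope Q" "aff_dim Q = int CARD('d)" and G: "realized_as_skeleton G Q"
  shows "CARD('d) \<le> colin_de_verdiere_number G"
proof -
  obtain f where f: "bij_betw f UNIV {p. p extreme_point_of Q}"
    and edges: "\<And>i j. G i j \<longleftrightarrow> i \<noteq> j \<and> closed_segment (f i) (f j) edge_of Q"
    using G unfolding realized_as_skeleton_def by blast
  have "aff_dim Q = int DIM(real^'d)" using Q(2) by simp
  then have "interior Q = rel_interior Q" by (metis interior_rel_interior_gen)
  moreover have "Q \<noteq> {}" using Q(2) by auto
  ultimately have "interior Q \<noteq> {}" using rel_interior_eq_empty polytope_imp_convex[OF Q(1)] by metis
  then obtain c where c: "c \<in> interior Q" by blast
  define v where "v i = f i - c" for i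
  define x :: "real^'m" where "x = (\<chi> i. 1)"
  have H: "has_outer_facet_normals v x"
    unfolding v_def[abs_def] x_def by (rule polar_dual_has_outer_facet_normals[OF d Q c f])
  have nz: "v k \<noteq> 0" for k using has_outer_facet_normals_strict_point[OF H] by blast
  have face: "support_facet v x i face_of support_polytope v x" for i
    using H by (simp add: has_outer_facet_normals_def facet_of_imp_face_of)
  have "dual_skeleton v x i j \<longleftrightarrow> G i j" for i j
    unfolding dual_skeleton_iff[OF has_outer_facet_normals_general_position[OF H] nz face d] edges
    using polar_dual_edges[OF d Q c f, of i j] by (auto simp: v_def x_def)
  then have "dual_skeleton v x = G" by (simp add: fun_eq_iff)
  moreover define M :: "real^'m^'m" where "M = (\<chi> i j. - partial_deriv i (partial_deriv j (support_volume v)) x)"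
  ultimately have "colin_de_verdiere_matrix G M" "corank M = CARD('d)"
    using volume_hessian_colin_de_verdiere[OF d H, of M] by simp_all
  then show ?thesis using colin_de_verdiere_number_ge[of G M] by simp
qed

theorem theorem2p4:
  assumes "CARD('d::finite) \<ge> 2"
  shows "(\<forall>(v :: 'n::finite \<Rightarrow> real^'d) (x0 :: real^'n) (M :: real^'n^'n).
            has_outer_facet_normals v x0 \<and>
            (\<forall>i j. M $ i $ j = - partial_deriv i (partial_deriv j (support_volume v)) x0) \<longrightarrow>
            colin_de_verdiere_matrix (dual_skeleton v x0) M \<and> corank M = CARD('d)) \<and>
         (\<forall>(G :: 'm::finite \<Rightarrow> 'm \<Rightarrow> bool) (Q :: (real^'d) set).
            polytope Q \<and> aff_dim Q = int CARD('d) \<and> realized_as_skeleton G Q \<longrightarrow>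
            colin_de_verdiere_number G \<ge> CARD('d))"
proof (intro conjI allI impI; elim conjE)
  fix v :: "'n \<Rightarrow> real^'d" and x0 M
  assume "has_outer_facet_normals v x0"
    and "\<forall>i j. M $ i $ j = - partial_deriv i (partial_deriv j (support_volume v)) x0"
  then have "colin_de_verdiere_matrix (dual_skeleton v x0) M \<and> corank M = CARD('d)"
    by (intro volume_hessian_colin_de_verdiere[OF assms]) auto
  then show "colin_de_verdiere_matrix (dual_skeleton v x0) M" "corank M = CARD('d)" by simp_all
next
  fix G :: "'m \<Rightarrow> 'm \<Rightarrow> bool" and Q :: "(real^'d) set"
  assume "polytope Q" "aff_dim Q = int CARD('d)" "realized_as_skeleton G Q"
  then show "CARD('d) \<le> colin_de_verdiere_number G" by (rule skeleton_colin_de_verdiere_number[OF assms])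
qed

end
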